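(* Let $G$ be a graph with $n$ vertices, suppose that $\pi=\{W_1,\ldots,W_m\}$ is a clique vertex-partition of $G$, and let $G^{\pi}$ be the corresponding fully clique-whiskered graph. Let $\mathbb{K}$ be a field, let $S$ be the polynomial ring over $\mathbb{K}$ whose variables are the $n+m$ vertices of $G^{\pi}$, and let $J(G^{\pi})\subset S$ be the cover ideal of $G^{\pi}$. Then $$\operatorname{depth}(S/J(G^{\pi})^{(k)})=\begin{cases} n+m-\alpha(G)-1 & \text{if } k=1,\\ n-1 & \text{if } k\geq 2,\end{cases}$$ where $\alpha(G)$ is the independence number of $G$. In particular, $\operatorname{sdstab}(J(G^{\pi}))\leq 2$.
   Context: Graphs are finite and simple; the vertices of a graph are identified with the variables of the polynomial ring. A subset $W\subseteq V(G)$ is a clique of $G$ if every pair of distinct vertices of $W$ is adjacent in $G$. A clique vertex-partition of $G$ is a partition $\pi=\{W_1,\ldots,W_m\}$ of $V(G)$ (into nonempty sets) such that each $W_i$ is a clique of $G$. The fully clique-whiskered graph $G^{\pi}$ is obtained from $G$ by adding new vertices $y_1,\ldots,y_m$ and new edges $\{x,y_i\}$ for every $x\in W_i$ and every $1\leq i\leq m$. The independence number $\alpha(G)$ is the largest cardinality of a subset of $V(G)$ containing no two adjacent vertices. For a graph $H$, the cover ideal is $J(H)=\bigcap_{\{u,v\}\in E(H)}(u,v)$ in the polynomial ring over $\mathbb{K}$ on $V(H)$. For an ideal $I\subset S$ and an integer $k\geq 1$, the $k$-th symbolic power is $I^{(k)}=\bigcap_{\mathfrak{p}\in\operatorname{Min}(I)}\operatorname{Ker}(S\to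 (S/I^k)_{\mathfrak{p}})$, where $\operatorname{Min}(I)$ is the set of minimal primes of $I$; in particular $J(H)^{(k)}=\bigcap_{\{u,v\}\in E(H)}(u,v)^k$. Depth is taken with respect to the graded maximal ideal of $S$. For a squarefree monomial ideal $I\subset S$, the sequence $\{\operatorname{depth}(S/I^{(k)})\}_{k\geq 1}$ is convergent, and the index of depth stability of symbolic powers $\operatorname{sdstab}(I)$ is the smallest integer $k\geq 1$ such that $\operatorname{depth}(S/I^{(m)})=\lim_{t\to\infty}\operatorname{depth}(S/I^{(t)})$ for all $m\geq k$. *)

theory Defs
  imports
    "HOL-Algebra.Algebra"
    "HOL-Algebra.Algebraic_Closure_Type"
    "HOL-Library.Poly_Mapping"
    "HOL-Library.Disjoint_Sets"
    "HOL-Library.Cardinality"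
    "HOL-Library.Extended_Real"
begin

section \<open>Graphs\<close>

text \<open>
  A graph on a vertex type is given by its set of edges; the vertex set is the whole (finite) type.
\<close>

definition simple_graph :: "'v set set \<Rightarrow> bool" where
  "simple_graph E \<longleftrightarrow> (\<forall>e\<in>E. card e = 2)"

definition clique :: "'v set set \<Rightarrow> 'v set \<Rightarrow> bool" where
  "clique E W \<longleftrightarrow> (\<forall>x\<in>W. \<forall>y\<in>W. x \<noteq> y \<longrightarrow> {x, y} \<in> E)"

definition clique_vertex_partition :: "'v set set \<Rightarrow> 'v set set \<Rightarrow> bool" where
  "clique_vertex_partition E P \<longleftrightarrow> partition_on UNIV P \<and> (\<forall>W\<in>P. clique E W)"

definition independent_set :: "'v set set \<Rightarrow> 'v set \<Rightarrow> bool" where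
  "independent_set E A \<longleftrightarrow> (\<forall>x\<in>A. \<forall>y\<in>A. {x, y} \<notin> E)"

definition independence_number :: "'v::finite set set \<Rightarrow> nat" where
  "independence_number E = Max {card A | A. independent_set E A}"

text \<open>
  For a family \<open>W\<close> of sets of vertices, the new vertex attached to all of \<open>W i\<close> is \<open>Inr i\<close>.
\<close>

definition clique_whiskered :: "'v set set \<Rightarrow> ('i \<Rightarrow> 'v set) \<Rightarrow> ('v + 'i) set set" where
  "clique_whiskered E W = (\<lambda>e. Inl ` e) ` E \<union> {{Inl x, Inr i} | x i. x \<in> W i}"


section \<open>Localization, symbolic powers and depth\<close>

definition quot_module :: "('a, 'r) ring_scheme \<Rightarrow> 'a set \<Rightarrow> ('a, 'a set) module" where
  "quot_module R I = ring.extend (R Quot I)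
     (module.fields (\<lambda>a Y. (I +>\<^bsub>R\<^esub> a) \<otimes>\<^bsub>R Quot I\<^esub> Y))"

text \<open>
  The fractions \<open>u/s\<close> and \<open>v/t\<close> of the localization \<open>M\<^sub>P\<close> are equal iff
  \<open>w(tu) = w(sv)\<close> for some \<open>w \<notin> P\<close>; the elements of \<open>M\<^sub>P\<close> are the equivalence classes.
\<close>

definition fraction_rel ::
  "('a, 'r) ring_scheme \<Rightarrow> ('a, 'm, 's) module_scheme \<Rightarrow> 'a set \<Rightarrow> (('m \<times> 'a) \<times> ('m \<times> 'a)) set" where
  "fraction_rel R M P = {((u, s), (v, t)) | u s v t.
     u \<in> carrier M \<and> v \<in> carrier M \<and> s \<in> carrier R - P \<and> t \<in> carrier R - P \<and>
     (\<exists>w \<in> carrier R - P. w \<odot>\<^bsub>M\<^esub> (t \<odot>\<^bsub>M\<^esub> u) = w \<odot>\<^bsub>M\<^esub> (s \<odot>\<^bsub>M\<^esub> v))}"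

definition fraction ::
  "('a, 'r) ring_scheme \<Rightarrow> ('a, 'm, 's) module_scheme \<Rightarrow> 'a set \<Rightarrow> 'm \<Rightarrow> 'a \<Rightarrow> ('m \<times> 'a) set" where
  "fraction R M P u s = fraction_rel R M P `` {(u, s)}"

definition kernel_to_localization :: "('a, 'r) ring_scheme \<Rightarrow> 'a set \<Rightarrow> 'a set \<Rightarrow> 'a set" where
  "kernel_to_localization R I P = {f \<in> carrier R.
     fraction R (quot_module R I) P (I +>\<^bsub>R\<^esub> f) \<one>\<^bsub>R\<^esub> =
     fraction R (quot_module R I) P \<zero>\<^bsub>quot_module R I\<^esub> \<one>\<^bsub>R\<^esub>}"

definition minimal_primes :: "('a, 'r) ring_scheme \<Rightarrow> 'a set \<Rightarrow> 'a set set" where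
  "minimal_primes R I = {P. primeideal P R \<and> I \<subseteq> P \<and>
     (\<forall>Q. primeideal Q R \<and> I \<subseteq> Q \<and> Q \<subseteq> P \<longrightarrow> Q = P)}"

definition symbolic_power :: "('a, 'r) ring_scheme \<Rightarrow> 'a set \<Rightarrow> nat \<Rightarrow> 'a set" where
  "symbolic_power R I k = carrier R \<inter>
     (\<Inter>P\<in>minimal_primes R I. kernel_to_localization R (I [^]\<^bsub>ideals_set R\<^esub> k) P)"

text \<open>The submodule \<open>(x\<^sub>1, \<dots>, x\<^sub>r)M\<close>.\<close>

definition seq_submodule :: "('a, 'm, 's) module_scheme \<Rightarrow> 'a list \<Rightarrow> 'm set" where
  "seq_submodule M xs =
     {finsum M (\<lambda>i. (xs ! i) \<odot>\<^bsub>M\<^esub> u i) {..<length xs} | u. u \<in> {..<length xs} \<rightarrow> carrier M}"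

text \<open>
  The first condition says that \<open>x\<^sub>i\<close> is a nonzerodivisor on \<open>M/(x\<^sub>1, \<dots>, x\<^sub>i\<^sub>-\<^sub>1)M\<close>,
  the second that \<open>M/(x\<^sub>1, \<dots>, x\<^sub>r)M\<close> is nonzero.
\<close>

definition regular_sequence ::
  "('a, 'r) ring_scheme \<Rightarrow> ('a, 'm, 's) module_scheme \<Rightarrow> 'a list \<Rightarrow> bool" where
  "regular_sequence R M xs \<longleftrightarrow> set xs \<subseteq> carrier R \<and>
     (\<forall>i<length xs. \<forall>u\<in>carrier M.
        (xs ! i) \<odot>\<^bsub>M\<^esub> u \<in> seq_submodule M (take i xs) \<longrightarrow> u \<in> seq_submodule M (take i xs)) \<and>
     seq_submodule M xs \<noteq> carrier M"

definition depth ::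
  "('a, 'r) ring_scheme \<Rightarrow> 'a set \<Rightarrow> ('a, 'm, 's) module_scheme \<Rightarrow> enat" where
  "depth R \<mm> M = (SUP xs \<in> {xs. set xs \<subseteq> \<mm> \<and> regular_sequence R M xs}. enat (length xs))"


section \<open>Polynomial rings and cover ideals\<close>

type_synonym ('v, 'k) mpoly = "('v \<Rightarrow>\<^sub>0 nat) \<Rightarrow>\<^sub>0 'k"

abbreviation mpoly_ring :: "('v, 'k::field) mpoly ring" where
  "mpoly_ring \<equiv> ring_of_type_algebra"

definition var :: "'v \<Rightarrow> ('v, 'k::field) mpoly" where
  "var v = Poly_Mapping.single (Poly_Mapping.single v 1) 1"

definition graded_maximal_ideal :: "('v, 'k::field) mpoly set" where
  "graded_maximal_ideal = Idl\<^bsub>mpoly_ring\<^esub> (range var)"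

definition cover_ideal :: "'v set set \<Rightarrow> ('v, 'k::field) mpoly set" where
  "cover_ideal E = (\<Inter>e\<in>E. Idl\<^bsub>mpoly_ring\<^esub> (var ` e))"

definition depth_quot :: "('v, 'k::field) mpoly set \<Rightarrow> enat" where
  "depth_quot I = depth mpoly_ring graded_maximal_ideal (quot_module mpoly_ring I)"

text \<open>
  For a squarefree monomial ideal the limit exists (in the order topology of \<^typ>\<open>enat\<close>), and
  so does the least \<open>k\<close>.
\<close>

definition sdstab :: "('v, 'k::field) mpoly set \<Rightarrow> nat" where
  "sdstab I = (LEAST k. 1 \<le> k \<and> (\<forall>j\<ge>k.
     depth_quot (symbolic_power mpoly_ring I j) = lim (\<lambda>t. depth_quot (symbolic_power mpoly_ring I t))))"

end

theory Submission
  imports Defs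
begin

text \<open>
  Write \<open>S\<close> for the polynomial ring, \<open>N = n + m\<close> for the number of its variables, \<open>H\<close> for the
  whiskered graph, and \<open>J\<close> for its cover ideal. The minimal primes of \<open>J\<close> are the ideals \<open>(u, v)\<close>
  for the edges \<open>{u, v}\<close> of \<open>H\<close>, and the order at such a prime is a valuation; hence the symbolic
  power \<open>J\<^sup>(\<^sup>k\<^sup>)\<close> is spanned by the monomials \<open>x\<^sup>a\<close> with \<open>a\<^sub>u + a\<^sub>v \<ge> k\<close> for all edges \<open>{u, v}\<close>
  (\<open>symbolic_power_cover_ideal\<close>). All modules that occur are of the form \<open>S/Q\<close>, so that regular
  sequences can be treated in terms of ideals only (\<open>regular_sequence_iff_wreg\<close>). Both bounds for the
  depth involve the number \<open>t = \<alpha>(G)\<close> for \<open>k = 1\<close> and \<open>t = m\<close> for \<open>k \<ge> 2\<close>; the claim is that the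
  depth is \<open>N - t - 1\<close>.

  Lower bound. Repeatedly splitting along \<open>0 \<rightarrow> S/(Q : v) \<rightarrow> S/Q \<rightarrow> S/(Q + (v)) \<rightarrow> 0\<close>, for variables
  \<open>v\<close>, yields a filtration of \<open>S/J\<^sup>(\<^sup>k\<^sup>)\<close> with quotients \<open>S/(Z)\<close>, where \<open>Z\<close> is a set of variables.
  For \<open>k \<ge> 2\<close> it is arranged that, before a violated edge is made part of \<open>Z\<close>, the set \<open>Z\<close> consists
  of vertices of exponent less than \<open>k/2\<close>, at most one from each of the \<open>m\<close> cliques
  \<open>W\<^sub>i \<union> {y\<^sub>i}\<close>; for \<open>k = 1\<close> it is an independent set of \<open>G\<close>. The violated edge adds at most one
  further vertex, so that \<open>|Z| \<le> t + 1\<close>. The elementary symmetric polynomials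
  \<open>e\<^sub>1, \<dots>, e\<^sub>d\<close> with \<open>d = N - t - 1\<close> form a regular sequence on each \<open>S/(Z)\<close>
  (\<open>wreg_esym\<close>), hence on \<open>S/J\<^sup>(\<^sup>k\<^sup>)\<close>.

  Upper bound. If \<open>z\<close> generates the maximal ideal up to radical, the Koszul cohomology
  \<open>H\<^sup>i(z; S/Q)\<close> vanishes for all \<open>i\<close> less than the length of a regular sequence
  (\<open>koszul_vanishing\<close>). Choose \<open>t\<close> whiskers \<open>{x\<^sub>i, y\<^sub>i}\<close>, those at a maximum independent set for
  \<open>k = 1\<close> and one at each clique for \<open>k \<ge> 2\<close>. Colon by a suitable monomial turns \<open>J\<^sup>(\<^sup>k\<^sup>)\<close>
  into the product of the \<open>t\<close> ideals \<open>(x\<^sub>i, y\<^sub>i)\<close>, whose Stanley-Reisner complex, on the \<open>2t\<close>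
  variables involved, is homotopy equivalent to a sphere of dimension \<open>t - 2\<close>; the corresponding
  class for the powers of the variables is a nonzero element of \<open>H\<^sup>N\<^sup>-\<^sup>t\<^sup>-\<^sup>1\<close> (\<open>no_long_regular_sequence\<close>).
\<close>

section \<open>Ideals and regular sequences\<close>

text \<open>Ideals of a commutative ring that is given as a type.\<close>

definition is_ideal :: "'r::comm_ring_1 set \<Rightarrow> bool" where
  "is_ideal Q \<longleftrightarrow> 0 \<in> Q \<and> (\<forall>x\<in>Q. \<forall>y\<in>Q. x + y \<in> Q) \<and> (\<forall>x\<in>Q. \<forall>r. r * x \<in> Q)"

lemma is_idealI:
  assumes "0 \<in> Q" "\<And>x y. x \<in> Q \<Longrightarrow> y \<in> Q \<Longrightarrow> x + y \<in> Q" "\<And>r x. x \<in> Q \<Longrightarrow> r * x \<in> Q"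
  shows "is_ideal Q"
  using assms unfolding is_ideal_def by blast

lemma is_idealD:
  assumes "is_ideal Q"
  shows is_ideal_zero: "0 \<in> Q"
    and is_ideal_add: "\<And>x y. x \<in> Q \<Longrightarrow> y \<in> Q \<Longrightarrow> x + y \<in> Q"
    and is_ideal_mult: "\<And>r x. x \<in> Q \<Longrightarrow> r * x \<in> Q"
    and is_ideal_mult_right: "\<And>r x. x \<in> Q \<Longrightarrow> x * r \<in> Q"
    and is_ideal_uminus: "\<And>x. x \<in> Q \<Longrightarrow> - x \<in> Q"
    and is_ideal_diff: "\<And>x y. x \<in> Q \<Longrightarrow> y \<in> Q \<Longrightarrow> x - y \<in> Q"
proof -
  show 0: "0 \<in> Q" and a: "\<And>x y. x \<in> Q \<Longrightarrow> y \<in> Q \<Longrightarrow> x + y \<in> Q"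
    and m: "\<And>r x. x \<in> Q \<Longrightarrow> r * x \<in> Q"
    using assms unfolding is_ideal_def by blast+
  show "x * r \<in> Q" if "x \<in> Q" for r x
    using m[OF that, of r] by (simp add: mult.commute)
  show n: "- x \<in> Q" if "x \<in> Q" for x
    using m[OF that, of "-1"] by simp
  show "x - y \<in> Q" if "x \<in> Q" "y \<in> Q" for x y
    using a[OF that(1) n[OF that(2)]] by simp
qed

lemma is_ideal_sum:
  assumes "is_ideal Q" "\<And>i. i \<in> A \<Longrightarrow> f i \<in> Q"
  shows "sum f A \<in> Q"
  using assms(2)
  by (induction A rule: infinite_finite_induct) (auto intro: is_idealD[OF assms(1)])

text \<open>The ideals \<open>Q + (g)\<close> and \<open>Q : g\<close>.\<close>

definition adjoin :: "'r::comm_ring_1 set \<Rightarrow> 'r \<Rightarrow> 'r set" where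
  "adjoin Q g = {q + g * u | q u. q \<in> Q}"

definition colon :: "'r::comm_ring_1 set \<Rightarrow> 'r \<Rightarrow> 'r set" where
  "colon Q g = {u. g * u \<in> Q}"

lemma adjoinI: "q \<in> Q \<Longrightarrow> x = q + g * u \<Longrightarrow> x \<in> adjoin Q g"
  unfolding adjoin_def by blast

lemma adjoinE:
  assumes "x \<in> adjoin Q g"
  obtains q u where "q \<in> Q" "x = q + g * u"
  using assms unfolding adjoin_def by blast

lemma is_ideal_adjoin:
  assumes "is_ideal Q"
  shows "is_ideal (adjoin Q g)"
proof (rule is_idealI)
  note Q = is_idealD[OF assms]
  show "0 \<in> adjoin Q g" by (rule adjoinI[OF Q(1), of _ g 0]) simp
  show "x + y \<in> adjoin Q g" if xy: "x \<in> adjoin Q g" "y \<in> adjoin Q g" for x y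
  proof -
    obtain q u where x: "q \<in> Q" "x = q + g * u" using xy(1) by (rule adjoinE)
    obtain q' u' where y: "q' \<in> Q" "y = q' + g * u'" using xy(2) by (rule adjoinE)
    show ?thesis
      by (rule adjoinI[OF Q(2)[OF x(1) y(1)], of _ g "u + u'"]) (simp add: x y algebra_simps)
  qed
  show "r * x \<in> adjoin Q g" if xy: "x \<in> adjoin Q g" for r x
  proof -
    obtain q u where x: "q \<in> Q" "x = q + g * u" using xy(1) by (rule adjoinE)
    show ?thesis
      by (rule adjoinI[OF Q(3)[OF x(1), of r], of _ g "r * u"]) (simp add: x algebra_simps)
  qed
qed

lemma subset_adjoin: "Q \<subseteq> adjoin Q g"
proof
  fix x assume "x \<in> Q"
  then show "x \<in> adjoin Q g" by (intro adjoinI[of x _ _ _ 0]) auto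
qed

lemma adjoin_commute: "adjoin (adjoin Q f) g = adjoin (adjoin Q g) f"
proof -
  have "adjoin (adjoin Q f) g \<subseteq> adjoin (adjoin Q g) f" for f g
  proof
    fix x assume "x \<in> adjoin (adjoin Q f) g"
    then obtain q u v where "q \<in> Q" "x = q + f * u + g * v"
      by (metis adjoinE)
    then show "x \<in> adjoin (adjoin Q g) f"
      by (intro adjoinI[of "q + g * v" _ x f u] adjoinI[of q _ _ g v]) (auto simp: algebra_simps)
  qed
  then show ?thesis by blast
qed

lemma adjoin_subset:
  assumes "is_ideal Q'" "Q \<subseteq> Q'" "g \<in> Q'"
  shows "adjoin Q g \<subseteq> Q'"
  using assms(2,3) by (auto elim!: adjoinE intro!: is_idealD[OF assms(1)])

text \<open>
  Regular sequences on \<open>R/Q\<close>, without the requirement that the final quotient is nonzero;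
  \<open>adjoins Q [f\<^sub>1, \<dots>, f\<^sub>r]\<close> is the ideal \<open>Q + (f\<^sub>1, \<dots>, f\<^sub>r)\<close>.
\<close>

fun wreg :: "'r::comm_ring_1 set \<Rightarrow> 'r list \<Rightarrow> bool" where
  "wreg Q [] \<longleftrightarrow> True"
| "wreg Q (f # fs) \<longleftrightarrow> (\<forall>u. f * u \<in> Q \<longrightarrow> u \<in> Q) \<and> wreg (adjoin Q f) fs"

abbreviation adjoins :: "'r::comm_ring_1 set \<Rightarrow> 'r list \<Rightarrow> 'r set" where
  "adjoins \<equiv> foldl adjoin"

lemma is_ideal_adjoins: "is_ideal Q \<Longrightarrow> is_ideal (adjoins Q fs)"
  by (induction fs arbitrary: Q) (auto simp: is_ideal_adjoin)

lemma wreg_append: "wreg Q (fs @ gs) \<longleftrightarrow> wreg Q fs \<and> wreg (adjoins Q fs) gs"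
  by (induction fs arbitrary: Q) auto

lemma wreg_UNIV: "wreg UNIV fs"
proof (induction fs)
  case (Cons f fs)
  have "adjoin UNIV f = UNIV" using subset_adjoin[of UNIV f] by auto
  with Cons show ?case by simp
qed simp

text \<open>
  Regularity passes from the outer terms of \<open>0 \<rightarrow> R/(Q:g) \<rightarrow> R/Q \<rightarrow> R/(Q+(g)) \<rightarrow> 0\<close>
  to the middle one.
\<close>

lemma wreg_extension:
  assumes "is_ideal Q" "wreg (colon Q g) fs" "wreg (adjoin Q g) fs"
  shows "wreg Q fs"
  using assms
proof (induction fs arbitrary: Q)
  case (Cons f fs)
  note Q = is_idealD[OF Cons.prems(1)]
  have r1: "u \<in> colon Q g" if "f * u \<in> colon Q g" for u using Cons.prems(2) that by simp
  have r2: "u \<in> adjoin Q g" if "f * u \<in> adjoin Q g" for u using Cons.prems(3) that by simp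
  have reg: "u \<in> Q" if u: "f * u \<in> Q" for u
  proof -
    have "u \<in> adjoin Q g" using r2 u subset_adjoin[of Q g] by blast
    then obtain q v where v: "q \<in> Q" "u = q + g * v" by (rule adjoinE)
    have "g * (f * v) = f * u - f * q" by (simp add: v algebra_simps)
    then have "f * v \<in> colon Q g" using Q u v by (auto simp: colon_def)
    then have "g * v \<in> Q" using r1 by (auto simp: colon_def)
    then show ?thesis using Q v by auto
  qed
  have "colon (adjoin Q f) g = adjoin (colon Q g) f"
  proof (intro equalityI subsetI)
    fix u assume "u \<in> colon (adjoin Q f) g"
    then obtain q v where v: "q \<in> Q" "g * u = q + f * v" by (auto simp: colon_def elim: adjoinE)
    have "f * v \<in> adjoin Q g"
      by (rule adjoinI[of "- q" _ _ _ u]) (auto simp: v Q)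
    then obtain q' v' where v': "q' \<in> Q" "v = q' + g * v'" using r2 by (metis adjoinE)
    have "g * (u - f * v') = q + f * q'" using v v' by (simp add: algebra_simps)
    then have "u - f * v' \<in> colon Q g" using Q v v' by (auto simp: colon_def)
    then show "u \<in> adjoin (colon Q g) f" by (rule adjoinI[of _ _ _ _ v']) simp
  next
    fix u assume "u \<in> adjoin (colon Q g) f"
    then obtain q v where v: "g * q \<in> Q" "u = q + f * v" by (auto simp: colon_def elim: adjoinE)
    then show "u \<in> colon (adjoin Q f) g"
      by (auto simp: colon_def algebra_simps intro!: adjoinI[of "g * q" _ _ _ "g * v"])
  qed
  moreover have "wreg (adjoin (colon Q g) f) fs" "wreg (adjoin (adjoin Q g) f) fs"
    using Cons.prems(2,3) by (simp_all only: wreg.simps)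
  ultimately have "wreg (colon (adjoin Q f) g) fs" "wreg (adjoin (adjoin Q f) g) fs"
    by (simp_all only: adjoin_commute[of Q f g])
  then have "wreg (adjoin Q f) fs"
    by (rule Cons.IH[OF is_ideal_adjoin[OF Cons.prems(1)]])
  with reg show ?case unfolding wreg.simps by blast
qed simp

section \<open>Koszul cochains\<close>

text \<open>
  A cochain with values in \<open>R\<close> assigns an element of \<open>R\<close> to every set of basis vectors \<open>e\<^sub>v\<close>,
  which stands for the coefficient of the exterior product of these vectors. The vectors are ordered
  by \<open>to_nat\<close>, and \<open>ksign v s\<close> is the sign of moving \<open>e\<^sub>v\<close> to its place among the vectors in \<open>s\<close>.
  Exterior multiplication by \<open>\<Sum> w\<^sub>v e\<^sub>v\<close> is \<open>wedge w\<close>, and \<open>contract v\<close> is the contraction with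
  the dual vector of \<open>e\<^sub>v\<close>. The Koszul differential for a family \<open>z\<close> is \<open>wedge z\<close>.
\<close>

definition ksign :: "'v::countable \<Rightarrow> 'v set \<Rightarrow> 'r::comm_ring_1" where
  "ksign v s = (- 1) ^ card {w \<in> s. to_nat w < to_nat v}"

definition wedge :: "('v::finite \<Rightarrow> 'r) \<Rightarrow> ('v set \<Rightarrow> 'r) \<Rightarrow> 'v set \<Rightarrow> 'r::comm_ring_1" where
  "wedge w c s = (\<Sum>v\<in>s. w v * (ksign v s * c (s - {v})))"

definition contract :: "'v::finite \<Rightarrow> ('v set \<Rightarrow> 'r) \<Rightarrow> 'v set \<Rightarrow> 'r::comm_ring_1" where
  "contract v c s = (if v \<in> s then 0 else ksign v s * c (insert v s))"

lemma ksign_square [simp]: "ksign v s * ksign v s = 1"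
  by (simp add: ksign_def flip: power_mult_distrib)

lemma ksign_square_mult [simp]: "ksign v s * (ksign v s * x) = x"
  by (simp add: mult.assoc[symmetric])

lemma ksign_remove_self: "ksign v (s - {v}) = ksign v s"
  unfolding ksign_def by (rule arg_cong[of _ _ "\<lambda>A. (- 1) ^ card A"]) auto

lemma ksign_insert_self: "ksign v (insert v s) = ksign v s"
  unfolding ksign_def by (rule arg_cong[of _ _ "\<lambda>A. (- 1) ^ card A"]) auto

lemma ksign_remove:
  fixes s :: "'v::finite set"
  assumes "u \<in> s"
  shows "ksign v (s - {u}) = (if to_nat u < to_nat v then - 1 else 1) * ksign v s"
proof (cases "to_nat u < to_nat v")
  case True
  have "{w \<in> s. to_nat w < to_nat v} = insert u {w \<in> s - {u}. to_nat w < to_nat v}"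
    using True assms by auto
  then have "card {w \<in> s. to_nat w < to_nat v} = Suc (card {w \<in> s - {u}. to_nat w < to_nat v})"
    by (metis (no_types, lifting) DiffE card_insert_disjoint finite mem_Collect_eq singletonI)
  then show ?thesis using True by (simp add: ksign_def)
next
  case False
  then have "{w \<in> s - {u}. to_nat w < to_nat v} = {w \<in> s. to_nat w < to_nat v}" by auto
  then show ?thesis using False by (simp add: ksign_def)
qed

lemma ksign_swap:
  fixes s :: "'v::finite set"
  assumes "u \<in> s" "v \<in> s" "u \<noteq> v"
  shows "ksign u s * ksign v (s - {u}) = - (ksign v s * ksign u (s - {v}))"
proof -
  have "to_nat u \<noteq> to_nat v" using assms by simp
  then show ?thesis using assms by (auto simp: ksign_remove algebra_simps)
qed

lemma wedge_add_left: "wedge (\<lambda>v. w v + w' v) c s = wedge w c s + wedge w' c s"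
  by (simp add: wedge_def algebra_simps sum.distrib)

lemma wedge_add: "wedge w (\<lambda>s. c s + c' s) s = wedge w c s + wedge w c' s"
  by (simp add: wedge_def algebra_simps sum.distrib)

lemma wedge_diff: "wedge w (\<lambda>s. c s - c' s) s = wedge w c s - wedge w c' s"
  by (simp add: wedge_def algebra_simps sum_subtractf)

lemma wedge_smult: "wedge w (\<lambda>s. r * c s) s = r * wedge w c s"
  by (simp add: wedge_def algebra_simps sum_distrib_left)

lemma wedge_smult_left: "wedge (\<lambda>v. r * w v) c s = r * wedge w c s"
  by (simp add: wedge_def algebra_simps sum_distrib_left)

lemma wedge_zero [simp]: "wedge w (\<lambda>s. 0) s = 0"
  by (simp add: wedge_def)

lemma wedge_zero_left [simp]: "wedge (\<lambda>v. 0) c s = 0"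
  by (simp add: wedge_def)

lemma wedge_sum: "wedge w (\<lambda>s. \<Sum>i\<in>A. c i s) s = (\<Sum>i\<in>A. wedge w (c i) s)"
  by (induction A rule: infinite_finite_induct) (auto simp: wedge_add)

lemma wedge_sum_left: "wedge (\<lambda>v. \<Sum>i\<in>A. w i v) c s = (\<Sum>i\<in>A. wedge (w i) c s)"
  by (induction A rule: infinite_finite_induct) (auto simp: wedge_add_left)

lemma wedge_in_ideal:
  assumes "is_ideal Q" "\<And>s. c s \<in> Q"
  shows "wedge w c s \<in> Q"
  unfolding wedge_def using assms
  by (intro is_ideal_sum is_ideal_mult) auto

lemma sum_antisymmetric_eq_0:
  fixes F :: "'a \<Rightarrow> 'a \<Rightarrow> 'b::ab_group_add"
  assumes "finite A" "\<And>u v. u \<in> A \<Longrightarrow> v \<in> A \<Longrightarrow> F u v = - F v u" "\<And>u. u \<in> A \<Longrightarrow> F u u = 0"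
  shows "(\<Sum>u\<in>A. \<Sum>v\<in>A. F u v) = 0"
  using assms
proof (induction A rule: finite_induct)
  case (insert x A)
  have "(\<Sum>u\<in>A. F u x) = - (\<Sum>v\<in>A. F x v)"
    unfolding sum_negf[symmetric] by (rule sum.cong[OF refl], rule insert.prems(1)) auto
  moreover have "(\<Sum>u\<in>A. \<Sum>v\<in>A. F u v) = 0" "F x x = 0"
    by (rule insert.IH, rule insert.prems(1), auto intro: insert.prems(2))
  ultimately show ?case using insert.hyps by (simp add: sum.distrib)
qed simp

lemma wedge_wedge_eq:
  "wedge w (wedge w' c) s = (\<Sum>u\<in>s. \<Sum>v\<in>s.
     if u = v then 0 else w u * w' v * (ksign u s * ksign v (s - {u}) * c (s - {u, v})))"
  unfolding wedge_def
proof (intro sum.cong refl)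
  fix u assume u: "u \<in> s"
  have "(\<Sum>v\<in>s. if u = v then 0 else w u * w' v * (ksign u s * ksign v (s - {u}) * c (s - {u, v})))
      = (\<Sum>v\<in>s - {u}. w u * w' v * (ksign u s * ksign v (s - {u}) * c (s - {u, v})))"
    using u by (simp add: sum.remove[of s u]) (intro sum.cong, auto)
  also have "\<dots> = (\<Sum>v\<in>s - {u}. w u * (ksign u s * (w' v * (ksign v (s - {u}) * c (s - {u} - {v})))))"
    by (intro sum.cong refl) (simp add: algebra_simps insert_commute Diff_insert[symmetric])
  finally show "w u * (ksign u s * (\<Sum>v\<in>s - {u}. w' v * (ksign v (s - {u}) * c (s - {u} - {v}))))
    = (\<Sum>v\<in>s. if u = v then 0 else w u * w' v * (ksign u s * ksign v (s - {u}) * c (s - {u, v})))"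
    by (simp add: sum_distrib_left)
qed

lemma wedge_anticommute:
  fixes w w' :: "'v::finite \<Rightarrow> 'a::comm_ring_1"
  shows "wedge w (wedge w' c) s = - wedge w' (wedge w c) s"
proof -
  have "wedge w' (wedge w c) s = (\<Sum>v\<in>s. \<Sum>u\<in>s.
     if u = v then 0 else w u * w' v * (ksign v s * ksign u (s - {v}) * c (s - {u, v})))"
    unfolding wedge_wedge_eq by (intro sum.cong refl) (auto simp: algebra_simps insert_commute)
  also have "\<dots> = (\<Sum>u\<in>s. \<Sum>v\<in>s.
     if u = v then 0 else w u * w' v * (ksign v s * ksign u (s - {v}) * c (s - {u, v})))"
    by (rule sum.swap)
  also have "\<dots> = (\<Sum>u\<in>s. \<Sum>v\<in>s. -
     (if u = v then 0 else w u * w' v * (ksign u s * ksign v (s - {u}) * c (s - {u, v}))))"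
  proof (intro sum.cong refl)
    fix u v assume "u \<in> s" "v \<in> s"
    then show "(if u = v then 0 else w u * w' v * (ksign v s * ksign u (s - {v}) * c (s - {u, v})))
      = - (if u = v then 0 else w u * w' v * (ksign u s * ksign v (s - {u}) * c (s - {u, v})))"
      using ksign_swap[of v s u, where ?'a = 'a] by simp
  qed
  finally show ?thesis unfolding wedge_wedge_eq sum_negf by simp
qed

lemma wedge_wedge_self [simp]:
  fixes w :: "'v::finite \<Rightarrow> 'a::comm_ring_1"
  shows "wedge w (wedge w c) s = 0"
  unfolding wedge_wedge_eq
proof (rule sum_antisymmetric_eq_0)
  fix u v assume "u \<in> s" "v \<in> s"
  then show "(if u = v then 0 else w u * w v * (ksign u s * ksign v (s - {u}) * c (s - {u, v}))) =
    - (if v = u then 0 else w v * w u * (ksign v s * ksign u (s - {v}) * c (s - {v, u})))"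
    using ksign_swap[of u s v, where ?'a = 'a] by (auto simp: insert_commute)
qed auto

lemma contract_wedge:
  fixes w :: "'v::finite \<Rightarrow> 'a::comm_ring_1"
  shows
  "contract v (wedge w c) s + wedge w (contract v c) s = w v * c s"
proof (cases "v \<in> s")
  case True
  have "wedge w (contract v c) s =
    (\<Sum>u\<in>s. if u = v then w v * c s else 0)"
    unfolding wedge_def contract_def
    using True by (intro sum.cong refl) (auto simp: ksign_remove_self insert_absorb)
  then show ?thesis using True by (simp add: contract_def)
next
  case False
  have "wedge w c (insert v s) = w v * (ksign v s * c s) +
      (\<Sum>u\<in>s. w u * (ksign u (insert v s) * c (insert v s - {u})))"
    unfolding wedge_def using False by (simp add: ksign_insert_self)
  moreover have "wedge w (contract v c) s =
      (\<Sum>u\<in>s. w u * (ksign u s * (ksign v (s - {u}) * c (insert v (s - {u})))))"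
    unfolding wedge_def contract_def using False by (intro sum.cong refl) auto
  moreover have "ksign v s * (w u * (ksign u (insert v s) * c (insert v s - {u}))) =
      - (w u * (ksign u s * (ksign v (s - {u}) * c (insert v (s - {u})))))" if "u \<in> s" for u
  proof -
    have "u \<noteq> v" using that False by auto
    then have "to_nat u \<noteq> to_nat v" by simp
    then have "ksign v s * ksign u (insert v s) = - (ksign u s * ksign v (s - {u}) :: 'a)"
      using ksign_remove[of v "insert v s" u, where ?'a = 'a] ksign_remove[of u s v, where ?'a = 'a]
        that False by (auto simp: algebra_simps)
    moreover have "insert v s - {u} = insert v (s - {u})" using \<open>u \<noteq> v\<close> by auto
    ultimately show ?thesis by (metis (no_types, opaque_lifting) mult.assoc mult.left_commute mult_minus_left)
  qed
  ultimately show ?thesis using False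
    by (simp add: contract_def algebra_simps sum_distrib_left sum_negf)
qed

lemma wedge_degree:
  assumes "\<And>s. Suc (card s) \<noteq> i \<Longrightarrow> b s = 0" "card s \<noteq> i"
  shows "wedge w b s = 0"
  unfolding wedge_def
proof (intro sum.neutral ballI)
  fix v assume "v \<in> s"
  then have "Suc (card (s - {v})) = card s" by (rule card_Suc_Diff1[OF finite])
  with assms show "w v * (ksign v s * b (s - {v})) = 0" by simp
qed

text \<open>
  Koszul cohomology with coefficients in \<open>R/Q\<close> vanishes in all degrees below the length of a
  regular sequence whose members are nilpotent modulo \<open>(z)\<close>. A power of the first member \<open>f\<close> kills
  the cohomology, because each \<open>z\<^sub>v\<close> does by contraction; and \<open>f\<close> acts injectively on it, because the
  cohomology with coefficients in \<open>R/(Q + (f))\<close> vanishes one degree lower by induction.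
\<close>

lemma koszul_vanishing:
  fixes z :: "'v::finite \<Rightarrow> 'r::comm_ring_1"
  assumes "is_ideal Q" "wreg Q fs"
    and "\<And>f. f \<in> set fs \<Longrightarrow> \<exists>p r. f ^ p = (\<Sum>v\<in>UNIV. z v * r v)"
    and "\<And>s. card s \<noteq> i \<Longrightarrow> c s = 0" and "i < length fs" and "\<And>s. wedge z c s \<in> Q"
  shows "\<exists>b. (\<forall>s. Suc (card s) \<noteq> i \<longrightarrow> b s = 0) \<and> (\<forall>s. c s - wedge z b s \<in> Q)"
  using assms
proof (induction fs arbitrary: Q i c)
  case (Cons f fs)
  note Q = is_idealD[OF Cons.prems(1)]
  have reg: "u \<in> Q" if "f * u \<in> Q" for u
    using Cons.prems(2) that unfolding wreg.simps by blast
  \<comment> \<open>\<open>P n\<close> says that \<open>f\<^sup>n c\<close> is a coboundary modulo \<open>Q\<close>; the claim is \<open>P 0\<close>.\<close>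
  define P where "P n \<longleftrightarrow> (\<exists>b. (\<forall>s. Suc (card s) \<noteq> i \<longrightarrow> b s = 0) \<and>
    (\<forall>s. f ^ n * c s - wedge z b s \<in> Q))" for n
  obtain p r where p: "f ^ p = (\<Sum>v\<in>UNIV. z v * r v)" using Cons.prems(3)[of f] by auto
  have "P p" unfolding P_def
  proof (intro exI conjI allI impI)
    define b where "b = (\<lambda>s. \<Sum>v\<in>UNIV. r v * contract v c s)"
    show "(\<Sum>v\<in>UNIV. r v * contract v c s) = 0" if "Suc (card s) \<noteq> i" for s
      using that by (intro sum.neutral ballI) (auto simp: contract_def Cons.prems(4))
    show "f ^ p * c s - wedge z (\<lambda>s. \<Sum>v\<in>UNIV. r v * contract v c s) s \<in> Q" for s
    proof -
      have "f ^ p * c s = (\<Sum>v\<in>UNIV. r v * (z v * c s))"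
        by (simp add: p sum_distrib_left sum_distrib_right algebra_simps)
      also have "\<dots> = (\<Sum>v\<in>UNIV. r v * contract v (wedge z c) s) +
          (\<Sum>v\<in>UNIV. r v * wedge z (contract v c) s)"
        by (simp add: contract_wedge[symmetric] distrib_left sum.distrib)
      finally have "f ^ p * c s - wedge z (\<lambda>s. \<Sum>v\<in>UNIV. r v * contract v c s) s
          = (\<Sum>v\<in>UNIV. r v * contract v (wedge z c) s)"
        by (simp add: wedge_sum wedge_smult)
      also have "\<dots> \<in> Q" using Q Cons.prems(6)
        by (intro is_ideal_sum Cons.prems(1) Q(3)) (auto simp: contract_def)
      finally show ?thesis .
    qed
  qed
  moreover have "P n" if "P (Suc n)" for n
  proof -
    obtain b where b: "\<And>s. Suc (card s) \<noteq> i \<Longrightarrow> b s = 0"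
        "\<And>s. f ^ Suc n * c s - wedge z b s \<in> Q"
      using \<open>P (Suc n)\<close> unfolding P_def by blast
    show ?thesis
    proof (cases i)
      case 0
      then have "b s = 0" for s using b(1) by simp
      then have "f * (f ^ n * c s) \<in> Q" for s using b(2)[of s] by (simp add: wedge_def mult.assoc)
      then have "f ^ n * c s \<in> Q" for s by (rule reg)
      then show ?thesis unfolding P_def by (intro exI[of _ "\<lambda>s. 0"]) auto
    next
      case (Suc i')
      have "\<exists>b'. (\<forall>s. Suc (card s) \<noteq> i' \<longrightarrow> b' s = 0) \<and> (\<forall>s. b s - wedge z b' s \<in> adjoin Q f)"
      proof (rule Cons.IH)
        show "wedge z b s \<in> adjoin Q f" for s
          by (rule adjoinI[of "- (f ^ Suc n * c s - wedge z b s)" _ _ _ "f ^ n * c s"])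
             (use b(2)[of s] in \<open>auto intro: Q(5) simp: algebra_simps simp del: minus_diff_eq\<close>)
        show "b s = 0" if "card s \<noteq> i'" for s using b(1) that Suc by simp
      qed (use Cons.prems Suc in \<open>auto simp: is_ideal_adjoin\<close>)
      then obtain b' where b': "\<And>s. Suc (card s) \<noteq> i' \<Longrightarrow> b' s = 0"
        "\<And>s. b s - wedge z b' s \<in> adjoin Q f" by blast
      have "\<exists>q u. q \<in> Q \<and> b s - wedge z b' s = q + f * u \<and> (Suc (card s) \<noteq> i \<longrightarrow> u = 0)" for s
      proof (cases "Suc (card s) = i")
        case True
        then show ?thesis using b'(2)[of s] by (auto elim!: adjoinE)
      next
        case False
        then have "b s = 0" "wedge z b' s = 0" using b(1) Suc wedge_degree[of i' b' s, OF b'(1)] by auto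
        then show ?thesis using Q(1) by (intro exI[of _ 0]) auto
      qed
      then obtain q u where qu: "\<And>s. q s \<in> Q" "\<And>s. b s - wedge z b' s = q s + f * u s"
        "\<And>s. Suc (card s) \<noteq> i \<Longrightarrow> u s = 0" by metis
      have "f ^ n * c s - wedge z u s \<in> Q" for s
      proof (rule reg)
        have "wedge z b s = wedge z (\<lambda>s. b s - wedge z b' s) s + wedge z (wedge z b') s"
          by (simp only: wedge_diff) simp
        also have "\<dots> = wedge z q s + f * wedge z u s"
          by (simp only: qu(2)) (simp add: wedge_add wedge_smult)
        finally have "f * (f ^ n * c s - wedge z u s) = (f ^ Suc n * c s - wedge z b s) + wedge z q s"
          by (simp add: algebra_simps)
        then show "f * (f ^ n * c s - wedge z u s) \<in> Q"
          using b(2)[of s] wedge_in_ideal[where c = q and w = z and s = s, OF Cons.prems(1) qu(1)] by (auto intro: Q(2))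
      qed
      then show ?thesis unfolding P_def using qu(3) by blast
    qed
  qed
  then have "P n \<Longrightarrow> P 0" for n by (induction n) auto
  ultimately have "P 0" by blast
  then show ?case unfolding P_def by simp
qed simp

lemma wedge_cong:
  assumes "\<And>v. v \<in> s \<Longrightarrow> w v = w' v" "\<And>t. t \<subseteq> s \<Longrightarrow> c t = c' t"
  shows "wedge w c s = wedge w' c' s"
  unfolding wedge_def using assms by (intro sum.cong) auto

text \<open>The exterior product of the \<open>1\<close>-forms in a list.\<close>

definition form_prod :: "('v::finite \<Rightarrow> 'r::comm_ring_1) list \<Rightarrow> 'v set \<Rightarrow> 'r" where
  "form_prod ws = foldr wedge ws (\<lambda>s. if s = {} then 1 else 0)"

lemma form_prod_Nil: "form_prod [] s = (if s = {} then 1 else 0)"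
  by (simp add: form_prod_def)

lemma form_prod_Cons: "form_prod (w # ws) = wedge w (form_prod ws)"
  by (simp add: form_prod_def)

lemma form_prod_degree: "card s \<noteq> length ws \<Longrightarrow> form_prod ws s = 0"
proof (induction ws arbitrary: s)
  case (Cons w ws)
  show ?case unfolding form_prod_Cons
    by (rule wedge_degree[of "length (w # ws)"]) (use Cons in auto)
qed (auto simp: form_prod_Nil)

lemma form_prod_cong:
  assumes "length ws = length ws'" "\<And>i v. i < length ws \<Longrightarrow> v \<in> s \<Longrightarrow> (ws ! i) v = (ws' ! i) v"
  shows "form_prod ws s = form_prod ws' s"
  using assms
proof (induction ws ws' arbitrary: s rule: list_induct2)
  case (Cons w ws w' ws')
  show ?case unfolding form_prod_Cons
  proof (rule wedge_cong)
    show "w v = w' v" if "v \<in> s" for v using Cons.prems[of 0 v] that by simp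
    show "form_prod ws t = form_prod ws' t" if "t \<subseteq> s" for t
      using Cons.prems[of "Suc _"] that by (intro Cons.IH) auto
  qed
qed simp

lemma wedge_form_prod_eq_0:
  assumes "w \<in> set ws"
  shows "wedge w (form_prod ws) s = 0"
  using assms
proof (induction ws arbitrary: s)
  case (Cons w' ws)
  show ?case
  proof (cases "w = w'")
    case False
    then have "wedge w (form_prod ws) = (\<lambda>s. 0)" using Cons by auto
    then show ?thesis unfolding form_prod_Cons by (subst wedge_anticommute) simp
  qed (simp add: form_prod_Cons)
qed simp

text \<open>The value on its support of a product of multiples of distinct basis forms.\<close>

lemma form_prod_basis:
  fixes r :: "'v::finite \<Rightarrow> 'r::comm_ring_1"
  assumes "distinct vs"
  shows "\<exists>e\<in>{1, - 1}. form_prod (map (\<lambda>v u. if u = v then r v else 0) vs) (set vs) = e * prod_list (map r vs)"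
  using assms
proof (induction vs)
  case (Cons x vs)
  then have "distinct vs" by simp
  from Cons.IH[OF this] obtain e where e: "e \<in> {1, - 1}"
    "form_prod (map (\<lambda>v u. if u = v then r v else 0) vs) (set vs) = e * prod_list (map r vs)" by blast
  have "form_prod (map (\<lambda>v u. if u = v then r v else 0) (x # vs)) (set (x # vs)) =
     (\<Sum>v\<in>insert x (set vs). (if v = x then r x else 0) * (ksign v (insert x (set vs)) *
       form_prod (map (\<lambda>v u. if u = v then r v else 0) vs) (insert x (set vs) - {v})))"
    by (simp add: form_prod_Cons wedge_def)
  also have "\<dots> = (\<Sum>v\<in>insert x (set vs). if v = x then r x * (ksign x (insert x (set vs)) *
       form_prod (map (\<lambda>v u. if u = v then r v else 0) vs) (insert x (set vs) - {x})) else 0)"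
    by (intro sum.cong refl) auto
  also have "\<dots> = r x * (ksign x (insert x (set vs)) * (e * prod_list (map r vs)))"
    using Cons.prems e by (simp add: insert_Diff_if)
  finally have "form_prod (map (\<lambda>v u. if u = v then r v else 0) (x # vs)) (set (x # vs)) =
     (ksign x (insert x (set vs)) * e) * prod_list (map r (x # vs))" by (simp add: algebra_simps)
  moreover have "(ksign x (insert x (set vs)) :: 'r) \<in> {1, - 1}"
    unfolding ksign_def by (metis insertCI minus_one_power_iff)
  then have "(ksign x (insert x (set vs)) * e :: 'r) \<in> {1, - 1}" using e(1) by auto
  ultimately show ?case by blast
qed (auto simp: form_prod_Nil)

section \<open>Monomial ideals\<close>

text \<open>The monomial with a given exponent vector.\<close>

definition mon :: "('v \<Rightarrow>\<^sub>0 nat) \<Rightarrow> ('v, 'k::field) mpoly" where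
  "mon a = Poly_Mapping.single a 1"

lemma mon_0 [simp]: "mon 0 = 1"
  by (simp add: mon_def)

lemma mon_add: "mon (a + b) = mon a * mon b"
  by (simp add: mon_def mult_single)

lemma var_eq_mon: "var v = mon (Poly_Mapping.single v 1)"
  by (simp add: var_def mon_def)

lemma mon_sum: "mon (\<Sum>i\<in>A. a i) = (\<Prod>i\<in>A. mon (a i))"
  by (induction A rule: infinite_finite_induct) (auto simp: mon_add)

lemma var_power: "var v ^ s = mon (Poly_Mapping.single v s)"
proof (induction s)
  case (Suc s)
  have "Poly_Mapping.single v (Suc s) = Poly_Mapping.single v 1 + Poly_Mapping.single v s"
    by (simp flip: single_add)
  then show ?case using Suc by (simp add: var_eq_mon mon_add)
qed simp

lemma keys_mon [simp]: "Poly_Mapping.keys (mon a) = {a}"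
  by (simp add: mon_def)

lemma mpoly_eq_sum_single:
  "f = (\<Sum>a\<in>Poly_Mapping.keys f. Poly_Mapping.single a (Poly_Mapping.lookup f a))"
proof (rule poly_mapping_eqI)
  fix k
  have "Poly_Mapping.lookup (\<Sum>a\<in>Poly_Mapping.keys f. Poly_Mapping.single a (Poly_Mapping.lookup f a)) k
    = (\<Sum>a\<in>Poly_Mapping.keys f. if a = k then Poly_Mapping.lookup f k else 0)"
    unfolding lookup_sum by (intro sum.cong refl) (auto simp: lookup_single when_def)
  also have "\<dots> = Poly_Mapping.lookup f k" by (auto simp: in_keys_iff)
  finally show "Poly_Mapping.lookup f k =
    Poly_Mapping.lookup (\<Sum>a\<in>Poly_Mapping.keys f. Poly_Mapping.single a (Poly_Mapping.lookup f a)) k" ..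
qed

lemma single_eq_const_mult_mon: "Poly_Mapping.single a c = Poly_Mapping.single 0 c * mon a"
  by (simp add: mon_def mult_single)

lemma in_ideal_if_mon_in_ideal:
  assumes "is_ideal Q" "\<And>a. a \<in> Poly_Mapping.keys f \<Longrightarrow> mon a \<in> Q"
  shows "f \<in> Q"
proof -
  have "Poly_Mapping.single a (Poly_Mapping.lookup f a) \<in> Q" if "a \<in> Poly_Mapping.keys f" for a
    using is_ideal_mult[OF assms(1) assms(2)[OF that], of "Poly_Mapping.single 0 (Poly_Mapping.lookup f a)"]
    by (simp only: single_eq_const_mult_mon[of a])
  then have "(\<Sum>a\<in>Poly_Mapping.keys f. Poly_Mapping.single a (Poly_Mapping.lookup f a)) \<in> Q"
    by (intro is_ideal_sum[OF assms(1)])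
  then show ?thesis using mpoly_eq_sum_single[of f] by simp
qed

lemma lookup_mon_mult: "Poly_Mapping.lookup (mon a * f) (a + b) = Poly_Mapping.lookup f b"
proof -
  have "mon a * f = (\<Sum>b\<in>Poly_Mapping.keys f. Poly_Mapping.single (a + b) (Poly_Mapping.lookup f b))"
    by (subst (1) mpoly_eq_sum_single[of f]) (simp add: sum_distrib_left mon_def mult_single)
  then have "Poly_Mapping.lookup (mon a * f) (a + b)
    = (\<Sum>c\<in>Poly_Mapping.keys f. if c = b then Poly_Mapping.lookup f b else 0)"
    by (simp only: lookup_sum) (intro sum.cong refl, auto simp: lookup_single when_def)
  also have "\<dots> = Poly_Mapping.lookup f b" by (auto simp: in_keys_iff)
  finally show ?thesis .
qed

lemma keys_mon_mult: "Poly_Mapping.keys (mon a * f) = (+) a ` Poly_Mapping.keys f"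
proof
  show "Poly_Mapping.keys (mon a * f) \<subseteq> (+) a ` Poly_Mapping.keys f"
    using keys_mult[of "mon a" f] by auto
  show "(+) a ` Poly_Mapping.keys f \<subseteq> Poly_Mapping.keys (mon a * f)"
    by (auto simp: in_keys_iff lookup_mon_mult)
qed

text \<open>Sets of exponents that are closed under increasing the exponents.\<close>

definition upset :: "('v \<Rightarrow>\<^sub>0 nat) set \<Rightarrow> bool" where
  "upset U \<longleftrightarrow> (\<forall>a\<in>U. \<forall>b. a + b \<in> U)"

text \<open>The span of the monomials with exponent in \<open>U\<close>.\<close>

definition mono_ideal :: "('v \<Rightarrow>\<^sub>0 nat) set \<Rightarrow> ('v, 'k::field) mpoly set" where
  "mono_ideal U = {f. Poly_Mapping.keys f \<subseteq> U}"

lemma mon_in_mono_ideal [simp]: "mon a \<in> mono_ideal U \<longleftrightarrow> a \<in> U"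
  by (simp add: mono_ideal_def)

lemma mono_ideal_UNIV [simp]: "mono_ideal UNIV = UNIV"
  by (simp add: mono_ideal_def)

lemma is_ideal_mono_ideal:
  assumes "upset U"
  shows "is_ideal (mono_ideal U :: ('v, 'k::field) mpoly set)"
proof (rule is_idealI)
  show "(0 :: ('v, 'k) mpoly) \<in> mono_ideal U" by (simp add: mono_ideal_def)
  show "x + y \<in> mono_ideal U" if "x \<in> mono_ideal U" "y \<in> mono_ideal U" for x y :: "('v, 'k) mpoly"
    using that keys_add[of x y] by (auto simp: mono_ideal_def)
  show "r * x \<in> mono_ideal U" if "x \<in> mono_ideal U" for r x :: "('v, 'k) mpoly"
  proof -
    have "a + b \<in> U" if "b \<in> Poly_Mapping.keys x" for a b
      using that \<open>x \<in> mono_ideal U\<close> assms by (auto simp: mono_ideal_def upset_def add.commute[of a b])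
    then show ?thesis using keys_mult[of r x] by (auto simp: mono_ideal_def)
  qed
qed

lemma mon_mult_in_mono_ideal:
  "mon a * f \<in> mono_ideal U \<longleftrightarrow> f \<in> mono_ideal {b. a + b \<in> U}"
  by (auto simp: mono_ideal_def keys_mon_mult)

lemma colon_mono_ideal: "colon (mono_ideal U) (mon a) = mono_ideal {b. a + b \<in> U}"
  by (auto simp: colon_def mon_mult_in_mono_ideal)

lemma adjoin_mono_ideal:
  assumes "upset U"
  shows "adjoin (mono_ideal U) (mon a) = (mono_ideal (U \<union> range ((+) a)) :: ('v, 'k::field) mpoly set)"
proof
  have up: "upset (U \<union> range ((+) a))"
    using assms by (auto simp: upset_def add.assoc)
  show "adjoin (mono_ideal U) (mon a) \<subseteq> (mono_ideal (U \<union> range ((+) a)) :: ('v, 'k::field) mpoly set)"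
  proof (rule adjoin_subset[OF is_ideal_mono_ideal[OF up]])
    have "a \<in> range ((+) a)" by (rule range_eqI[of _ _ 0]) simp
    then show "(mon a :: ('v, 'k) mpoly) \<in> mono_ideal (U \<union> range ((+) a))" by simp
  qed (auto simp: mono_ideal_def)
  have id: "is_ideal (adjoin (mono_ideal U) (mon a) :: ('v, 'k) mpoly set)"
    by (intro is_ideal_adjoin is_ideal_mono_ideal assms)
  show "mono_ideal (U \<union> range ((+) a)) \<subseteq> (adjoin (mono_ideal U) (mon a) :: ('v, 'k::field) mpoly set)"
  proof
    fix f :: "('v, 'k) mpoly" assume f: "f \<in> mono_ideal (U \<union> range ((+) a))"
    show "f \<in> adjoin (mono_ideal U) (mon a)"
    proof (rule in_ideal_if_mon_in_ideal[OF id])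
      fix b assume "b \<in> Poly_Mapping.keys f"
      then have "b \<in> U \<union> range ((+) a)" using f by (auto simp: mono_ideal_def)
      then show "(mon b :: ('v, 'k) mpoly) \<in> adjoin (mono_ideal U) (mon a)"
      proof
        assume "b \<in> U" then show ?thesis
          using subset_adjoin[of "mono_ideal U :: ('v, 'k) mpoly set" "mon a"] by auto
      next
        assume "b \<in> range ((+) a)"
        then obtain d where "b = a + d" by auto
        then show ?thesis
          by (intro adjoinI[of 0 _ _ _ "mon d"]) (auto simp: mon_add mono_ideal_def)
      qed
    qed
  qed
qed

text \<open>The exponents of the monomials in the ideal generated by the variables in \<open>A\<close>.\<close>

definition hits :: "'v set \<Rightarrow> ('v \<Rightarrow>\<^sub>0 nat) set" where
  "hits A = {a. \<exists>v\<in>A. Poly_Mapping.lookup a v \<noteq> 0}"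

lemma upset_hits: "upset (hits A)"
  by (auto simp: upset_def hits_def lookup_add)

lemma range_plus_single: "range ((+) (Poly_Mapping.single v 1)) = hits {v}"
proof
  show "hits {v} \<subseteq> range ((+) (Poly_Mapping.single v 1))"
  proof
    fix a :: "'a \<Rightarrow>\<^sub>0 nat" assume "a \<in> hits {v}"
    then have "a = Poly_Mapping.single v 1 + (a - Poly_Mapping.single v 1)"
      by (intro poly_mapping_eqI) (auto simp: hits_def lookup_add lookup_minus lookup_single when_def)
    then show "a \<in> range ((+) (Poly_Mapping.single v 1))" by (rule range_eqI)
  qed
qed (auto simp: hits_def lookup_add)

lemma adjoin_var_mono_ideal:
  assumes "upset U"
  shows "adjoin (mono_ideal U) (var v) = mono_ideal (U \<union> hits {v})"
  unfolding var_eq_mon by (simp only: adjoin_mono_ideal[OF assms] range_plus_single)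

lemma hits_insert: "hits (insert v A) = hits A \<union> hits {v}"
  by (auto simp: hits_def)

lemma single_plus_in_hits: "v \<notin> A \<Longrightarrow> Poly_Mapping.single v s + a \<in> hits A \<longleftrightarrow> a \<in> hits A"
  by (auto simp: hits_def lookup_add lookup_single when_def)

lemma var_regular:
  assumes "v \<notin> A" "var v * u \<in> mono_ideal (hits A)"
  shows "u \<in> mono_ideal (hits A)"
proof -
  have "{b. Poly_Mapping.single v (1::nat) + b \<in> hits A} = hits A"
    by (auto simp: single_plus_in_hits[OF assms(1)])
  then show ?thesis using assms(2) unfolding var_eq_mon mon_mult_in_mono_ideal by simp
qed


section \<open>Homogeneous components\<close>

text \<open>
  The total degree of an exponent vector; a polynomial is homogeneous of degree \<open>d\<close> if all its
  monomials have degree \<open>d\<close> (in particular, if it is zero), and \<open>component d\<close> is the projection to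
  these polynomials.
\<close>

definition tdeg :: "('v::finite \<Rightarrow>\<^sub>0 nat) \<Rightarrow> nat" where
  "tdeg a = (\<Sum>v\<in>UNIV. Poly_Mapping.lookup a v)"

lemma tdeg_0 [simp]: "tdeg 0 = 0"
  by (simp add: tdeg_def)

lemma tdeg_add: "tdeg (a + b) = tdeg a + tdeg b"
  by (simp add: tdeg_def lookup_add sum.distrib)

lemma tdeg_single [simp]: "tdeg (Poly_Mapping.single v n) = n"
  by (simp add: tdeg_def lookup_single when_def)

definition homogeneous :: "nat \<Rightarrow> ('v::finite, 'k::field) mpoly \<Rightarrow> bool" where
  "homogeneous d f \<longleftrightarrow> (\<forall>a\<in>Poly_Mapping.keys f. tdeg a = d)"

definition component :: "nat \<Rightarrow> ('v::finite, 'k::field) mpoly \<Rightarrow> ('v, 'k) mpoly" where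
  "component d f = Abs_poly_mapping (\<lambda>a. Poly_Mapping.lookup f a when tdeg a = d)"

lemma lookup_component:
  "Poly_Mapping.lookup (component d f) a = (Poly_Mapping.lookup f a when tdeg a = d)"
proof -
  have "finite {a. (Poly_Mapping.lookup f a when tdeg a = d) \<noteq> 0}"
    by (rule finite_subset[of _ "Poly_Mapping.keys f"]) (auto simp: in_keys_iff)
  then show ?thesis unfolding component_def by simp
qed

lemma component_add: "component d (f + g) = component d f + component d g"
  by (rule poly_mapping_eqI) (simp add: lookup_component lookup_add when_def)

lemma component_sum:
  fixes f :: "'i \<Rightarrow> ('v::finite, 'k::field) mpoly"
  shows "component d (\<Sum>i\<in>A. f i) = (\<Sum>i\<in>A. component d (f i))"
proof -
  have "component d 0 = (0 :: ('v, 'k) mpoly)"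
    by (rule poly_mapping_eqI) (simp add: lookup_component)
  then show ?thesis by (induction A rule: infinite_finite_induct) (auto simp: component_add)
qed

lemma component_single:
  "component d (Poly_Mapping.single a c) = (if tdeg a = d then Poly_Mapping.single a c else 0)"
  by (rule poly_mapping_eqI) (auto simp: lookup_component lookup_single when_def)

lemma component_homogeneous: "homogeneous d f \<Longrightarrow> component d f = f"
  by (rule poly_mapping_eqI)
     (auto simp: lookup_component when_def homogeneous_def in_keys_iff)

lemma homogeneous_component: "homogeneous d (component d f)"
  by (auto simp: homogeneous_def in_keys_iff lookup_component)

lemma sum_components: "f = (\<Sum>d\<in>tdeg ` Poly_Mapping.keys f. component d f)"
proof (rule poly_mapping_eqI)
  fix a
  have "Poly_Mapping.lookup (\<Sum>d\<in>tdeg ` Poly_Mapping.keys f. component d f) a =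
    (\<Sum>d\<in>tdeg ` Poly_Mapping.keys f. if d = tdeg a then Poly_Mapping.lookup f a else 0)"
    unfolding lookup_sum by (intro sum.cong) (auto simp: lookup_component when_def)
  also have "\<dots> = Poly_Mapping.lookup f a" by (auto simp: in_keys_iff)
  finally show "Poly_Mapping.lookup f a =
    Poly_Mapping.lookup (\<Sum>d\<in>tdeg ` Poly_Mapping.keys f. component d f) a" ..
qed

lemma component_mult_homogeneous:
  assumes "homogeneous d f"
  shows "component e (f * u) = (if d \<le> e then f * component (e - d) u else 0)"
proof -
  have *: "component e (Poly_Mapping.single a x * Poly_Mapping.single b y) =
      (if d \<le> e then Poly_Mapping.single a x * component (e - d) (Poly_Mapping.single b y) else 0)"
    if "tdeg a = d" for a b :: "'a \<Rightarrow>\<^sub>0 nat" and x y :: 'b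
    using that by (auto simp: mult_single component_single tdeg_add)
  have "component e (f * u) = component e ((\<Sum>a\<in>Poly_Mapping.keys f. Poly_Mapping.single a (Poly_Mapping.lookup f a)) *
      (\<Sum>b\<in>Poly_Mapping.keys u. Poly_Mapping.single b (Poly_Mapping.lookup u b)))"
    by (simp only: mpoly_eq_sum_single[symmetric])
  also have "\<dots> = (\<Sum>a\<in>Poly_Mapping.keys f. \<Sum>b\<in>Poly_Mapping.keys u.
      if d \<le> e then Poly_Mapping.single a (Poly_Mapping.lookup f a) *
        component (e - d) (Poly_Mapping.single b (Poly_Mapping.lookup u b)) else 0)"
    using assms unfolding sum_product component_sum homogeneous_def
    by (intro sum.cong refl *) auto
  also have "\<dots> = (if d \<le> e then (\<Sum>a\<in>Poly_Mapping.keys f. Poly_Mapping.single a (Poly_Mapping.lookup f a)) *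
      component (e - d) (\<Sum>b\<in>Poly_Mapping.keys u. Poly_Mapping.single b (Poly_Mapping.lookup u b)) else 0)"
    by (simp add: sum_product component_sum)
  also have "\<dots> = (if d \<le> e then f * component (e - d) u else 0)"
    by (simp only: mpoly_eq_sum_single[symmetric])
  finally show ?thesis .
qed

lemma homogeneous_1: "homogeneous 0 1"
  by (simp add: homogeneous_def)

lemma homogeneous_var: "homogeneous 1 (var v)"
  by (simp add: homogeneous_def var_eq_mon)

lemma homogeneous_mult: "homogeneous d f \<Longrightarrow> homogeneous e g \<Longrightarrow> homogeneous (d + e) (f * g)"
  using keys_mult[of f g] by (auto simp: homogeneous_def tdeg_add)

lemma homogeneous_sum: "(\<And>i. i \<in> A \<Longrightarrow> homogeneous d (f i)) \<Longrightarrow> homogeneous d (sum f A)"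
proof (induction A rule: infinite_finite_induct)
  case (insert x A)
  have "Poly_Mapping.keys (f x + sum f A) \<subseteq> Poly_Mapping.keys (f x) \<union> Poly_Mapping.keys (sum f A)"
    by (rule keys_add)
  with insert show ?case by (auto simp: homogeneous_def)
qed (auto simp: homogeneous_def)

text \<open>Sets closed under taking homogeneous components; for an ideal, this is homogeneity.\<close>

definition homogeneous_set :: "('v::finite, 'k::field) mpoly set \<Rightarrow> bool" where
  "homogeneous_set Q \<longleftrightarrow> (\<forall>f\<in>Q. \<forall>d. component d f \<in> Q)"

lemma homogeneous_set_mono_ideal: "homogeneous_set (mono_ideal U)"
  by (auto simp: homogeneous_set_def mono_ideal_def in_keys_iff lookup_component)

lemma homogeneous_set_adjoin:
  assumes "homogeneous_set Q" "homogeneous d f"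
  shows "homogeneous_set (adjoin Q f)"
  unfolding homogeneous_set_def
proof (intro ballI allI)
  fix x e assume "x \<in> adjoin Q f"
  then obtain q u where "q \<in> Q" "x = q + f * u" by (rule adjoinE)
  then show "component e x \<in> adjoin Q f" using assms
    by (intro adjoinI[of "component e q" _ _ _ "if d \<le> e then component (e - d) u else 0"])
       (auto simp: component_add component_mult_homogeneous[OF assms(2)] homogeneous_set_def)
qed

text \<open>
  If \<open>z\<close> is regular on \<open>S/Q\<close> and \<open>f\<close> is regular on \<open>S/(Q + (z))\<close>, then \<open>f\<close> is regular on \<open>S/Q\<close>:
  a homogeneous \<open>u\<close> with \<open>f u \<in> Q\<close> is congruent modulo \<open>Q\<close> to \<open>z v\<close>, where \<open>v\<close> has smaller degree
  and again satisfies \<open>f v \<in> Q\<close>.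
\<close>

lemma homogeneous_regular_descent:
  assumes "is_ideal Q" "homogeneous_set Q" "homogeneous 1 z" "homogeneous d f"
    and z: "\<And>u. z * u \<in> Q \<Longrightarrow> u \<in> Q"
    and f: "\<And>u. f * u \<in> adjoin Q z \<Longrightarrow> u \<in> adjoin Q z"
    and "f * u \<in> Q"
  shows "u \<in> Q"
proof -
  note Q = is_idealD[OF assms(1)]
  have hom: "u \<in> Q" if "homogeneous e u" "f * u \<in> Q" for e u
    using that
  proof (induction e arbitrary: u rule: less_induct)
    case (less e)
    have "u \<in> adjoin Q z" using f less.prems(2) subset_adjoin[of Q z] by blast
    then obtain q v where v: "q \<in> Q" "u = q + z * v" by (rule adjoinE)
    have cq: "component e q \<in> Q" using assms(2) v(1) by (simp add: homogeneous_set_def)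
    have u: "u = component e q + (if 1 \<le> e then z * component (e - 1) v else 0)"
      using component_homogeneous[OF less.prems(1)] component_mult_homogeneous[OF assms(3), of e v]
      by (simp add: v(2) component_add)
    show ?case
    proof (cases "1 \<le> e")
      case True
      have "z * (f * component (e - 1) v) = f * u - f * component e q"
        using u True by (simp add: algebra_simps)
      also have "\<dots> \<in> Q" using less.prems(2) cq Q by auto
      finally have "f * component (e - 1) v \<in> Q" by (rule z)
      moreover have "e - 1 < e" using True by simp
      ultimately have "component (e - 1) v \<in> Q"
        using less.IH homogeneous_component by blast
      then have "component e q + z * component (e - 1) v \<in> Q" using cq Q by blast
      then show ?thesis using u True by simp
    qed (use u cq in auto)
  qed
  have "component e u \<in> Q" for e
  proof (rule hom[OF homogeneous_component])
    have "f * component e u = component (d + e) (f * u)"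
      by (simp add: component_mult_homogeneous[OF assms(4)])
    also have "\<dots> \<in> Q" using assms(2,7) by (simp add: homogeneous_set_def)
    finally show "f * component e u \<in> Q" .
  qed
  then have "(\<Sum>e\<in>tdeg ` Poly_Mapping.keys u. component e u) \<in> Q"
    by (intro is_ideal_sum assms(1))
  then show ?thesis using sum_components[of u] by simp
qed

text \<open>
  A homogeneous regular sequence \<open>z, f\<^sub>1, \<dots>, f\<^sub>r\<close> may be permuted to
  \<open>f\<^sub>1, \<dots>, f\<^sub>r, z\<close>.
\<close>

lemma wreg_move_to_end:
  assumes "is_ideal Q" "homogeneous_set Q" "homogeneous 1 z"
    and "\<And>f. f \<in> set fs \<Longrightarrow> \<exists>d. homogeneous d f"
    and "\<And>u. z * u \<in> Q \<Longrightarrow> u \<in> Q" "wreg (adjoin Q z) fs"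
  shows "wreg Q fs \<and> (\<forall>u. z * u \<in> adjoins Q fs \<longrightarrow> u \<in> adjoins Q fs)"
  using assms
proof (induction fs arbitrary: Q)
  case (Cons f fs)
  note Q = is_idealD[OF Cons.prems(1)]
  obtain d where d: "homogeneous d f" using Cons.prems(4)[of f] by auto
  have f: "u \<in> adjoin Q z" if "f * u \<in> adjoin Q z" for u
    using Cons.prems(6) that unfolding wreg.simps by blast
  have reg: "u \<in> Q" if "f * u \<in> Q" for u
    by (rule homogeneous_regular_descent[OF Cons.prems(1,2,3) d Cons.prems(5) f that])
  have "u \<in> adjoin Q f" if zu: "z * u \<in> adjoin Q f" for u
  proof -
    obtain q w where w: "q \<in> Q" "z * u = q + f * w" using adjoinE[OF zu] by blast
    have "f * w \<in> adjoin Q z"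
      by (rule adjoinI[of "- q" _ _ _ u]) (auto simp: w Q)
    then obtain q' w' where w': "q' \<in> Q" "w = q' + z * w'" using f by (metis adjoinE)
    have "z * (u - f * w') = q + f * q'" using w w' by (simp add: algebra_simps)
    also have "\<dots> \<in> Q" by (rule Q(2)[OF w(1) Q(3)[OF w'(1)]])
    finally have "u - f * w' \<in> Q" by (rule Cons.prems(5))
    then show ?thesis by (rule adjoinI[of _ _ _ _ w']) simp
  qed
  moreover have "wreg (adjoin (adjoin Q f) z) fs"
    using Cons.prems(6) by (simp only: adjoin_commute[of Q f z] wreg.simps)
  ultimately have "wreg (adjoin Q f) fs \<and>
      (\<forall>u. z * u \<in> adjoins (adjoin Q f) fs \<longrightarrow> u \<in> adjoins (adjoin Q f) fs)"
    using Cons.prems(3,4) d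
    by (intro Cons.IH is_ideal_adjoin homogeneous_set_adjoin Cons.prems(1,2)) auto
  then show ?case unfolding wreg.simps foldl_Cons using reg by blast
qed simp


section \<open>Elementary symmetric polynomials\<close>

text \<open>The elementary symmetric polynomials in all variables.\<close>

definition esym :: "nat \<Rightarrow> ('v::finite, 'k::field) mpoly" where
  "esym j = (\<Sum>B\<in>{B. card B = j}. \<Prod>v\<in>B. var v)"

lemma homogeneous_prod_var: "homogeneous (card B) (\<Prod>v\<in>B. var v)"
proof (induction B rule: infinite_finite_induct)
  case (insert x A)
  then show ?case using homogeneous_mult[OF homogeneous_var insert.IH] by simp
qed (auto simp: homogeneous_1)

lemma homogeneous_esym: "homogeneous j (esym j)"
  unfolding esym_def using homogeneous_prod_var by (intro homogeneous_sum) auto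

text \<open>
  After the variables in \<open>A\<close> are set to zero, the first \<open>j\<close> elementary symmetric polynomials form a
  regular sequence provided that at least \<open>j\<close> variables are left. If more variables are left, set a
  further variable \<open>v\<close> to zero and move it to the end of the sequence. If exactly \<open>j\<close> variables are
  left, the last polynomial is their product, and each of them is regular modulo the first \<open>j - 1\<close>
  polynomials, again because it may be moved to the end.
\<close>

lemma wreg_esym:
  fixes A :: "'v::finite set"
  assumes "j \<le> card (- A)"
  shows "wreg (mono_ideal (hits A) :: ('v, 'k::field) mpoly set) (map esym [1..<Suc j])"
  using assms
proof (induction j arbitrary: A)
  case (Suc j)
  define fs :: "('v, 'k) mpoly list" where "fs = map esym [1..<Suc j]"
  define n where "n = card (- A)"
  have hom: "\<exists>d. homogeneous d f" if "f \<in> set (map esym [1..<Suc i])" for f :: "('v, 'k) mpoly" and i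
    using that homogeneous_esym by auto
  note prem = is_ideal_mono_ideal[OF upset_hits] homogeneous_set_mono_ideal homogeneous_var
  have adj: "adjoin (mono_ideal (hits A)) (var v) = (mono_ideal (hits (insert v A)) :: ('v, 'k) mpoly set)" for v and A :: "'v set"
    unfolding adjoin_var_mono_ideal[OF upset_hits] hits_insert[of v A] ..
  have "Suc j \<le> n" using Suc.prems by (simp add: n_def)
  then show ?case using n_def
  proof (induction n arbitrary: A rule: dec_induct)
    case base
    define R :: "('v, 'k) mpoly set" where "R = adjoins (mono_ideal (hits A)) fs"
    have idR: "is_ideal R" unfolding R_def by (intro is_ideal_adjoins is_ideal_mono_ideal upset_hits)
    have sub: "mono_ideal (hits A) \<subseteq> R"
    proof -
      have "Q \<subseteq> adjoins Q gs" for Q :: "('v, 'k) mpoly set" and gs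
      proof (induction gs arbitrary: Q)
        case (Cons g gs)
        show ?case using subset_adjoin[of Q g] Cons.IH[of "adjoin Q g"] by auto
      qed simp
      then show ?thesis by (simp add: R_def)
    qed
    have var: "u \<in> R" if "v \<notin> A" "var v * u \<in> R" for u v
    proof -
      have "card (- insert v A) = j"
      proof -
        have "- insert v A = - A - {v}" by auto
        then show ?thesis using base that by simp
      qed
      then have "wreg (adjoin (mono_ideal (hits A)) (var v)) fs"
        unfolding adj fs_def by (intro Suc.IH) auto
      then have "\<forall>u. var v * u \<in> adjoins (mono_ideal (hits A)) fs \<longrightarrow> u \<in> adjoins (mono_ideal (hits A)) fs"
        using wreg_move_to_end[of "mono_ideal (hits A)" "var v" fs, OF prem] hom var_regular[OF that(1)] unfolding fs_def by blast
      then show ?thesis using that unfolding R_def by blast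
    qed
    have prod: "u \<in> R" if "B \<subseteq> - A" "(\<Prod>v\<in>B. var v) * u \<in> R" for B u
      using finite[of B] that
    proof (induction B arbitrary: u rule: finite_induct)
      case (insert x B)
      have "var x * ((\<Prod>v\<in>B. var v) * u) \<in> R"
        using insert.prems(2) insert.hyps by (simp add: mult.assoc)
      with insert.prems(1) have "(\<Prod>v\<in>B. var v) * u \<in> R" using var[of x] by blast
      then show ?case using insert.IH insert.prems(1) by blast
    qed simp
    have "u \<in> R" if u: "esym (Suc j) * u \<in> R" for u
    proof (rule prod[of "- A"])
      have fin: "- A \<in> {B. card B = Suc j}" using base by simp
      have "esym (Suc j) - (\<Prod>v\<in>- A. var v) = (\<Sum>B\<in>{B. card B = Suc j} - {- A}. \<Prod>v\<in>B. var v :: ('v, 'k) mpoly)"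
        unfolding esym_def using sum.remove[OF _ fin, of "\<lambda>B. \<Prod>v\<in>B. var v :: ('v, 'k) mpoly"] by simp
      also have "\<dots> \<in> mono_ideal (hits A)"
      proof (intro is_ideal_sum is_ideal_mono_ideal upset_hits)
        fix B assume B: "B \<in> {B. card B = Suc j} - {- A}"
        then have "\<not> B \<subseteq> - A" using base card_subset_eq[of "- A" B] by auto
        then obtain v where v: "v \<in> B" "v \<in> A" by auto
        have "(var v :: ('v, 'k) mpoly) \<in> mono_ideal (hits A)"
          using v unfolding var_eq_mon mon_in_mono_ideal hits_def by (auto intro!: bexI[of _ v])
        then have "var v * (\<Prod>v\<in>B - {v}. var v :: ('v, 'k) mpoly) \<in> mono_ideal (hits A)"
          by (intro is_ideal_mult_right is_ideal_mono_ideal upset_hits)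
        then show "(\<Prod>v\<in>B. var v :: ('v, 'k) mpoly) \<in> mono_ideal (hits A)"
          using v by (simp add: prod.remove[of B v])
      qed
      finally have "(esym (Suc j) - (\<Prod>v\<in>- A. var v)) * u \<in> R"
        using sub by (intro is_ideal_mult_right[OF idR]) auto
      then have "esym (Suc j) * u - (esym (Suc j) - (\<Prod>v\<in>- A. var v)) * u \<in> R"
        using u by (intro is_ideal_diff[OF idR])
      then show "(\<Prod>v\<in>- A. var v) * u \<in> R" by (simp add: algebra_simps)
    qed auto
    moreover have "wreg (mono_ideal (hits A)) fs" unfolding fs_def using base by (intro Suc.IH) auto
    moreover have "map esym [1..<Suc (Suc j)] = fs @ [esym (Suc j)]" by (simp add: fs_def)
    ultimately show ?case unfolding wreg_append R_def[symmetric] by (auto simp: wreg_append R_def)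
  next
    case (step n)
    have "card (- A) \<noteq> 0" using \<open>Suc n = card (- A)\<close> by linarith
    then have "- A \<noteq> {}" by (metis card.empty)
    then obtain v where v: "v \<in> - A" by blast
    have "- insert v A = - A - {v}" by auto
    then have "card (- insert v A) = n" using step v by simp
    then have "wreg (adjoin (mono_ideal (hits A) :: ('v, 'k) mpoly set) (var v)) (map esym [1..<Suc (Suc j)])"
      unfolding adj by (intro step.IH) auto
    then show ?case
      using wreg_move_to_end[of "mono_ideal (hits A)" "var v" "map esym [1..<Suc (Suc j)]", OF prem] hom var_regular[of v A] v by blast
  qed
qed simp

section \<open>Filtrations with quotients by variables\<close>

text \<open>
  \<open>prime_filtration U q g Z\<close> asserts that the module spanned by the monomials with exponent in
  \<open>{g + a | a. a = 0 on Z} - U\<close> has a filtration with quotients of the form \<open>S/(Z')\<close>, for sets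
  \<open>Z'\<close> of at most \<open>q\<close> variables, that is obtained by splitting off variables. The rule \<open>split\<close>
  separates the monomials in which the exponent of \<open>v\<close> is \<open>g\<^sub>v\<close> from those in which it is larger.
\<close>

inductive prime_filtration :: "('v \<Rightarrow>\<^sub>0 nat) set \<Rightarrow> nat \<Rightarrow> ('v \<Rightarrow>\<^sub>0 nat) \<Rightarrow> 'v set \<Rightarrow> bool" for U q where
  zero: "g \<in> U \<Longrightarrow> prime_filtration U q g Z"
| cell: "(\<And>a. (\<forall>v\<in>Z. Poly_Mapping.lookup a v = 0) \<Longrightarrow> g + a \<notin> U) \<Longrightarrow> card Z \<le> q \<Longrightarrow> prime_filtration U q g Z"
| split: "v \<notin> Z \<Longrightarrow> prime_filtration U q g (insert v Z) \<Longrightarrow>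
    prime_filtration U q (g + Poly_Mapping.single v 1) Z \<Longrightarrow> prime_filtration U q g Z"

text \<open>
  Under the shift by \<open>g\<close>, the module in question becomes the quotient of \<open>S\<close> by the ideal
  that occurs here, and \<open>split\<close> corresponds to the colon and the sum of this ideal with \<open>(v)\<close>.
\<close>

lemma prime_filtration_wreg:
  fixes U :: "('v \<Rightarrow>\<^sub>0 nat) set" and fs :: "('v, 'k::field) mpoly list"
  assumes "prime_filtration U q g Z" "upset U"
    and "\<And>A. card A \<le> q \<Longrightarrow> wreg (mono_ideal (hits A)) fs"
  shows "wreg (mono_ideal (hits Z \<union> {a. g + a \<in> U})) fs"
  using assms(1)
proof (induction rule: prime_filtration.induct)
  case (zero g Z)
  then have "{a. g + a \<in> U} = UNIV" using assms(2) by (auto simp: upset_def)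
  then show ?case by (simp add: wreg_UNIV)
next
  case (cell Z g)
  then have "hits Z \<union> {a. g + a \<in> U} = hits Z" unfolding hits_def by blast
  then show ?case using assms(3) cell by simp
next
  case (split v Z g)
  have up: "upset (hits Z \<union> {a. g + a \<in> U})"
    using assms(2) upset_hits[of Z] by (auto simp: upset_def add.assoc[symmetric])
  have 1: "adjoin (mono_ideal (hits Z \<union> {a. g + a \<in> U})) (var v) =
      (mono_ideal (hits (insert v Z) \<union> {a. g + a \<in> U}) :: ('v, 'k) mpoly set)"
    unfolding adjoin_var_mono_ideal[OF up] hits_insert[of v Z] by (simp add: Un_ac)
  have 2: "colon (mono_ideal (hits Z \<union> {a. g + a \<in> U})) (var v) =
      (mono_ideal (hits Z \<union> {a. g + Poly_Mapping.single v 1 + a \<in> U}) :: ('v, 'k) mpoly set)"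
    unfolding var_eq_mon colon_mono_ideal using split(1)
    by (intro arg_cong[of _ _ mono_ideal]) (auto simp: single_plus_in_hits add.assoc)
  show ?case
    by (rule wreg_extension[where g = "var v"]) (simp_all only: 1 2 split.IH is_ideal_mono_ideal up)
qed

section \<open>An obstruction to long regular sequences\<close>

text \<open>Exponent vectors on a finite set of variables.\<close>

definition expo :: "('v::finite \<Rightarrow> nat) \<Rightarrow> ('v \<Rightarrow>\<^sub>0 nat)" where
  "expo f = Abs_poly_mapping f"

lemma lookup_expo [simp]: "Poly_Mapping.lookup (expo f) v = f v"
  by (simp add: expo_def)

lemma mono_ideal_mult:
  assumes "f \<in> mono_ideal U" "g \<in> mono_ideal V" "\<And>a b. a \<in> U \<Longrightarrow> b \<in> V \<Longrightarrow> a + b \<in> T"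
  shows "f * g \<in> mono_ideal T"
  using keys_mult[of f g] assms by (fastforce simp: mono_ideal_def)

lemma power_in_mono_ideal_tdeg:
  fixes f :: "('v::finite, 'k::field) mpoly"
  assumes "f \<in> mono_ideal (- {0})"
  shows "f ^ p \<in> mono_ideal {a. p \<le> tdeg a}"
proof (induction p)
  case (Suc p)
  have "tdeg a \<noteq> 0" if a: "a \<noteq> 0" for a :: "'v \<Rightarrow>\<^sub>0 nat"
  proof -
    obtain v where "Poly_Mapping.lookup a v \<noteq> 0" using a by (metis lookup_zero poly_mapping_eqI)
    then show ?thesis by (auto simp: tdeg_def)
  qed
  then have "1 \<le> tdeg a" if "a \<noteq> 0" for a :: "'v \<Rightarrow>\<^sub>0 nat"
    using that by (auto simp: Suc_le_eq)
  then have "a \<in> - {0} \<Longrightarrow> b \<in> {a. p \<le> tdeg a} \<Longrightarrow> a + b \<in> {a. Suc p \<le> tdeg a}" for a b :: "'v \<Rightarrow>\<^sub>0 nat"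
    unfolding mem_Collect_eq tdeg_add by (metis ComplD add_mono plus_1_eq_Suc singletonI)
  then show ?case unfolding power_Suc by (rule mono_ideal_mult[OF assms Suc.IH])
qed (simp add: mono_ideal_def)

text \<open>
  The powers \<open>v\<^sup>s\<close> of the variables generate the maximal ideal up to radical.
\<close>

lemma maximal_ideal_nilpotent:
  fixes f :: "('v::finite, 'k::field) mpoly"
  assumes "f \<in> mono_ideal (- {0})"
  shows "\<exists>p r. f ^ p = (\<Sum>v\<in>UNIV. var v ^ s * r v)"
proof -
  have id: "is_ideal {\<Sum>v\<in>UNIV. var v ^ s * r v | r :: 'v \<Rightarrow> ('v, 'k) mpoly. True}"
  proof (rule is_idealI)
    show "0 \<in> {\<Sum>v\<in>UNIV. var v ^ s * r v | r :: 'v \<Rightarrow> ('v, 'k) mpoly. True}"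
      by (auto intro!: exI[of _ "\<lambda>v. 0"])
  next
    fix x y assume "x \<in> {\<Sum>v\<in>UNIV. var v ^ s * r v | r :: 'v \<Rightarrow> ('v, 'k) mpoly. True}"
      "y \<in> {\<Sum>v\<in>UNIV. var v ^ s * r v | r :: 'v \<Rightarrow> ('v, 'k) mpoly. True}"
    then obtain r r' where "x = (\<Sum>v\<in>UNIV. var v ^ s * r v)" "y = (\<Sum>v\<in>UNIV. var v ^ s * r' v)"
      by blast
    then have "x + y = (\<Sum>v\<in>UNIV. var v ^ s * (r v + r' v))"
      by (simp add: sum.distrib distrib_left)
    then show "x + y \<in> {\<Sum>v\<in>UNIV. var v ^ s * r v | r. True}"
      by (intro CollectI exI[of _ "\<lambda>v. r v + r' v"]) simp
  next
    fix t x assume "x \<in> {\<Sum>v\<in>UNIV. var v ^ s * r v | r :: 'v \<Rightarrow> ('v, 'k) mpoly. True}"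
    then obtain r where "x = (\<Sum>v\<in>UNIV. var v ^ s * r v)" by blast
    then have "t * x = (\<Sum>v\<in>UNIV. var v ^ s * (t * r v))"
      by (simp add: sum_distrib_left mult.left_commute)
    then show "t * x \<in> {\<Sum>v\<in>UNIV. var v ^ s * r v | r. True}"
      by (intro CollectI exI[of _ "\<lambda>v. t * r v"]) simp
  qed
  \<comment> \<open>A monomial of degree more than \<open>s\<close> times the number of variables is divisible by some \<open>v\<^sup>s\<close>.\<close>
  define p where "p = Suc (card (UNIV :: 'v set) * s)"
  have "f ^ p \<in> {\<Sum>v\<in>UNIV. var v ^ s * r v | r. True}"
  proof (rule in_ideal_if_mon_in_ideal[OF id])
    fix a assume "a \<in> Poly_Mapping.keys (f ^ p)"
    then have "p \<le> tdeg a"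
      using power_in_mono_ideal_tdeg[OF assms, of p] by (auto simp: mono_ideal_def)
    have "\<exists>v. s \<le> Poly_Mapping.lookup a v"
    proof (rule ccontr)
      assume "\<not> ?thesis"
      then have "tdeg a \<le> card (UNIV :: 'v set) * s" unfolding tdeg_def
        by (intro order.trans[OF sum_bounded_above[of _ _ s]]) (auto simp: not_le less_imp_le)
      with \<open>p \<le> tdeg a\<close> show False by (simp add: p_def)
    qed
    then obtain v where v: "s \<le> Poly_Mapping.lookup a v" by blast
    have a: "a = Poly_Mapping.single v s + (a - Poly_Mapping.single v s)"
      using v by (intro poly_mapping_eqI) (auto simp: lookup_add lookup_minus lookup_single when_def)
    have "(\<Sum>u\<in>UNIV. var u ^ s * (if u = v then mon (a - Poly_Mapping.single v s) else 0)) =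
       (\<Sum>u\<in>UNIV. if u = v then mon a else 0 :: ('v, 'k) mpoly)"
      using a by (intro sum.cong refl) (auto simp: var_power mon_add[symmetric])
    also have "\<dots> = mon a" by simp
    finally show "(mon a :: ('v, 'k) mpoly) \<in> {\<Sum>v\<in>UNIV. var v ^ s * r v | r. True}"
      by (intro CollectI exI[of _ "\<lambda>u. if u = v then mon (a - Poly_Mapping.single v s) else 0"]) simp
  qed
  then show ?thesis by blast
qed

text \<open>
  The \<open>1\<close>-form \<open>a\<^sup>s e\<^sub>a + b\<^sup>s e\<^sub>b\<close> of a pair \<open>(a, b)\<close> of variables, and the basis form \<open>e\<^sub>v\<close>.
\<close>

definition pair_form :: "nat \<Rightarrow> 'v \<times> 'v \<Rightarrow> 'v \<Rightarrow> ('v::finite, 'k::field) mpoly" where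
  "pair_form s p v = (if v = fst p \<or> v = snd p then var v ^ s else 0)"

definition basis_form :: "'v \<Rightarrow> 'v \<Rightarrow> ('v::finite, 'k::field) mpoly" where
  "basis_form u v = (if v = u then 1 else 0)"

text \<open>
  The coefficients of the exterior product of the forms of all pairs are sums of products that contain
  one factor \<open>a\<^sup>s\<close> or \<open>b\<^sup>s\<close> for each pair \<open>(a, b)\<close>.
\<close>

lemma form_prod_pairs_in_ideal:
  fixes U :: "('v::finite \<Rightarrow>\<^sub>0 nat) set"
  assumes "upset U"
    and "\<And>t. (\<And>p. p \<in> set ps \<Longrightarrow> fst p \<in> t \<or> snd p \<in> t) \<Longrightarrow>
      h + expo (\<lambda>v. if v \<in> t then s else 0) \<in> U"
  shows "mon h * form_prod (map (pair_form s) ps @ map basis_form os) A \<in> (mono_ideal U :: ('v, 'k::field) mpoly set)"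
  using assms(2)
proof (induction ps arbitrary: h A)
  case Nil
  have "h + expo (\<lambda>v. if v \<in> {} then s else 0) \<in> U" by (rule Nil) auto
  also have "expo (\<lambda>v. if v \<in> {} then s else 0) = 0" by (rule poly_mapping_eqI) simp
  finally show ?case
    by (intro is_ideal_mult_right is_ideal_mono_ideal assms(1)) simp
next
  case (Cons p ps)
  define F :: "'v set \<Rightarrow> ('v, 'k) mpoly" where "F = form_prod (map (pair_form s) ps @ map basis_form os)"
  have "mon h * form_prod (map (pair_form s) (p # ps) @ map basis_form os) A =
     (\<Sum>v\<in>A. mon h * (pair_form s p v * (ksign v A * F (A - {v}))))"
    by (simp add: form_prod_Cons wedge_def F_def sum_distrib_left)
  also have "\<dots> \<in> mono_ideal U"
  proof (intro is_ideal_sum is_ideal_mono_ideal assms(1))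
    fix v
    show "mon h * (pair_form s p v * (ksign v A * F (A - {v}))) \<in> mono_ideal U"
    proof (cases "v = fst p \<or> v = snd p")
      case True
      have "mon (h + Poly_Mapping.single v s) * F (A - {v}) \<in> mono_ideal U"
        unfolding F_def
      proof (rule Cons.IH)
        fix t assume t: "\<And>p. p \<in> set ps \<Longrightarrow> fst p \<in> t \<or> snd p \<in> t"
        have "h + expo (\<lambda>u. if u \<in> insert v t then s else 0) \<in> U"
          using True t by (intro Cons.prems) auto
        then have "h + expo (\<lambda>u. if u \<in> insert v t then s else 0) +
            Poly_Mapping.single v (if v \<in> t then s else 0) \<in> U"
          using assms(1) unfolding upset_def by blast
        also have "h + expo (\<lambda>u. if u \<in> insert v t then s else 0) +
            Poly_Mapping.single v (if v \<in> t then s else 0) =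
            h + Poly_Mapping.single v s + expo (\<lambda>u. if u \<in> t then s else 0)"
          by (rule poly_mapping_eqI) (auto simp: lookup_add lookup_single when_def)
        finally show "h + Poly_Mapping.single v s + expo (\<lambda>u. if u \<in> t then s else 0) \<in> U" .
      qed
      then have "ksign v A * (mon (h + Poly_Mapping.single v s) * F (A - {v})) \<in> mono_ideal U"
        by (rule is_ideal_mult[OF is_ideal_mono_ideal[OF assms(1)]])
      then show ?thesis using True by (simp add: pair_form_def var_power mon_add mult_ac)
    qed (simp add: pair_form_def is_ideal_zero[OF is_ideal_mono_ideal[OF assms(1)]])
  qed
  finally show ?case .
qed

lemma wedge_combination_eq_0:
  assumes "\<And>v. w v = (\<Sum>p\<in>P. f p v) + (\<Sum>p\<in>P'. r p * g p v)"
    and "\<And>p. p \<in> P \<Longrightarrow> f p \<in> set ws" "\<And>p. p \<in> P' \<Longrightarrow> g p \<in> set ws"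
  shows "wedge w (form_prod ws) s = 0"
proof -
  have "w = (\<lambda>v. (\<Sum>p\<in>P. f p v) + (\<Sum>p\<in>P'. r p * g p v))" using assms(1) by auto
  then have "wedge w (form_prod ws) s = (\<Sum>p\<in>P. wedge (f p) (form_prod ws) s) +
      (\<Sum>p\<in>P'. r p * wedge (g p) (form_prod ws) s)"
    by (simp only: wedge_add_left wedge_sum_left wedge_smult_left)
  then show ?thesis using assms(2,3) by (simp add: wedge_form_prod_eq_0)
qed

lemma lookup_var_power_mult_eq_0:
  "Poly_Mapping.lookup a v < s \<Longrightarrow> Poly_Mapping.lookup (var v ^ s * f) a = 0"
proof -
  assume "Poly_Mapping.lookup a v < s"
  then have "a \<notin> Poly_Mapping.keys (var v ^ s * f)"
    unfolding var_power keys_mon_mult by (auto simp: lookup_add)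
  then show ?thesis by (simp add: in_keys_iff)
qed

lemma lookup_wedge:
  "Poly_Mapping.lookup (wedge w c A) a = (\<Sum>v\<in>A. Poly_Mapping.lookup (w v * (ksign v A * c (A - {v}))) a)"
  by (simp add: wedge_def lookup_sum)

lemma sum_pair_forms:
  fixes ps :: "('v::finite \<times> 'v) list"
  assumes "distinct (map fst ps @ map snd ps)"
  shows "(\<Sum>p\<in>set ps. pair_form s p v) =
    (if v \<in> fst ` set ps \<union> snd ` set ps then var v ^ s else 0 :: ('v, 'k::field) mpoly)"
  using assms
proof (induction ps)
  case (Cons p ps)
  have "(\<Sum>q\<in>set (p # ps). pair_form s q v) = pair_form s p v + (\<Sum>q\<in>set ps. pair_form s q v :: ('v, 'k) mpoly)"
    using Cons.prems by (auto intro!: sum.insert)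
  also have "(\<Sum>q\<in>set ps. pair_form s q v :: ('v, 'k) mpoly) =
      (if v \<in> fst ` set ps \<union> snd ` set ps then var v ^ s else 0)"
    using Cons by auto
  finally show ?case using Cons.prems by (auto simp: pair_form_def)
qed simp

text \<open>
  Let \<open>P\<close> be a nonempty list of disjoint pairs of variables, \<open>O\<close> the set of the remaining variables,
  and \<open>h\<close> an exponent such that \<open>x\<^sup>h\<close> becomes an element of the ideal after multiplication by \<open>a\<^sup>s\<close>
  or \<open>b\<^sup>s\<close> for every pair \<open>(a, b)\<close>, but not after multiplication by the \<open>b\<^sup>s\<close> of all pairs except
  one; at the variables in \<open>O\<close>, the exponent \<open>h\<close> is less than \<open>s\<close>. Drop one pair; then \<open>x\<^sup>h\<close> times the
  exterior product of the forms \<open>a\<^sup>s e\<^sub>a + b\<^sup>s e\<^sub>b\<close> of the other pairs and of the \<open>e\<^sub>v\<close> for \<open>v \<in> O\<close> is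
  a cocycle of degree \<open>|P| - 1 + |O| = N - |P| - 1\<close> which is not a coboundary, where \<open>N\<close> is the number
  of all variables.
\<close>

lemma no_long_regular_sequence:
  fixes U :: "('v::finite \<Rightarrow>\<^sub>0 nat) set" and fs :: "('v, 'k::field) mpoly list"
    and ps :: "('v \<times> 'v) list"
  assumes U: "upset U"
    and dist: "distinct (map fst ps @ map snd ps)" and "ps \<noteq> []"
    and trans: "\<And>t. (\<And>p. p \<in> set ps \<Longrightarrow> fst p \<in> t \<or> snd p \<in> t) \<Longrightarrow>
      h + expo (\<lambda>v. if v \<in> t then s else 0) \<in> U"
    and skip: "\<And>p. p \<in> set ps \<Longrightarrow> h + expo (\<lambda>v. if v \<in> snd ` set ps - {snd p} then s else 0) \<notin> U"
    and rest: "\<And>v. v \<notin> fst ` set ps \<union> snd ` set ps \<Longrightarrow> Poly_Mapping.lookup h v < s"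
    and fs: "wreg (mono_ideal U) fs" "set fs \<subseteq> mono_ideal (- {0})"
  shows "length fs < CARD('v) - length ps"
proof (rule ccontr)
  assume len: "\<not> ?thesis"
  obtain p0 ps' where ps: "ps = p0 # ps'" using \<open>ps \<noteq> []\<close> by (cases ps) auto
  define B where "B = snd ` set ps"
  define O' where "O' = - (fst ` set ps \<union> B)"
  obtain os where os: "set os = O'" "distinct os" using finite_distinct_list[of O'] by auto
  define z :: "'v \<Rightarrow> ('v, 'k) mpoly" where "z = (\<lambda>v. var v ^ s)"
  define ws :: "('v \<Rightarrow> ('v, 'k) mpoly) list" where "ws = map (pair_form s) ps' @ map basis_form os"
  define c where "c = (\<lambda>A. mon h * form_prod ws A)"
  have idQ: "is_ideal (mono_ideal U :: ('v, 'k) mpoly set)" by (rule is_ideal_mono_ideal[OF U])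
  have cardO: "CARD('v) = length os + 2 * length ps"
  proof -
    have "card (fst ` set ps \<union> B) = length (map fst ps @ map snd ps)"
      using distinct_card[OF dist] by (simp add: B_def)
    moreover have "card O' = length os" using distinct_card[OF os(2)] os(1) by simp
    moreover have "card (UNIV :: 'v set) = card (fst ` set ps \<union> B) + card O'"
      unfolding O'_def using card_Un_disjoint[OF finite finite Compl_disjoint[of "fst ` set ps \<union> B"]]
      by (simp only: Compl_partition)
    ultimately show ?thesis by simp
  qed
  then have lenws: "length ws < length fs" using len by (simp add: ws_def ps)
  have rest_sum: "(if v \<in> O' then r v else 0) = (\<Sum>u\<in>O'. r u * basis_form u v)"
    for r :: "'v \<Rightarrow> ('v, 'k) mpoly" and v
  proof -
    have "(\<Sum>u\<in>O'. r u * basis_form u v) = (\<Sum>u\<in>O'. if u = v then r v else 0)"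
      by (intro sum.cong refl) (auto simp: basis_form_def)
    then show ?thesis by simp
  qed
  have dist': "distinct (map fst ps' @ map snd ps')" using dist by (auto simp: ps)
  have p0: "fst p0 \<notin> fst ` set ps'" "fst p0 \<notin> snd ` set ps'" "snd p0 \<notin> fst ` set ps'"
      "snd p0 \<notin> snd ` set ps'" "fst p0 \<noteq> snd p0"
    using dist by (auto simp: ps image_iff)
  have fstB: "fst p \<notin> B" if "p \<in> set ps" for p
    using dist that by (auto simp: B_def)

  \<comment> \<open>The differential only sees the dropped pair, since the other summands of \<open>z\<close> are combinations
     of factors of the exterior product.\<close>
  have cocycle: "wedge z c A \<in> mono_ideal U" for A
  proof -
    define w where "w = (\<lambda>v. if v = fst p0 \<or> v = snd p0 then 0 else z v)"
    have "wedge w (form_prod ws) A = 0"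
    proof (rule wedge_combination_eq_0)
      fix v
      show "w v = (\<Sum>p\<in>set ps'. pair_form s p v) + (\<Sum>u\<in>O'. z u * basis_form u v)"
        unfolding rest_sum[symmetric] sum_pair_forms[OF dist']
        using p0 by (auto simp: w_def z_def O'_def B_def ps)
    qed (auto simp: ws_def os)
    moreover have "z = (\<lambda>v. pair_form s p0 v + w v)"
      by (auto simp: z_def w_def pair_form_def)
    ultimately have "wedge z (form_prod ws) A = wedge (pair_form s p0) (form_prod ws) A"
      by (simp add: wedge_add_left)
    then have "wedge z c A = mon h * form_prod (map (pair_form s) ps @ map basis_form os) A"
      by (simp add: c_def wedge_smult ws_def ps form_prod_Cons)
    also have "\<dots> \<in> mono_ideal U"
    proof (rule form_prod_pairs_in_ideal[OF U])
      show "h + expo (\<lambda>v. if v \<in> t then s else 0) \<in> U"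
        if "\<And>p. p \<in> set ps \<Longrightarrow> fst p \<in> t \<or> snd p \<in> t" for t
        using that by (rule trans)
    qed
    finally show ?thesis .
  qed
  have "\<exists>b. (\<forall>A. Suc (card A) \<noteq> length ws \<longrightarrow> b A = 0) \<and> (\<forall>A. c A - wedge z b A \<in> mono_ideal U)"
  proof (rule koszul_vanishing[OF idQ fs(1) _ _ lenws cocycle])
    show "\<exists>p r. f ^ p = (\<Sum>v\<in>UNIV. z v * r v)" if "f \<in> set fs" for f
      unfolding z_def using fs(2) that by (intro maximal_ideal_nilpotent) auto
    show "c A = 0" if "card A \<noteq> length ws" for A
      using form_prod_degree[OF that] by (simp add: c_def)
  qed
  then obtain b where b: "\<And>A. c A - wedge z b A \<in> mono_ideal U" by blast

  \<comment> \<open>The class is detected by the linear form that maps a cochain \<open>y\<close> to the coefficient of the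
     monomial \<open>\<mu>\<close> in the component of \<open>wedge zB y\<close> at \<open>T\<close>. It vanishes on cochains with values in the
     ideal and on coboundaries, but not on \<open>c\<close>.\<close>
  define zB where "zB = (\<lambda>v. if v \<in> B then z v else 0)"
  define zO where "zO = (\<lambda>v. if v \<in> O' then z v else 0)"
  define \<mu> where "\<mu> = h + expo (\<lambda>v. if v \<in> B then s else 0)"
  define T where "T = O' \<union> B"
  define q where "q = (\<lambda>A. c A - wedge z b A)"
  have "wedge zB q T = wedge zB c T - wedge zB (wedge z b) T"
    unfolding q_def by (rule wedge_diff)
  moreover have "Poly_Mapping.lookup (wedge zB q T) \<mu> = 0"
    unfolding lookup_wedge
  proof (intro sum.neutral ballI)
    fix v
    show "Poly_Mapping.lookup (zB v * (ksign v T * q (T - {v}))) \<mu> = 0"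
    proof (cases "v \<in> B")
      case True
      then obtain p where p: "p \<in> set ps" "v = snd p" by (auto simp: B_def)
      have \<mu>: "\<mu> = Poly_Mapping.single v s + (h + expo (\<lambda>u. if u \<in> B - {v} then s else 0))"
        using True unfolding \<mu>_def
        by (intro poly_mapping_eqI) (auto simp: lookup_add lookup_single when_def)
      have "ksign v T * q (T - {v}) \<in> mono_ideal U"
        using b unfolding q_def by (intro is_ideal_mult[OF idQ])
      then have "h + expo (\<lambda>u. if u \<in> B - {v} then s else 0) \<notin> Poly_Mapping.keys (ksign v T * q (T - {v}))"
        using skip[OF p(1)] p(2) by (auto simp: mono_ideal_def B_def)
      then show ?thesis
        using True unfolding \<mu> zB_def z_def var_power by (simp add: lookup_mon_mult in_keys_iff)
    qed (simp add: zB_def)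
  qed
  moreover have "Poly_Mapping.lookup (wedge zB (wedge z b) T) \<mu> = 0"
  proof -
    have "wedge zB (wedge z b) T = - wedge z (wedge zB b) T" by (rule wedge_anticommute)
    also have "wedge z (wedge zB b) T = wedge (\<lambda>v. zB v + zO v) (wedge zB b) T"
      by (rule wedge_cong) (auto simp: T_def zB_def zO_def O'_def)
    also have "\<dots> = wedge zO (wedge zB b) T" by (simp add: wedge_add_left)
    finally have "Poly_Mapping.lookup (wedge zB (wedge z b) T) \<mu> =
        - Poly_Mapping.lookup (wedge zO (wedge zB b) T) \<mu>" by simp
    also have "Poly_Mapping.lookup (wedge zO (wedge zB b) T) \<mu> = 0"
      unfolding lookup_wedge
    proof (intro sum.neutral ballI)
      fix v
      show "Poly_Mapping.lookup (zO v * (ksign v T * wedge zB b (T - {v}))) \<mu> = 0"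
      proof (cases "v \<in> O'")
        case True
        then have "Poly_Mapping.lookup \<mu> v < s"
          using rest[of v] by (auto simp: \<mu>_def lookup_add O'_def B_def)
        then show ?thesis using True by (simp add: zO_def z_def lookup_var_power_mult_eq_0)
      qed (simp add: zO_def)
    qed
    finally show ?thesis by simp
  qed
  moreover have "Poly_Mapping.lookup (wedge zB c T) \<mu> \<noteq> 0"
  proof -
    define r where "r = (\<lambda>v. if v \<in> B then z v else 1)"
    define bf where "bf = (\<lambda>v u. if u = v then r v else 0)"
    define us where "us = map snd ps' @ os"
    have B: "B = insert (snd p0) (snd ` set ps')" by (auto simp: B_def ps)
    have "wedge zB c T = mon h * wedge zB (form_prod ws) T"
      by (simp add: c_def wedge_smult)
    also have "wedge zB (form_prod ws) T = wedge zB (form_prod (map bf us)) T"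
    proof (rule wedge_cong[OF refl form_prod_cong])
      fix t i v assume t: "t \<subseteq> T" "i < length ws" "v \<in> t"
      show "(ws ! i) v = (map bf us ! i) v"
      proof (cases "i < length ps'")
        case True
        define p where "p = ps' ! i"
        have p: "p \<in> set ps" using True by (simp add: p_def ps)
        have "v \<noteq> fst p" using t fstB[OF p] p by (auto simp: T_def O'_def)
        moreover have "snd p \<in> B" using p by (simp add: B_def)
        moreover have "(ws ! i) = pair_form s p" "(map bf us ! i) = bf (snd p)"
          using True by (simp_all add: ws_def us_def nth_append p_def)
        ultimately show ?thesis by (auto simp: pair_form_def bf_def r_def z_def)
      next
        case False
        define u where "u = os ! (i - length ps')"
        have "(ws ! i) = basis_form u" "(map bf us ! i) = bf u"
          using False t(2) by (simp_all add: ws_def us_def nth_append u_def)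
        moreover have "u \<in> O'" using False t(2) os(1) by (auto simp: u_def ws_def)
        then have "u \<notin> B" by (simp add: O'_def)
        ultimately show ?thesis by (auto simp: basis_form_def bf_def r_def)
      qed
    qed (simp add: ws_def us_def)
    also have "\<dots> = wedge (bf (snd p0)) (form_prod (map bf us)) T"
    proof -
      have "wedge (\<lambda>v. if v \<in> snd ` set ps' then z v else 0) (form_prod (map bf us)) T = 0"
      proof (rule wedge_combination_eq_0)
        fix v
        have "(\<Sum>u\<in>snd ` set ps'. bf u v) = (\<Sum>u\<in>snd ` set ps'. if u = v then z v else 0)"
          by (intro sum.cong refl) (auto simp: bf_def r_def B)
        then show "(if v \<in> snd ` set ps' then z v else 0) =
            (\<Sum>u\<in>snd ` set ps'. bf u v) + (\<Sum>u\<in>{}. 0 * bf u v)" by simp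
      qed (auto simp: us_def)
      moreover have "zB = (\<lambda>v. bf (snd p0) v + (if v \<in> snd ` set ps' then z v else 0))"
        using p0 by (auto simp: zB_def bf_def r_def B)
      ultimately show ?thesis by (simp add: wedge_add_left)
    qed
    also have "\<dots> = form_prod (map bf (snd p0 # us)) T" by (simp add: form_prod_Cons)
    finally have eq: "wedge zB c T = mon h * form_prod (map bf (snd p0 # us)) T" .
    have T: "T = set (snd p0 # us)" by (auto simp: T_def us_def B os)
    have dus: "distinct (snd p0 # us)"
      using dist os by (auto simp: us_def ps O'_def B_def)
    obtain e where e: "e \<in> {1, - 1}"
      "form_prod (map bf (snd p0 # us)) (set (snd p0 # us)) = e * prod_list (map r (snd p0 # us))"
      using form_prod_basis[OF dus, of r] unfolding bf_def by blast
    have "prod_list (map r (snd p0 # us)) = (\<Prod>v\<in>T. r v)"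
      unfolding T by (rule prod.distinct_set_conv_list[OF dus, symmetric])
    also have "\<dots> = (\<Prod>v\<in>B. z v)"
      by (intro prod.mono_neutral_cong_right) (auto simp: T_def r_def)
    also have "\<dots> = mon (\<Sum>v\<in>B. Poly_Mapping.single v s)"
      by (simp add: z_def var_power mon_sum)
    also have "(\<Sum>v\<in>B. Poly_Mapping.single v s) = expo (\<lambda>v. if v \<in> B then s else 0)"
      by (rule poly_mapping_eqI) (simp add: lookup_sum lookup_single when_def)
    finally have "wedge zB c T = e * mon \<mu>"
      using eq e(2) unfolding T[symmetric] by (simp add: \<mu>_def mon_add)
    then show ?thesis using e(1) by (auto simp: mon_def)
  qed
  ultimately show False by (simp add: lookup_minus)
qed

section \<open>Exponents of the monomials in symbolic powers\<close>

text \<open>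
  The exponents of the monomials of order at least \<open>k\<close> at every edge of \<open>H\<close>, that is, of the
  monomials in the intersection of the ideals \<open>(u, v)\<^sup>k\<close> for the edges \<open>{u, v}\<close>.
\<close>

definition edge_powers :: "'v set set \<Rightarrow> nat \<Rightarrow> ('v \<Rightarrow>\<^sub>0 nat) set" where
  "edge_powers H k = {a. \<forall>e\<in>H. k \<le> (\<Sum>v\<in>e. Poly_Mapping.lookup a v)}"

lemma upset_edge_powers: "upset (edge_powers H k)"
  by (auto simp: upset_def edge_powers_def lookup_add sum.distrib intro: le_trans[OF _ le_add1])

lemma edge_powers_failure:
  assumes "simple_graph H" "g \<notin> edge_powers H k"
  obtains u v where "u \<noteq> v" "{u, v} \<in> H" "Poly_Mapping.lookup g u + Poly_Mapping.lookup g v < k"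
proof -
  obtain e where e: "e \<in> H" "(\<Sum>v\<in>e. Poly_Mapping.lookup g v) < k"
    using assms(2) by (auto simp: edge_powers_def not_le)
  then obtain u v where "e = {u, v}" "u \<noteq> v"
    using assms(1) by (auto simp: simple_graph_def card_2_iff)
  with e show thesis using that[of u v] by auto
qed

section \<open>Filtrations for the symbolic powers\<close>

lemma prime_filtration_failing_edge:
  assumes "{u, v} \<in> H" "u \<noteq> v" "Poly_Mapping.lookup g u + Poly_Mapping.lookup g v < k"
    and "u \<in> Z" "v \<in> Z" "card Z \<le> q"
  shows "prime_filtration (edge_powers H k) q g Z"
proof (rule prime_filtration.cell)
  fix a :: "'a \<Rightarrow>\<^sub>0 nat" assume "\<forall>v\<in>Z. Poly_Mapping.lookup a v = 0"
  then show "g + a \<notin> edge_powers H k"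
    using assms by (auto simp: edge_powers_def lookup_add intro!: bexI[of _ "{u, v}"])
qed (use assms in auto)

lemma prime_filtration_split_edge:
  fixes Z :: "'v::finite set"
  assumes "{u, v} \<in> H" "u \<noteq> v" "Poly_Mapping.lookup g u + Poly_Mapping.lookup g v < k"
    and "u \<notin> Z" "v \<in> Z" "card Z < q"
    and "prime_filtration (edge_powers H k) q (g + Poly_Mapping.single u 1) Z"
  shows "prime_filtration (edge_powers H k) q g Z"
proof (rule prime_filtration.split[OF assms(4) _ assms(7)])
  show "prime_filtration (edge_powers H k) q g (insert u Z)"
    using assms by - (rule prime_filtration_failing_edge[of u v]; auto)
qed

lemma sum_deficit_decreases:
  fixes g :: "'v::finite \<Rightarrow>\<^sub>0 nat"
  assumes "Poly_Mapping.lookup g u < k"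
  shows "(\<Sum>v\<in>UNIV. k - Poly_Mapping.lookup (g + Poly_Mapping.single u 1) v) < (\<Sum>v\<in>UNIV. k - Poly_Mapping.lookup g v)"
proof (rule sum_strict_mono_ex1)
  show "\<exists>v\<in>UNIV. k - Poly_Mapping.lookup (g + Poly_Mapping.single u 1) v < k - Poly_Mapping.lookup g v"
    using assms by (intro bexI[of _ u]) (auto simp: lookup_add)
qed (auto simp: lookup_add)

lemma card_Compl_insert: "u \<notin> Z \<Longrightarrow> card (- insert u Z) < card (- Z)" for Z :: "'v::finite set"
  by (intro psubset_card_mono) auto

text \<open>
  The fibres of \<open>\<kappa>\<close> are cliques that cover the graph. Vertices \<open>u\<close> with \<open>2 g\<^sub>u < k\<close> are processed
  first. If the clique of \<open>u\<close> contains no element of \<open>Z\<close>, then \<open>u\<close> may be added to \<open>Z\<close>; otherwise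
  adding \<open>u\<close> violates the edge to the element of \<open>Z\<close> for good. When no such \<open>u\<close> is left outside
  \<open>Z\<close>, every violated edge meets \<open>Z\<close>. In all cases \<open>Z\<close> grows by at most one beyond a partial
  transversal of the cliques.
\<close>

lemma prime_filtration_clique_cover:
  fixes H :: "'v::finite set set" and \<kappa> :: "'v \<Rightarrow> 'b::finite"
  assumes H: "simple_graph H"
    and cliques: "\<And>u v. u \<noteq> v \<Longrightarrow> \<kappa> u = \<kappa> v \<Longrightarrow> {u, v} \<in> H"
  assumes "inj_on \<kappa> Z" "\<And>z. z \<in> Z \<Longrightarrow> 2 * Poly_Mapping.lookup g z < k"
  shows "prime_filtration (edge_powers H k) (Suc CARD('b)) g Z"
  using assms(3,4)
proof (induction "(\<Sum>v\<in>UNIV. k - Poly_Mapping.lookup g v) + card (- Z)" arbitrary: g Z rule: less_induct)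
  case less
  let ?F = "prime_filtration (edge_powers H k) (Suc CARD('b))"
  have card: "card Z < Suc CARD('b)"
    using card_inj_on_le[OF less.prems(1), of UNIV] by auto
  have raise: "?F (g + Poly_Mapping.single u 1) Z" if "u \<notin> Z" "Poly_Mapping.lookup g u < k" for u
  proof (rule less.hyps)
    show "2 * Poly_Mapping.lookup (g + Poly_Mapping.single u 1) z < k" if "z \<in> Z" for z
      using less.prems(2)[OF that] \<open>u \<notin> Z\<close> that by (auto simp: lookup_add lookup_single when_def)
  qed (use sum_deficit_decreases[OF that(2)] less.prems(1) in auto)
  show ?case
  proof (cases "\<exists>u. u \<notin> Z \<and> 2 * Poly_Mapping.lookup g u < k")
    case True
    then obtain u where u: "u \<notin> Z" "2 * Poly_Mapping.lookup g u < k" by blast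
    note raise_u = raise[OF u(1)]
    show ?thesis
    proof (cases "\<exists>z\<in>Z. \<kappa> z = \<kappa> u")
      case True
      then obtain z where z: "z \<in> Z" "\<kappa> z = \<kappa> u" by blast
      have "u \<noteq> z" using z u by blast
      moreover from this have "{u, z} \<in> H" using z by (intro cliques) auto
      ultimately show ?thesis
        using u z less.prems(2)[OF z(1)] card raise_u
        by - (rule prime_filtration_split_edge[of u z]; auto)
    next
      case False
      have "?F g (insert u Z)"
        using card_Compl_insert[OF u(1)] less.prems u False
        by (intro less.hyps) (auto simp: inj_on_insert)
      then show ?thesis using raise_u u by - (rule prime_filtration.split[of u]; auto)
    qed
  next
    case False
    then have big: "k \<le> 2 * Poly_Mapping.lookup g u" if "u \<notin> Z" for u
      using that by (meson not_le)
    show ?thesis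
    proof (cases "g \<in> edge_powers H k")
      case True
      then show ?thesis by (rule prime_filtration.zero)
    next
      case False
      then obtain u v where uv: "u \<noteq> v" "{u, v} \<in> H"
          "Poly_Mapping.lookup g u + Poly_Mapping.lookup g v < k"
        using edge_powers_failure[OF H] by blast
      consider "u \<in> Z" "v \<in> Z" | "u \<notin> Z" "v \<in> Z" | "u \<in> Z" "v \<notin> Z" | "u \<notin> Z" "v \<notin> Z" by blast
      then show ?thesis
      proof cases
        case 1
        then show ?thesis using uv card by - (rule prime_filtration_failing_edge[of u v]; auto)
      next
        case 2
        then show ?thesis
          using uv card raise[of u] by - (rule prime_filtration_split_edge[of u v]; auto)
      next
        case 3
        then show ?thesis
          using uv card raise[of v] by - (rule prime_filtration_split_edge[of v u]; auto simp: insert_commute)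
      next
        case 4
        then show ?thesis using big[of u] big[of v] uv(3) by linarith
      qed
    qed
  qed
qed

text \<open>
  For \<open>k = 1\<close> only vertices in the vertex cover \<open>L\<close> are added to \<open>Z\<close>, as long as \<open>Z\<close> stays
  independent. A vertex that is adjacent to an element of \<open>Z\<close> is added only when this violates
  an edge for good.
\<close>

lemma prime_filtration_independent:
  fixes H :: "'v::finite set set"
  assumes H: "simple_graph H"
    and cover: "\<And>u v. {u, v} \<in> H \<Longrightarrow> u \<in> L \<or> v \<in> L"
    and \<alpha>: "\<And>A. A \<subseteq> L \<Longrightarrow> independent_set H A \<Longrightarrow> card A \<le> \<alpha>"
  assumes "Z \<subseteq> L" "independent_set H Z" "\<And>z. z \<in> Z \<Longrightarrow> Poly_Mapping.lookup g z = 0"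
  shows "prime_filtration (edge_powers H 1) (Suc \<alpha>) g Z"
  using assms(4-6)
proof (induction "(\<Sum>v\<in>UNIV. 1 - Poly_Mapping.lookup g v) + card (- Z)" arbitrary: g Z rule: less_induct)
  case less
  let ?F = "prime_filtration (edge_powers H 1) (Suc \<alpha>)"
  have card: "card Z < Suc \<alpha>" using \<alpha>[OF less.prems(1,2)] by simp
  have raise: "?F (g + Poly_Mapping.single u 1) Z" if "u \<notin> Z" "Poly_Mapping.lookup g u = 0" for u
  proof (rule less.hyps)
    show "Poly_Mapping.lookup (g + Poly_Mapping.single u 1) z = 0" if "z \<in> Z" for z
      using less.prems(3)[OF that] \<open>u \<notin> Z\<close> that by (auto simp: lookup_add lookup_single when_def)
  qed (use sum_deficit_decreases[of g u 1] that less.prems(1,2) in auto)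
  have edge: ?case if "{u, z} \<in> H" "u \<notin> Z" "z \<in> Z" "Poly_Mapping.lookup g u = 0" for u z
    using that card raise[of u] less.prems(3)[of z]
    by - (rule prime_filtration_split_edge[of u z]; auto)
  have vertex: ?case if "u \<in> L" "u \<notin> Z" "Poly_Mapping.lookup g u = 0" for u
  proof (cases "\<exists>z\<in>Z. {u, z} \<in> H")
    case True
    then show ?thesis using edge that by blast
  next
    case False
    have "{u} \<notin> H" using H by (auto simp: simple_graph_def)
    then have "independent_set H (insert u Z)"
      using False less.prems(2) by (auto simp: independent_set_def insert_commute)
    then have "?F g (insert u Z)"
      using that less.prems(1,3) card_Compl_insert[OF that(2)] by (intro less.hyps) auto
    then show ?thesis using raise[of u] that by - (rule prime_filtration.split[of u]; auto)
  qed
  show ?case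
  proof (cases "g \<in> edge_powers H 1")
    case True
    then show ?thesis by (rule prime_filtration.zero)
  next
    case False
    then obtain u v where uv: "u \<noteq> v" "{u, v} \<in> H"
        "Poly_Mapping.lookup g u + Poly_Mapping.lookup g v < 1"
      using edge_powers_failure[OF H] by blast
    then have "\<not> (u \<in> Z \<and> v \<in> Z)" using less.prems(2) by (auto simp: independent_set_def)
    then consider "u \<notin> Z" "v \<in> Z" | "u \<in> Z" "v \<notin> Z" | "u \<notin> Z" "v \<notin> Z" by blast
    then show ?thesis
    proof cases
      case 1
      then show ?thesis using edge[of u v] uv by auto
    next
      case 2
      then show ?thesis using edge[of v u] uv by (auto simp: insert_commute)
    next
      case 3
      then show ?thesis using cover[OF uv(2)] vertex[of u] vertex[of v] uv(3) by auto
    qed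
  qed
qed

section \<open>Clique-whiskered graphs\<close>

text \<open>A graph with a clique vertex-partition; \<open>H\<close> denotes the fully clique-whiskered graph.\<close>

locale whiskered =
  fixes E :: "'a::finite set set" and W :: "'b::finite \<Rightarrow> 'a set"
  assumes simple: "simple_graph E" and inj: "inj W" and cvp: "clique_vertex_partition E (range W)"
begin

abbreviation "H \<equiv> clique_whiskered E W"

lemma W_cover: "\<exists>i. x \<in> W i"
  using cvp by (auto simp: clique_vertex_partition_def partition_on_def)

lemma W_nonempty: "W i \<noteq> {}"
  using cvp unfolding clique_vertex_partition_def partition_on_def by (metis rangeI)

lemma W_unique: "x \<in> W i \<Longrightarrow> x \<in> W j \<Longrightarrow> i = j"
  using cvp inj unfolding clique_vertex_partition_def partition_on_def disjoint_def
  by (metis IntI empty_iff injD rangeI)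

lemma W_clique: "x \<in> W i \<Longrightarrow> y \<in> W i \<Longrightarrow> x \<noteq> y \<Longrightarrow> {x, y} \<in> E"
  using cvp by (auto simp: clique_vertex_partition_def clique_def)

lemma edge_cases:
  assumes "e \<in> H"
  obtains (old) x y where "x \<noteq> y" "{x, y} \<in> E" "e = {Inl x, Inl y}"
  | (whisker) x i where "x \<in> W i" "e = {Inl x, Inr i}"
proof -
  from assms consider e' where "e' \<in> E" "e = Inl ` e'" | x i where "x \<in> W i" "e = {Inl x, Inr i}"
    unfolding clique_whiskered_def by blast
  then show thesis
  proof cases
    case 1
    then obtain x y where "e' = {x, y}" "x \<noteq> y"
      using simple by (auto simp: simple_graph_def card_2_iff)
    with 1 show ?thesis by (intro old[of x y]) auto
  next
    case 2
    then show ?thesis by (rule whisker)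
  qed
qed

lemma old_edge_iff: "{Inl x, Inl y} \<in> H \<longleftrightarrow> {x, y} \<in> E"
proof
  assume "{x, y} \<in> E"
  then have "Inl ` {x, y} \<in> H" unfolding clique_whiskered_def by blast
  then show "{Inl x, Inl y} \<in> H" by simp
next
  assume "{Inl x, Inl y} \<in> H"
  then show "{x, y} \<in> E"
    by (cases rule: edge_cases) (auto simp: doubleton_eq_iff insert_commute)
qed

lemma whisker_edge: "x \<in> W i \<Longrightarrow> {Inl x, Inr i} \<in> H"
  by (auto simp: clique_whiskered_def)

lemma simple_H: "simple_graph H"
  unfolding simple_graph_def
proof
  fix e assume "e \<in> H"
  then show "card e = 2" by (cases rule: edge_cases) auto
qed

lemma prime_filtration_general: "prime_filtration (edge_powers H k) (Suc CARD('b)) 0 {}"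
proof -
  define cl where "cl x = (THE i. x \<in> W i)" for x
  have cl: "x \<in> W (cl x)" for x
    unfolding cl_def using W_cover[of x] W_unique[of x] by (metis theI)
  define \<kappa> where "\<kappa> = case_sum cl id"
  show ?thesis
  proof (rule prime_filtration_clique_cover[of _ \<kappa>, OF simple_H])
    fix u v :: "'a + 'b" assume uv: "u \<noteq> v" "\<kappa> u = \<kappa> v"
    show "{u, v} \<in> H"
    proof (cases u)
      case u: (Inl x)
      show ?thesis
      proof (cases v)
        case (Inl y)
        then show ?thesis using u uv cl[of x] cl[of y] W_clique[of x "cl x" y]
          by (auto simp: \<kappa>_def old_edge_iff)
      next
        case (Inr i)
        then show ?thesis using u uv cl[of x] whisker_edge by (auto simp: \<kappa>_def)
      qed
    next
      case u: (Inr i)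
      then show ?thesis using uv cl whisker_edge
        by (cases v) (auto simp: \<kappa>_def insert_commute)
    qed
  qed auto
qed

lemma card_independent_le:
  assumes "independent_set E A"
  shows "card A \<le> independence_number E"
  unfolding independence_number_def using assms by (intro Max_ge) auto

lemma max_independent_set:
  obtains A where "independent_set E A" "card A = independence_number E"
proof -
  have "independent_set E {}" by (simp add: independent_set_def)
  then have "independence_number E \<in> {card A | A. independent_set E A}"
    unfolding independence_number_def by (intro Max_in) auto
  then show thesis using that by auto
qed

lemma prime_filtration_first: "prime_filtration (edge_powers H 1) (Suc (independence_number E)) 0 {}"
proof (rule prime_filtration_independent[where L = "range Inl", OF simple_H])
  fix u v assume "{u, v} \<in> H"
  then show "u \<in> range Inl \<or> v \<in> range Inl"
    by (cases rule: edge_cases) (auto simp: doubleton_eq_iff)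
next
  fix A :: "('a + 'b) set" assume A: "A \<subseteq> range Inl" "independent_set H A"
  define B where "B = Inl -` A"
  have "A = Inl ` B" using A by (auto simp: B_def)
  then have "card A = card B" by (simp add: card_image)
  moreover have "independent_set E B"
    using A(2) unfolding independent_set_def B_def by (auto simp: old_edge_iff[symmetric])
  ultimately show "card A \<le> independence_number E" using card_independent_le by simp
qed (auto simp: independent_set_def)

text \<open>
  The pairs are the whiskers \<open>{x\<^sub>i, y\<^sub>i}\<close> for \<open>i \<in> T\<close>. The exponent \<open>h\<close> is \<open>k - 1\<close> at \<open>x\<^sub>i\<close>, \<open>0\<close> at
  \<open>y\<^sub>i\<close>, and \<open>k\<close> elsewhere: the chosen whiskers fail to have order \<open>k\<close> by one, while all other edges
  have order at least \<open>k\<close>. For an edge between two of the \<open>x\<^sub>i\<close> this requires \<open>2 (k - 1) \<ge> k\<close>,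
  so such edges have to be excluded if \<open>k = 1\<close>.
\<close>

lemma no_long_regular_sequence_whiskered:
  fixes fs :: "('a + 'b, 'k::field) mpoly list"
  assumes "1 \<le> k" "T \<noteq> {}" and x: "\<And>i. i \<in> T \<Longrightarrow> x i \<in> W i"
    and indep: "2 \<le> k \<or> independent_set E (x ` T)"
    and fs: "wreg (mono_ideal (edge_powers H k)) fs" "set fs \<subseteq> mono_ideal (- {0})"
  shows "length fs < CARD('a) + CARD('b) - card T"
proof -
  obtain ts where ts: "set ts = T" "distinct ts" using finite_distinct_list[of T] by auto
  define ps :: "(('a + 'b) \<times> ('a + 'b)) list" where "ps = map (\<lambda>i. (Inl (x i), Inr i)) ts"
  define h :: "('a + 'b) \<Rightarrow>\<^sub>0 nat" where
    "h = expo (case_sum (\<lambda>y. if y \<in> x ` T then k - 1 else k) (\<lambda>i. if i \<in> T then 0 else k))"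
  have injx: "inj_on x T" using x W_unique by (metis inj_onI)
  have setps: "set ps = (\<lambda>i. (Inl (x i), Inr i)) ` T" by (simp add: ps_def ts)
  have dist: "distinct (map fst ps @ map snd ps)"
  proof -
      have "map fst ps = map (Inl \<circ> x) ts" "map snd ps = map Inr ts" by (simp_all add: ps_def)
      moreover have "inj_on (Inl \<circ> x :: 'b \<Rightarrow> 'a + 'b) T" using injx by (auto simp: inj_on_def)
      ultimately show ?thesis using ts by (auto simp: distinct_map)
    qed
  have "ps \<noteq> []" using assms(2) ts by (auto simp: ps_def)
  have trans: "h + expo (\<lambda>v. if v \<in> t then Suc k else 0) \<in> edge_powers H k"
    if t: "\<And>p. p \<in> set ps \<Longrightarrow> fst p \<in> t \<or> snd p \<in> t" for t
      unfolding edge_powers_def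
    proof (intro CollectI ballI)
      fix e assume "e \<in> H"
      then show "k \<le> (\<Sum>v\<in>e. Poly_Mapping.lookup (h + expo (\<lambda>v. if v \<in> t then Suc k else 0)) v)"
      proof (cases rule: edge_cases)
        case (old y y')
        have "\<not> (y \<in> x ` T \<and> y' \<in> x ` T) \<or> 2 \<le> k"
          using indep old by (auto simp: independent_set_def)
        then show ?thesis using old(1,3) by (auto simp: lookup_add h_def)
      next
        case (whisker y i)
        show ?thesis
        proof (cases "y \<in> x ` T \<and> i \<in> T")
          case True
          then obtain j where "j \<in> T" "y = x j" by blast
          then have "j = i" using x whisker(1) W_unique by blast
          then have "(Inl y, Inr i) \<in> set ps" using \<open>y = x j\<close> \<open>j \<in> T\<close> by (auto simp: setps)
          then have "Inl y \<in> t \<or> Inr i \<in> t" using t by fastforce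
          then show ?thesis using whisker(2) by (auto simp: lookup_add h_def)
        qed (use whisker(2) in \<open>auto simp: lookup_add h_def\<close>)
      qed
    qed
  have skip: "h + expo (\<lambda>v. if v \<in> snd ` set ps - {snd p} then Suc k else 0) \<notin> edge_powers H k"
    if p: "p \<in> set ps" for p
  proof -
    obtain i where i: "i \<in> T" "p = (Inl (x i), Inr i)" using p by (auto simp: setps)
    have "{Inl (x i), Inr i} \<in> H" using x[OF i(1)] by (rule whisker_edge)
    moreover have "(\<Sum>v\<in>{Inl (x i), Inr i}. Poly_Mapping.lookup
        (h + expo (\<lambda>v. if v \<in> snd ` set ps - {snd p} then Suc k else 0)) v) < k"
      using i assms(1) by (auto simp: lookup_add h_def setps)
    ultimately show ?thesis
      unfolding edge_powers_def by (auto simp: not_le simp del: lookup_expo sum.insert)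
  qed
  have rest: "Poly_Mapping.lookup h v < Suc k" for v
    by (cases v) (auto simp: h_def)
  have "length fs < CARD('a + 'b) - length ps"
    by (rule no_long_regular_sequence[OF upset_edge_powers dist \<open>ps \<noteq> []\<close> trans skip rest fs])
  moreover have "length ps = card T" using distinct_card[OF ts(2)] ts(1) by (simp add: ps_def)
  ultimately show ?thesis by simp
qed

end

section \<open>Quotient modules and depth\<close>

lemma type_ring_simps [simp]:
  "carrier ring_of_type_algebra = UNIV"
  "x \<otimes>\<^bsub>ring_of_type_algebra\<^esub> y = x * y"
  "x \<oplus>\<^bsub>ring_of_type_algebra\<^esub> y = x + y"
  "\<one>\<^bsub>ring_of_type_algebra\<^esub> = 1"
  "\<zero>\<^bsub>ring_of_type_algebra\<^esub> = 0"
  by (simp_all add: ring_of_type_algebra_def)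

lemma ideal_iff_is_ideal:
  fixes I :: "'r::comm_ring_1 set"
  shows "ideal I ring_of_type_algebra \<longleftrightarrow> is_ideal I"
proof
  assume "ideal I ring_of_type_algebra"
  then interpret ideal I ring_of_type_algebra .
  show "is_ideal I"
    using additive_subgroup.zero_closed[OF is_additive_subgroup]
      additive_subgroup.a_closed[OF is_additive_subgroup] I_l_closed
    by (intro is_idealI) auto
next
  assume I: "is_ideal I"
  have ring: "ring (ring_of_type_algebra :: 'r ring)" by (rule ring_from_type_algebra)
  show "ideal I ring_of_type_algebra"
  proof (rule idealI[OF ring])
    show "subgroup I (add_monoid ring_of_type_algebra)"
    proof
      fix x assume "x \<in> I"
      interpret ring "ring_of_type_algebra :: 'r ring" by (rule ring)
      have "\<ominus>\<^bsub>ring_of_type_algebra\<^esub> x = - x"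
        by (rule minus_equality) auto
      then show "inv\<^bsub>add_monoid ring_of_type_algebra\<^esub> x \<in> I"
        using is_ideal_uminus[OF I \<open>x \<in> I\<close>] by (simp add: a_inv_def)
    qed (use is_idealD[OF I] in auto)
  qed (use is_idealD[OF I] in auto)
qed

text \<open>The elements of \<open>R/I\<close>.\<close>

definition coset :: "'r::comm_ring_1 set \<Rightarrow> 'r \<Rightarrow> 'r set" where
  "coset I f = I +>\<^bsub>ring_of_type_algebra\<^esub> f"

lemma coset_eq: "coset I f = {i + f | i. i \<in> I}"
  by (auto simp: coset_def a_r_coset_def r_coset_def)

lemma coset_eq_iff:
  assumes "is_ideal I"
  shows "coset I f = coset I g \<longleftrightarrow> f - g \<in> I"
proof
  note I = is_idealD[OF assms]
  assume "coset I f = coset I g"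
  moreover have "f \<in> coset I f" using I(1) by (force simp: coset_eq)
  ultimately show "f - g \<in> I" by (auto simp: coset_eq)
next
  note I = is_idealD[OF assms]
  assume fg: "f - g \<in> I"
  show "coset I f = coset I g"
  proof (intro equalityI subsetI)
    fix x assume "x \<in> coset I f"
    then obtain i where "i \<in> I" "x = i + f" by (auto simp: coset_eq)
    then have "x = (i + (f - g)) + g" "i + (f - g) \<in> I" using I(2)[OF _ fg] by simp_all
    then show "x \<in> coset I g" unfolding coset_eq by blast
  next
    fix x assume "x \<in> coset I g"
    then obtain i where "i \<in> I" "x = i + g" by (auto simp: coset_eq)
    then have "x = (i - (f - g)) + f" "i - (f - g) \<in> I" using I(6)[OF _ fg] by simp_all
    then show "x \<in> coset I f" unfolding coset_eq by blast
  qed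
qed

lemma coset_0: "is_ideal I \<Longrightarrow> coset I 0 = I"
  by (simp add: coset_eq)

lemma quot_module_simps:
  fixes I :: "'r::comm_ring_1 set"
  assumes "is_ideal I"
  shows "carrier (quot_module ring_of_type_algebra I) = range (coset I)"
    and "\<zero>\<^bsub>quot_module ring_of_type_algebra I\<^esub> = coset I 0"
    and "coset I f \<oplus>\<^bsub>quot_module ring_of_type_algebra I\<^esub> coset I g = coset I (f + g)"
    and "a \<odot>\<^bsub>quot_module ring_of_type_algebra I\<^esub> coset I f = coset I (a * f)"
proof -
  interpret ideal I "ring_of_type_algebra :: 'r ring" using assms by (simp add: ideal_iff_is_ideal)
  show "carrier (quot_module ring_of_type_algebra I) = range (coset I)"
    unfolding quot_module_def ring.defs module.defs FactRing_def A_RCOSETS_def' coset_def by auto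
  show "\<zero>\<^bsub>quot_module ring_of_type_algebra I\<^esub> = coset I 0"
    using coset_0[OF assms] by (simp add: quot_module_def ring.defs module.defs FactRing_def)
  show "coset I f \<oplus>\<^bsub>quot_module ring_of_type_algebra I\<^esub> coset I g = coset I (f + g)"
    by (simp add: quot_module_def ring.defs module.defs FactRing_def coset_def a_rcos_sum)
  show "a \<odot>\<^bsub>quot_module ring_of_type_algebra I\<^esub> coset I f = coset I (a * f)"
    by (simp add: quot_module_def ring.defs module.defs FactRing_def coset_def rcoset_mult_add)
qed

lemma abelian_monoid_quot_module:
  assumes "is_ideal I"
  shows "abelian_monoid (quot_module ring_of_type_algebra I)"
  by (rule abelian_monoidI) (auto simp: quot_module_simps[OF assms] ac_simps)

lemma finsum_quot_module:
  assumes "is_ideal I"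
  shows "finsum (quot_module ring_of_type_algebra I) (\<lambda>i. coset I (h i)) {..<n::nat} = coset I (\<Sum>i<n. h i)"
proof (induction n)
  interpret abelian_monoid "quot_module ring_of_type_algebra I"
    by (rule abelian_monoid_quot_module[OF assms])
  case 0
  show ?case by (simp add: quot_module_simps[OF assms])
next
  interpret abelian_monoid "quot_module ring_of_type_algebra I"
    by (rule abelian_monoid_quot_module[OF assms])
  case (Suc n)
  then show ?case
    by (subst lessThan_Suc, subst finsum_insert)
       (auto simp: quot_module_simps[OF assms] add.commute)
qed

lemma adjoins_eq: "adjoins I xs = {q + (\<Sum>i<length xs. xs ! i * h i) | q h. q \<in> I}"
proof (induction xs rule: rev_induct)
  case (snoc x xs)
  show ?case
  proof (intro equalityI subsetI)
    fix y assume "y \<in> adjoins I (xs @ [x])"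
    then have "y \<in> adjoin (adjoins I xs) x" by simp
    then obtain q u h where "q \<in> I" "y = q + (\<Sum>i<length xs. xs ! i * h i) + x * u"
      unfolding snoc by (auto elim!: adjoinE)
    then have "y = q + (\<Sum>i<length (xs @ [x]). (xs @ [x]) ! i * (h(length xs := u)) i)"
      by (simp add: nth_append add.assoc)
    with \<open>q \<in> I\<close> show "y \<in> {q + (\<Sum>i<length (xs @ [x]). (xs @ [x]) ! i * h i) | q h. q \<in> I}" by blast
  next
    fix y assume "y \<in> {q + (\<Sum>i<length (xs @ [x]). (xs @ [x]) ! i * h i) | q h. q \<in> I}"
    then obtain q h where q: "q \<in> I" "y = q + (\<Sum>i<length (xs @ [x]). (xs @ [x]) ! i * h i)" by blast
    then have "y = (q + (\<Sum>i<length xs. xs ! i * h i)) + x * h (length xs)"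
      by (simp add: nth_append add.assoc)
    moreover have "q + (\<Sum>i<length xs. xs ! i * h i) \<in> adjoins I xs" unfolding snoc using q by blast
    ultimately show "y \<in> adjoins I (xs @ [x])" by (auto intro: adjoinI)
  qed
qed auto

lemma coset_in_seq_submodule:
  assumes "is_ideal I"
  shows "coset I f \<in> seq_submodule (quot_module ring_of_type_algebra I) xs \<longleftrightarrow> f \<in> adjoins I xs"
proof
  let ?M = "quot_module ring_of_type_algebra I"
  interpret M: abelian_monoid ?M by (rule abelian_monoid_quot_module[OF assms])
  {
    assume "coset I f \<in> seq_submodule ?M xs"
    then obtain u where u: "u \<in> {..<length xs} \<rightarrow> carrier ?M"
      "coset I f = finsum ?M (\<lambda>i. (xs ! i) \<odot>\<^bsub>?M\<^esub> u i) {..<length xs}"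
      unfolding seq_submodule_def by blast
    have "\<forall>i\<in>{..<length xs}. \<exists>g. u i = coset I g"
      using u(1) by (auto simp: quot_module_simps[OF assms] Pi_def)
    then obtain h where h: "\<And>i. i < length xs \<Longrightarrow> u i = coset I (h i)"
      by (metis lessThan_iff)
    have "coset I f = finsum ?M (\<lambda>i. coset I (xs ! i * h i)) {..<length xs}"
      unfolding u(2)
      by (rule M.finsum_cong') (auto simp: h quot_module_simps[OF assms])
    also have "\<dots> = coset I (\<Sum>i<length xs. xs ! i * h i)" by (rule finsum_quot_module[OF assms])
    finally have "f - (\<Sum>i<length xs. xs ! i * h i) \<in> I" by (simp add: coset_eq_iff[OF assms])
    moreover have "f = (f - (\<Sum>i<length xs. xs ! i * h i)) + (\<Sum>i<length xs. xs ! i * h i)" by simp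
    ultimately show "f \<in> adjoins I xs" unfolding adjoins_eq by blast
  next
    assume "f \<in> adjoins I xs"
    then obtain q h where q: "q \<in> I" "f = q + (\<Sum>i<length xs. xs ! i * h i)"
      unfolding adjoins_eq by blast
    then have "coset I f = coset I (\<Sum>i<length xs. xs ! i * h i)" by (simp add: coset_eq_iff[OF assms])
    also have "\<dots> = finsum ?M (\<lambda>i. (xs ! i) \<odot>\<^bsub>?M\<^esub> coset I (h i)) {..<length xs}"
      by (simp add: quot_module_simps[OF assms] finsum_quot_module[OF assms])
    finally show "coset I f \<in> seq_submodule ?M xs"
      unfolding seq_submodule_def
      by (intro CollectI exI[of _ "\<lambda>i. coset I (h i)"]) (auto simp: quot_module_simps[OF assms])
  }
qed

lemma wreg_iff_nth:
  "wreg I xs \<longleftrightarrow> (\<forall>i<length xs. \<forall>u. xs ! i * u \<in> adjoins I (take i xs) \<longrightarrow> u \<in> adjoins I (take i xs))"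
proof (induction xs rule: rev_induct)
  case (snoc x xs)
  show ?case by (auto simp: wreg_append snoc nth_append less_Suc_eq)
qed simp

lemma seq_submodule_subset:
  assumes "is_ideal I"
  shows "seq_submodule (quot_module ring_of_type_algebra I) xs \<subseteq> range (coset I)"
proof
  let ?M = "quot_module ring_of_type_algebra I"
  interpret M: abelian_monoid ?M by (rule abelian_monoid_quot_module[OF assms])
  fix y assume "y \<in> seq_submodule ?M xs"
  then obtain u where u: "u \<in> {..<length xs} \<rightarrow> carrier ?M"
      "y = finsum ?M (\<lambda>i. (xs ! i) \<odot>\<^bsub>?M\<^esub> u i) {..<length xs}"
    unfolding seq_submodule_def by blast
  have "y \<in> carrier ?M" unfolding u(2)
  proof (rule M.finsum_closed, rule Pi_I)
    fix i assume "i \<in> {..<length xs}"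
    then obtain g where "u i = coset I g" using u(1) by (auto simp: quot_module_simps[OF assms] Pi_def)
    then show "(xs ! i) \<odot>\<^bsub>?M\<^esub> u i \<in> carrier ?M" by (simp add: quot_module_simps[OF assms])
  qed
  then show "y \<in> range (coset I)" by (simp add: quot_module_simps[OF assms])
qed

lemma regular_sequence_iff_wreg:
  assumes "is_ideal I"
  shows "regular_sequence ring_of_type_algebra (quot_module ring_of_type_algebra I) xs \<longleftrightarrow>
    wreg I xs \<and> adjoins I xs \<noteq> UNIV"
proof -
  have "seq_submodule (quot_module ring_of_type_algebra I) xs = range (coset I) \<longleftrightarrow>
      (\<forall>f. coset I f \<in> seq_submodule (quot_module ring_of_type_algebra I) xs)"
    using seq_submodule_subset[OF assms, of xs] by auto
  then have "seq_submodule (quot_module ring_of_type_algebra I) xs = range (coset I) \<longleftrightarrow> adjoins I xs = UNIV"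
    unfolding coset_in_seq_submodule[OF assms] by auto
  then show ?thesis
    by (simp add: regular_sequence_def quot_module_simps[OF assms] coset_in_seq_submodule[OF assms] wreg_iff_nth)
qed

lemma Idl_type_ring:
  assumes "is_ideal I" "A \<subseteq> I" "\<And>K. is_ideal K \<Longrightarrow> A \<subseteq> K \<Longrightarrow> I \<subseteq> K"
  shows "Idl\<^bsub>ring_of_type_algebra\<^esub> A = I"
  using assms unfolding genideal_def ideal_iff_is_ideal by blast

lemma Idl_var: "Idl\<^bsub>mpoly_ring\<^esub> (var ` A) = (mono_ideal (hits A) :: ('v, 'k::field) mpoly set)"
proof (rule Idl_type_ring[OF is_ideal_mono_ideal[OF upset_hits]])
  show "var ` A \<subseteq> (mono_ideal (hits A) :: ('v, 'k) mpoly set)"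
  proof
    fix f :: "('v, 'k) mpoly" assume "f \<in> var ` A"
    then obtain v where "v \<in> A" "f = var v" by blast
    then show "f \<in> mono_ideal (hits A)"
      unfolding var_eq_mon by (auto simp: hits_def intro!: bexI[of _ v])
  qed
next
  fix K :: "('v, 'k) mpoly set" assume K: "is_ideal K" "var ` A \<subseteq> K"
  show "mono_ideal (hits A) \<subseteq> K"
  proof
    fix f :: "('v, 'k) mpoly" assume f: "f \<in> mono_ideal (hits A)"
    show "f \<in> K"
    proof (rule in_ideal_if_mon_in_ideal[OF K(1)])
      fix a assume "a \<in> Poly_Mapping.keys f"
      then obtain v where v: "v \<in> A" "a \<in> hits {v}" using f by (auto simp: mono_ideal_def hits_def)
      then obtain b where "a = Poly_Mapping.single v 1 + b" unfolding range_plus_single[symmetric] by blast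
      then have "mon a = var v * (mon b :: ('v, 'k) mpoly)" by (simp only: mon_add var_eq_mon)
      moreover have "var v \<in> K" using K(2) v(1) by blast
      ultimately show "mon a \<in> K" using is_ideal_mult_right[OF K(1)] by simp
    qed
  qed
qed

lemma hits_UNIV: "hits UNIV = - {0}"
  by (auto simp: hits_def) (metis lookup_zero neq0_conv poly_mapping_eqI)

lemma is_ideal_maximal: "is_ideal (mono_ideal (- {0}))"
  using is_ideal_mono_ideal[OF upset_hits] by (simp add: hits_UNIV[symmetric])

lemma graded_maximal_ideal_eq: "graded_maximal_ideal = (mono_ideal (- {0}) :: ('v, 'k::field) mpoly set)"
  unfolding graded_maximal_ideal_def Idl_var hits_UNIV ..

lemma depth_quot_eqI:
  fixes I :: "('v, 'k::field) mpoly set"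
  assumes "is_ideal I" "I \<subseteq> mono_ideal (- {0})"
    and "wreg I fs" "set fs \<subseteq> mono_ideal (- {0})" "length fs = d"
    and "\<And>fs. wreg I fs \<Longrightarrow> set fs \<subseteq> mono_ideal (- {0}) \<Longrightarrow> length fs \<le> d"
  shows "depth_quot I = enat d"
  unfolding depth_quot_def depth_def graded_maximal_ideal_eq
proof (rule antisym)
  show "(SUP xs\<in>{xs. set xs \<subseteq> mono_ideal (- {0}) \<and>
      regular_sequence mpoly_ring (quot_module mpoly_ring I) xs}. enat (length xs)) \<le> enat d"
    using assms(6) by (intro SUP_least) (auto simp: regular_sequence_iff_wreg[OF assms(1)])
  have "adjoins I xs \<subseteq> mono_ideal (- {0})" if "set xs \<subseteq> mono_ideal (- {0})" for xs
    using that
  proof (induction xs rule: rev_induct)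
    case (snoc x xs)
    then show ?case using adjoin_subset[OF is_ideal_maximal, of "adjoins I xs" x] by auto
  qed (use assms(2) in simp)
  then have "1 \<notin> adjoins I fs" using assms(4) by (force simp: mono_ideal_def)
  then have "fs \<in> {xs. set xs \<subseteq> mono_ideal (- {0}) \<and>
      regular_sequence mpoly_ring (quot_module mpoly_ring I) xs}"
    using assms(3,4) by (auto simp: regular_sequence_iff_wreg[OF assms(1)])
  then show "enat d \<le> (SUP xs\<in>{xs. set xs \<subseteq> mono_ideal (- {0}) \<and>
      regular_sequence mpoly_ring (quot_module mpoly_ring I) xs}. enat (length xs))"
    using assms(5) by (intro SUP_upper2[of fs]) auto
qed

section \<open>Kernels of localization\<close>

lemma kernel_to_localization_eq:
  fixes I P :: "'r::comm_ring_1 set"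
  assumes I: "is_ideal I" and P: "primeideal P ring_of_type_algebra"
  shows "kernel_to_localization ring_of_type_algebra I P = {f. \<exists>w. w \<notin> P \<and> w * f \<in> I}"
proof -
  let ?R = "ring_of_type_algebra :: 'r ring"
  let ?M = "quot_module ?R I"
  interpret primeideal P ?R by (rule P)
  have one: "1 \<notin> P" using I_notcarr one_imp_carrier by auto
  have mult: "v * w \<notin> P" if "v \<notin> P" "w \<notin> P" for v w
    using I_prime[of v w] that by auto
  note cz = coset_0[OF I]
  have rel: "((coset I f, 1), (coset I g, t)) \<in> fraction_rel ?R ?M P \<longleftrightarrow>
      t \<notin> P \<and> (\<exists>w. w \<notin> P \<and> w * (t * f) - w * g \<in> I)" for f g t
    using one by (auto simp: fraction_rel_def quot_module_simps[OF I] coset_eq_iff[OF I] algebra_simps)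
  have sub: "fraction_rel ?R ?M P \<subseteq> (carrier ?M \<times> UNIV) \<times> (carrier ?M \<times> UNIV)"
    by (auto simp: fraction_rel_def)
  have "fraction ?R ?M P (coset I f) 1 = fraction ?R ?M P (coset I 0) 1 \<longleftrightarrow>
      (\<exists>w. w \<notin> P \<and> w * f \<in> I)" for f
  proof
    assume eq: "fraction ?R ?M P (coset I f) 1 = fraction ?R ?M P (coset I 0) 1"
    have "((coset I 0, 1), (coset I 0, 1)) \<in> fraction_rel ?R ?M P"
      unfolding rel using one is_ideal_zero[OF I] by (auto intro: exI[of _ 1])
    then have "(coset I 0, 1) \<in> fraction ?R ?M P (coset I f) 1"
      unfolding eq by (simp add: fraction_def)
    then show "\<exists>w. w \<notin> P \<and> w * f \<in> I" unfolding fraction_def using rel[of f 0 1] by simp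
  next
    assume "\<exists>w. w \<notin> P \<and> w * f \<in> I"
    then obtain w where w: "w \<notin> P" "w * f \<in> I" by blast
    have "((coset I f, 1), (coset I g, t)) \<in> fraction_rel ?R ?M P \<longleftrightarrow>
        ((coset I 0, 1), (coset I g, t)) \<in> fraction_rel ?R ?M P" for g t
    proof -
      have "\<exists>v. v \<notin> P \<and> v * (t * 0) - v * g \<in> I" if v: "v \<notin> P" "v * (t * f) - v * g \<in> I" for v
      proof (intro exI[of _ "v * w"] conjI mult v w)
        have "w * (v * (t * f) - v * g) - (v * t) * (w * f) \<in> I"
          by (rule is_ideal_diff[OF I is_ideal_mult[OF I v(2)] is_ideal_mult[OF I w(2)]])
        then show "v * w * (t * 0) - v * w * g \<in> I" by (simp add: algebra_simps)
      qed
      moreover have "\<exists>v. v \<notin> P \<and> v * (t * f) - v * g \<in> I" if v: "v \<notin> P" "v * (t * 0) - v * g \<in> I" for v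
      proof (intro exI[of _ "v * w"] conjI mult v w)
        have "w * (v * (t * 0) - v * g) + (v * t) * (w * f) \<in> I"
          by (rule is_ideal_add[OF I is_ideal_mult[OF I v(2)] is_ideal_mult[OF I w(2)]])
        then show "v * w * (t * f) - v * w * g \<in> I" by (simp add: algebra_simps)
      qed
      ultimately show ?thesis unfolding rel by blast
    qed
    moreover have "\<exists>g. x = coset I g" if "((u, s), (x, t)) \<in> fraction_rel ?R ?M P" for u s x t
      using that sub quot_module_simps(1)[OF I] by blast
    ultimately have "((coset I f, 1), (x, t)) \<in> fraction_rel ?R ?M P \<longleftrightarrow>
        ((coset I 0, 1), (x, t)) \<in> fraction_rel ?R ?M P" for x t by metis
    then show "fraction ?R ?M P (coset I f) 1 = fraction ?R ?M P (coset I 0) 1"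
      unfolding fraction_def by auto
  qed
  then show ?thesis
    by (simp add: kernel_to_localization_def quot_module_simps[OF I] coset_def[symmetric])
qed

section \<open>The order at a prime generated by variables\<close>

text \<open>
  A pair \<open>(A', B')\<close> of nonempty subsets is a face of \<open>(A, B)\<close> if sums of elements of \<open>A'\<close> and \<open>B'\<close>
  have no further representations as sums of elements of \<open>A\<close> and \<open>B\<close>.
\<close>

definition face_pair :: "'e::plus set \<Rightarrow> 'e set \<Rightarrow> 'e set \<Rightarrow> 'e set \<Rightarrow> bool" where
  "face_pair A' B' A B \<longleftrightarrow> A' \<noteq> {} \<and> B' \<noteq> {} \<and> A' \<subseteq> A \<and> B' \<subseteq> B \<and>
    (\<forall>a\<in>A'. \<forall>b\<in>B'. \<forall>c\<in>A. \<forall>d\<in>B. c + d = a + b \<longrightarrow> c \<in> A' \<and> d \<in> B')"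

lemma face_pairD:
  assumes "face_pair A' B' A B"
  shows "A' \<noteq> {}" "B' \<noteq> {}" "A' \<subseteq> A" "B' \<subseteq> B"
    and "a \<in> A' \<Longrightarrow> b \<in> B' \<Longrightarrow> c \<in> A \<Longrightarrow> d \<in> B \<Longrightarrow> c + d = a + b \<Longrightarrow> c \<in> A' \<and> d \<in> B'"
  using assms unfolding face_pair_def by blast+

lemma face_pair_trans:
  assumes "face_pair A2 B2 A1 B1" "face_pair A1 B1 A B"
  shows "face_pair A2 B2 A B"
proof -
  have "c \<in> A2 \<and> d \<in> B2" if "a \<in> A2" "b \<in> B2" "c \<in> A" "d \<in> B" "c + d = a + b" for a b c d
  proof -
    have "a \<in> A1" "b \<in> B1" using that face_pairD(3,4)[OF assms(1)] by auto
    then have "c \<in> A1" "d \<in> B1" using face_pairD(5)[OF assms(2)] that by blast+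
    then show ?thesis using face_pairD(5)[OF assms(1)] that by blast
  qed
  then show ?thesis
    using face_pairD(1-4)[OF assms(1)] face_pairD(3,4)[OF assms(2)] unfolding face_pair_def by blast
qed

lemma face_pair_minimizers:
  fixes \<nu> :: "'e::plus \<Rightarrow> nat"
  assumes "finite A" "finite B" "A \<noteq> {}" "B \<noteq> {}" and add: "\<And>a b. \<nu> (a + b) = \<nu> a + \<nu> b"
  shows "face_pair {a \<in> A. \<nu> a = Min (\<nu> ` A)} {b \<in> B. \<nu> b = Min (\<nu> ` B)} A B"
proof -
  have min: "Min (\<nu> ` A) \<in> \<nu> ` A" "Min (\<nu> ` B) \<in> \<nu> ` B" using assms by (auto intro!: Min_in)
  have "\<nu> c = Min (\<nu> ` A) \<and> \<nu> d = Min (\<nu> ` B)"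
    if "\<nu> a = Min (\<nu> ` A)" "\<nu> b = Min (\<nu> ` B)" "c \<in> A" "d \<in> B" "c + d = a + b" for a b c d
  proof -
    have "Min (\<nu> ` A) \<le> \<nu> c" "Min (\<nu> ` B) \<le> \<nu> d" using assms that by auto
    moreover have "\<nu> c + \<nu> d = Min (\<nu> ` A) + Min (\<nu> ` B)"
      using add[of c d] add[of a b] that by simp
    ultimately show ?thesis by linarith
  qed
  moreover have "{a \<in> A. \<nu> a = Min (\<nu> ` A)} \<noteq> {}" "{b \<in> B. \<nu> b = Min (\<nu> ` B)} \<noteq> {}"
    using min by force+
  ultimately show ?thesis unfolding face_pair_def by blast
qed

lemma face_pair_constant:
  fixes A B :: "('v::finite \<Rightarrow>\<^sub>0 nat) set"
  assumes "finite A" "finite B" "A \<noteq> {}" "B \<noteq> {}"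
  shows "\<exists>A' B'. face_pair A' B' A B \<and>
    (\<forall>v\<in>V. \<exists>c d. (\<forall>a\<in>A'. Poly_Mapping.lookup a v = c) \<and> (\<forall>b\<in>B'. Poly_Mapping.lookup b v = d))"
  using finite[of V]
proof (induction V rule: finite_induct)
  case empty
  show ?case using assms by (intro exI[of _ A] exI[of _ B]) (auto simp: face_pair_def)
next
  case (insert v V)
  then obtain A1 B1 where 1: "face_pair A1 B1 A B"
    "\<forall>v\<in>V. \<exists>c d. (\<forall>a\<in>A1. Poly_Mapping.lookup a v = c) \<and> (\<forall>b\<in>B1. Poly_Mapping.lookup b v = d)" by blast
  have "finite A1" "finite B1" "A1 \<noteq> {}" "B1 \<noteq> {}"
    using face_pairD[OF 1(1)] assms(1,2) finite_subset by simp_all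
  then have "face_pair {a \<in> A1. Poly_Mapping.lookup a v = Min ((\<lambda>a. Poly_Mapping.lookup a v) ` A1)}
    {b \<in> B1. Poly_Mapping.lookup b v = Min ((\<lambda>a. Poly_Mapping.lookup a v) ` B1)} A1 B1"
    by (rule face_pair_minimizers) (simp add: lookup_add)
  then have "face_pair {a \<in> A1. Poly_Mapping.lookup a v = Min ((\<lambda>a. Poly_Mapping.lookup a v) ` A1)}
    {b \<in> B1. Poly_Mapping.lookup b v = Min ((\<lambda>a. Poly_Mapping.lookup a v) ` B1)} A B"
    using 1(1) by (rule face_pair_trans)
  moreover have "\<forall>u\<in>insert v V. \<exists>c d.
    (\<forall>a\<in>{a \<in> A1. Poly_Mapping.lookup a v = Min ((\<lambda>a. Poly_Mapping.lookup a v) ` A1)}. Poly_Mapping.lookup a u = c) \<and>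
    (\<forall>b\<in>{b \<in> B1. Poly_Mapping.lookup b v = Min ((\<lambda>a. Poly_Mapping.lookup a v) ` B1)}. Poly_Mapping.lookup b u = d)"
  proof
    fix u assume "u \<in> insert v V"
    then show "\<exists>c d.
      (\<forall>a\<in>{a \<in> A1. Poly_Mapping.lookup a v = Min ((\<lambda>a. Poly_Mapping.lookup a v) ` A1)}. Poly_Mapping.lookup a u = c) \<and>
      (\<forall>b\<in>{b \<in> B1. Poly_Mapping.lookup b v = Min ((\<lambda>a. Poly_Mapping.lookup a v) ` B1)}. Poly_Mapping.lookup b u = d)"
      using 1(2) by blast
  qed
  ultimately show ?case by blast
qed

text \<open>
  The exponents of the product of two polynomials include a sum of exponents that minimize \<open>\<nu>\<close> and for
  which no cancellation occurs. This replaces the choice of a monomial order, for which the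
  variables would have to be ordered.
\<close>

lemma unique_minimal_pair:
  fixes A B :: "('v::finite \<Rightarrow>\<^sub>0 nat) set" and \<nu> :: "('v \<Rightarrow>\<^sub>0 nat) \<Rightarrow> nat"
  assumes "finite A" "finite B" "A \<noteq> {}" "B \<noteq> {}" and add: "\<And>a b. \<nu> (a + b) = \<nu> a + \<nu> b"
  obtains a b where "a \<in> A" "b \<in> B" "\<nu> a = Min (\<nu> ` A)" "\<nu> b = Min (\<nu> ` B)"
    "\<And>c d. c \<in> A \<Longrightarrow> d \<in> B \<Longrightarrow> c + d = a + b \<Longrightarrow> c = a \<and> d = b"
proof -
  let ?A = "{a \<in> A. \<nu> a = Min (\<nu> ` A)}" and ?B = "{b \<in> B. \<nu> b = Min (\<nu> ` B)}"
  have f: "face_pair ?A ?B A B" by (rule face_pair_minimizers[OF assms])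
  have "finite ?A" "finite ?B" "?A \<noteq> {}" "?B \<noteq> {}"
    using face_pairD(1,2)[OF f] assms(1,2) by simp_all
  then obtain A' B' where 1: "face_pair A' B' ?A ?B"
    "\<forall>v\<in>UNIV. \<exists>c d. (\<forall>a\<in>A'. Poly_Mapping.lookup a v = c) \<and> (\<forall>b\<in>B'. Poly_Mapping.lookup b v = d)"
    using face_pair_constant[of ?A ?B UNIV] by blast
  have eq: "a = a'" if "a \<in> A' \<and> a' \<in> A' \<or> a \<in> B' \<and> a' \<in> B'" for a a'
  proof (rule poly_mapping_eqI)
    fix v
    obtain c d where "\<forall>a\<in>A'. Poly_Mapping.lookup a v = c" "\<forall>b\<in>B'. Poly_Mapping.lookup b v = d"
      using 1(2) by blast
    with that show "Poly_Mapping.lookup a v = Poly_Mapping.lookup a' v" by auto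
  qed
  obtain a b where ab: "a \<in> A'" "b \<in> B'" using face_pairD(1,2)[OF 1(1)] by blast
  have f': "face_pair A' B' A B" using 1(1) f by (rule face_pair_trans)
  show thesis
  proof (rule that)
    show "a \<in> A" "\<nu> a = Min (\<nu> ` A)" "b \<in> B" "\<nu> b = Min (\<nu> ` B)"
      using face_pairD(3,4)[OF 1(1)] ab by auto
    show "c = a \<and> d = b" if "c \<in> A" "d \<in> B" "c + d = a + b" for c d
    proof -
      have "c \<in> A'" "d \<in> B'" using face_pairD(5)[OF f'] ab that by blast+
      then show ?thesis using eq ab by blast
    qed
  qed
qed

lemma lookup_mult_unique:
  assumes "\<And>c d. c \<in> Poly_Mapping.keys f \<Longrightarrow> d \<in> Poly_Mapping.keys g \<Longrightarrow> c + d = a + b \<Longrightarrow> c = a \<and> d = b"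
    and "a \<in> Poly_Mapping.keys f" "b \<in> Poly_Mapping.keys g"
  shows "Poly_Mapping.lookup (f * g) (a + b) = Poly_Mapping.lookup f a * (Poly_Mapping.lookup g b :: 'k::field)"
proof -
  let ?f = "\<lambda>c. Poly_Mapping.single c (Poly_Mapping.lookup f c)"
  let ?g = "\<lambda>c. Poly_Mapping.single c (Poly_Mapping.lookup g c)"
  have "f * g = (\<Sum>c\<in>Poly_Mapping.keys f. ?f c) * (\<Sum>d\<in>Poly_Mapping.keys g. ?g d)"
    by (simp only: mpoly_eq_sum_single[symmetric])
  then have "Poly_Mapping.lookup (f * g) (a + b) = (\<Sum>c\<in>Poly_Mapping.keys f. \<Sum>d\<in>Poly_Mapping.keys g.
      Poly_Mapping.lookup (?f c * ?g d) (a + b))"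
    by (simp only: sum_product lookup_sum)
  also have "\<dots> = (\<Sum>c\<in>Poly_Mapping.keys f. \<Sum>d\<in>Poly_Mapping.keys g.
      if c = a then (if d = b then Poly_Mapping.lookup f a * Poly_Mapping.lookup g b else 0) else 0)"
    using assms(1) by (intro sum.cong refl) (auto simp: mult_single lookup_single when_def)
  also have "\<dots> = (\<Sum>c\<in>Poly_Mapping.keys f. if c = a then Poly_Mapping.lookup f a * Poly_Mapping.lookup g b else 0)"
    using assms(3) by (intro sum.cong refl) auto
  also have "\<dots> = Poly_Mapping.lookup f a * Poly_Mapping.lookup g b"
    using assms(2) by simp
  finally show ?thesis .
qed

text \<open>
  The order at the prime generated by the variables in \<open>e\<close> is a valuation; so the powers of this
  prime are primary.
\<close>

lemma order_cancel:
  fixes w f :: "('v::finite, 'k::field) mpoly"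
  assumes "w \<notin> mono_ideal (hits e)"
    and "w * f \<in> mono_ideal {a. k \<le> (\<Sum>v\<in>e. Poly_Mapping.lookup a v)}"
  shows "f \<in> mono_ideal {a. k \<le> (\<Sum>v\<in>e. Poly_Mapping.lookup a v)}"
proof (rule ccontr)
  assume nf: "\<not> ?thesis"
  define \<nu> where "\<nu> a = (\<Sum>v\<in>e. Poly_Mapping.lookup a v)" for a :: "'v \<Rightarrow>\<^sub>0 nat"
  obtain a0 where a0: "a0 \<in> Poly_Mapping.keys w" "a0 \<notin> hits e"
    using assms(1) by (auto simp: mono_ideal_def)
  obtain b0 where b0: "b0 \<in> Poly_Mapping.keys f" "\<not> k \<le> \<nu> b0"
    using nf unfolding mono_ideal_def \<nu>_def by blast
  have "\<nu> a0 = 0" using a0(2) by (auto simp: \<nu>_def hits_def)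
  obtain a b where ab: "a \<in> Poly_Mapping.keys w" "b \<in> Poly_Mapping.keys f"
    "\<nu> a = Min (\<nu> ` Poly_Mapping.keys w)" "\<nu> b = Min (\<nu> ` Poly_Mapping.keys f)"
    "\<And>c d. c \<in> Poly_Mapping.keys w \<Longrightarrow> d \<in> Poly_Mapping.keys f \<Longrightarrow> c + d = a + b \<Longrightarrow> c = a \<and> d = b"
    by (rule unique_minimal_pair[of "Poly_Mapping.keys w" "Poly_Mapping.keys f" \<nu>])
       (use a0 b0 in \<open>auto simp: \<nu>_def lookup_add sum.distrib\<close>)
  have "Poly_Mapping.lookup (w * f) (a + b) = Poly_Mapping.lookup w a * Poly_Mapping.lookup f b"
    by (rule lookup_mult_unique[OF ab(5) ab(1,2)])
  then have "a + b \<in> Poly_Mapping.keys (w * f)" using ab(1,2) by (simp add: in_keys_iff)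
  then have "k \<le> \<nu> (a + b)" using assms(2) by (auto simp: mono_ideal_def \<nu>_def)
  also have "\<nu> (a + b) = \<nu> a + \<nu> b" by (simp add: \<nu>_def lookup_add sum.distrib)
  also have "\<nu> a \<le> \<nu> a0" unfolding ab(3) using a0 by auto
  also have "\<nu> b \<le> \<nu> b0" unfolding ab(4) using b0 by auto
  finally show False using b0(2) \<open>\<nu> a0 = 0\<close> by simp
qed

section \<open>Symbolic powers of cover ideals\<close>

lemma hits_eq_edge_powers: "hits e = edge_powers {e} 1" if "finite e"
  using that by (simp add: hits_def edge_powers_def Suc_le_eq flip: neq0_conv)

lemma primeideal_vars:
  fixes e :: "'v::finite set"
  shows "primeideal (mono_ideal (hits e) :: ('v, 'k::field) mpoly set) ring_of_type_algebra"
proof (rule primeidealI)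
  show "ideal (mono_ideal (hits e) :: ('v, 'k) mpoly set) ring_of_type_algebra"
    by (simp add: ideal_iff_is_ideal is_ideal_mono_ideal upset_hits)
  show "cring (ring_of_type_algebra :: ('v, 'k) mpoly ring)" by (rule cring_from_type_algebra)
  have "(mon 0 :: ('v, 'k) mpoly) \<notin> mono_ideal (hits e)"
    unfolding mon_in_mono_ideal by (simp add: hits_def)
  then show "carrier ring_of_type_algebra \<noteq> (mono_ideal (hits e) :: ('v, 'k) mpoly set)" by auto
  show "a \<in> mono_ideal (hits e) \<or> b \<in> mono_ideal (hits e)"
    if "a \<otimes>\<^bsub>ring_of_type_algebra\<^esub> b \<in> mono_ideal (hits e)" for a b :: "('v, 'k) mpoly"
    using that order_cancel[of a e b 1] hits_eq_edge_powers[of e] by (auto simp: edge_powers_def)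
qed

lemma cover_ideal_eq:
  fixes H :: "'v::finite set set"
  shows "cover_ideal H = (mono_ideal (edge_powers H 1) :: ('v, 'k::field) mpoly set)"
proof -
  have "mono_ideal (edge_powers H 1) = (\<Inter>e\<in>H. mono_ideal (edge_powers {e} 1) :: ('v, 'k) mpoly set)"
    by (auto simp: mono_ideal_def edge_powers_def)
  then show ?thesis unfolding cover_ideal_def Idl_var by (simp add: hits_eq_edge_powers)
qed

lemma ideals_pow_Suc:
  "I [^]\<^bsub>ideals_set R\<^esub> Suc k = ideal_prod R (I [^]\<^bsub>ideals_set R\<^esub> k) I"
  by (simp add: nat_pow_def ideals_set_def)

lemma ideals_pow_0: "I [^]\<^bsub>ideals_set R\<^esub> (0::nat) = carrier R"
  by (simp add: nat_pow_def ideals_set_def)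

lemma is_ideal_ideals_pow:
  fixes I :: "'r::comm_ring_1 set"
  assumes "is_ideal I"
  shows "is_ideal (I [^]\<^bsub>ideals_set ring_of_type_algebra\<^esub> (k::nat))"
proof (induction k)
  case 0
  show ?case unfolding ideals_pow_0 by (simp add: is_ideal_def)
next
  case (Suc k)
  interpret ring "ring_of_type_algebra :: 'r ring" by (rule ring_from_type_algebra)
  show ?case using ideal_prod_is_ideal Suc assms
    unfolding ideals_pow_Suc ideal_iff_is_ideal by blast
qed

lemma power_mult_in_ideals_pow:
  fixes f g :: "'r::comm_ring_1"
  assumes "f \<in> I" "g \<in> I"
  shows "f ^ i * g ^ j \<in> I [^]\<^bsub>ideals_set ring_of_type_algebra\<^esub> (i + j)"
proof -
  have step: "h * f \<in> I [^]\<^bsub>ideals_set ring_of_type_algebra\<^esub> Suc n"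
    if "f \<in> I" "h \<in> I [^]\<^bsub>ideals_set ring_of_type_algebra\<^esub> n" for h f :: 'r and n :: nat
    unfolding ideals_pow_Suc using ideal_prod.prod[OF that(2,1), of ring_of_type_algebra] by simp
  have fi: "f ^ i \<in> I [^]\<^bsub>ideals_set ring_of_type_algebra\<^esub> i"
  proof (induction i)
    case 0
    show ?case unfolding ideals_pow_0 by simp
  next
    case (Suc i)
    show ?case using step[OF assms(1) Suc] by (simp only: power_Suc2)
  qed
  show ?thesis
  proof (induction j)
    case 0
    show ?case using fi by (simp only: power_0 mult_1_right add_0_right)
  next
    case (Suc j)
    show ?case using step[OF assms(2) Suc] by (simp only: power_Suc2 mult.assoc add_Suc_right)
  qed
qed

lemma ideals_pow_cover_subset:
  fixes I :: "('v, 'k::field) mpoly set"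
  assumes "I \<subseteq> mono_ideal (edge_powers H 1)"
  shows "I [^]\<^bsub>ideals_set ring_of_type_algebra\<^esub> k \<subseteq> mono_ideal (edge_powers H k)"
proof (induction k)
  case 0
  show ?case by (auto simp: mono_ideal_def edge_powers_def)
next
  case (Suc k)
  have "f \<in> mono_ideal (edge_powers H (Suc k))"
    if "f \<in> ideal_prod ring_of_type_algebra (I [^]\<^bsub>ideals_set ring_of_type_algebra\<^esub> k) I" for f
    using that
  proof (induction rule: ideal_prod.induct)
    case (prod i j)
    have "i * j \<in> mono_ideal (edge_powers H (Suc k))"
    proof (rule mono_ideal_mult)
      show "i \<in> mono_ideal (edge_powers H k)" "j \<in> mono_ideal (edge_powers H 1)"
        using prod Suc assms by auto
      fix a b :: "'v \<Rightarrow>\<^sub>0 nat" assume "a \<in> edge_powers H k" "b \<in> edge_powers H 1"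
      then show "a + b \<in> edge_powers H (Suc k)"
        by (fastforce simp: edge_powers_def lookup_add sum.distrib)
    qed
    then show ?case by simp
  next
    case (sum s1 s2)
    then show ?case using is_ideal_add[OF is_ideal_mono_ideal[OF upset_edge_powers]] by simp
  qed
  then show ?case unfolding ideals_pow_Suc by blast
qed

text \<open>The exponent of the product of all variables other than \<open>u\<close>.\<close>

definition all_but :: "'v::finite \<Rightarrow> ('v \<Rightarrow>\<^sub>0 nat)" where
  "all_but u = expo (\<lambda>v. if v = u then 0 else 1)"

lemma cover_in_edge_powers:
  fixes H :: "'v::finite set set"
  assumes "\<And>e. e \<in> H \<Longrightarrow> \<exists>v\<in>e. Poly_Mapping.lookup a v \<noteq> 0"
  shows "a \<in> edge_powers H 1"
proof -
  have "1 \<le> (\<Sum>v\<in>e. Poly_Mapping.lookup a v)" if e: "e \<in> H" for e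
  proof -
    obtain v where "v \<in> e" "Poly_Mapping.lookup a v \<noteq> 0" using assms e by blast
    then show ?thesis using member_le_sum[of v e "Poly_Mapping.lookup a"] by force
  qed
  then show ?thesis by (simp add: edge_powers_def)
qed

lemma all_but_in_edge_powers:
  fixes H :: "'v::finite set set"
  assumes "simple_graph H"
  shows "all_but u \<in> edge_powers H 1"
proof (rule cover_in_edge_powers)
  fix e assume "e \<in> H"
  then have "card e = 2" using assms by (simp add: simple_graph_def)
  then obtain v where "v \<in> e" "v \<noteq> u" by (auto simp: card_2_iff)
  then show "\<exists>v\<in>e. Poly_Mapping.lookup (all_but u) v \<noteq> 0" by (auto simp: all_but_def)
qed

lemma mon_expo: "mon (expo f) = (\<Prod>v\<in>UNIV. var v ^ f v)"
proof -
  have "expo f = (\<Sum>v\<in>UNIV. Poly_Mapping.single v (f v))"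
    by (rule poly_mapping_eqI) (simp add: lookup_sum lookup_single when_def)
  then show ?thesis by (simp add: mon_sum var_power)
qed

lemma primeideal_prodD:
  fixes P :: "'r::comm_ring_1 set"
  assumes "primeideal P ring_of_type_algebra" "prod f A \<in> P" "finite A"
  shows "\<exists>v\<in>A. f v \<in> P"
  using assms(3,2)
proof (induction A rule: finite_induct)
  case empty
  interpret primeideal P "ring_of_type_algebra :: 'r ring" by (rule assms(1))
  show ?case using empty I_notcarr one_imp_carrier by auto
next
  case (insert x A)
  interpret primeideal P "ring_of_type_algebra :: 'r ring" by (rule assms(1))
  show ?case using insert I_prime[of "f x" "prod f A"] by auto
qed

lemma prime_mon_expoD:
  fixes P :: "('v::finite, 'k::field) mpoly set"
  assumes "primeideal P ring_of_type_algebra" "mon (expo f) \<in> P"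
  shows "\<exists>v. f v \<noteq> 0 \<and> var v \<in> P"
proof -
  interpret primeideal P "ring_of_type_algebra :: ('v, 'k) mpoly ring" by (rule assms(1))
  obtain v where v: "var v ^ f v \<in> P"
    using primeideal_prodD[OF assms(1) assms(2)[unfolded mon_expo]] by auto
  have "f v \<noteq> 0" using v I_notcarr one_imp_carrier by (metis power_0 type_ring_simps(1,4))
  moreover have "var v \<in> P"
    using primeideal_prodD[OF assms(1), of "\<lambda>_. var v" "{..<f v}"] v by auto
  ultimately show ?thesis by blast
qed

text \<open>
  If a prime contains the cover ideal, then the variables outside it are not a vertex cover, so it
  contains both ends of some edge.
\<close>

lemma minimal_primes_cover_ideal:
  fixes H :: "'v::finite set set"
  assumes H: "simple_graph H"
  shows "minimal_primes ring_of_type_algebra (mono_ideal (edge_powers H 1) :: ('v, 'k::field) mpoly set)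
    = (\<lambda>e. mono_ideal (hits e)) ` H"
proof -
  let ?R = "ring_of_type_algebra :: ('v, 'k) mpoly ring"
  let ?J = "mono_ideal (edge_powers H 1) :: ('v, 'k) mpoly set"
  have id: "is_ideal Q" if "primeideal Q ?R" for Q
    using primeideal.axioms(1)[OF that] by (simp add: ideal_iff_is_ideal)
  have sub: "?J \<subseteq> mono_ideal (hits e)" if "e \<in> H" for e
    using that by (auto simp: mono_ideal_def hits_eq_edge_powers edge_powers_def)
  have gen: "mono_ideal (hits e) \<subseteq> Q" if "is_ideal Q" "\<And>v. v \<in> e \<Longrightarrow> var v \<in> Q"
    for Q :: "('v, 'k) mpoly set" and e
  proof -
    have "ideal Q ?R" using that by (simp add: ideal_iff_is_ideal)
    then have "Idl\<^bsub>?R\<^esub> (var ` e) \<subseteq> Q" using that(2) unfolding genideal_def by blast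
    then show ?thesis by (simp add: Idl_var)
  qed
  have edge_in: "\<exists>e\<in>H. mono_ideal (hits e) \<subseteq> Q" if Q: "primeideal Q ?R" "?J \<subseteq> Q" for Q
  proof (rule ccontr)
    assume no: "\<not> ?thesis"
    have "expo (\<lambda>v. if (var v :: ('v, 'k) mpoly) \<in> Q then 0 else 1) \<in> edge_powers H 1"
    proof (rule cover_in_edge_powers)
      fix e assume "e \<in> H"
      then obtain v where "v \<in> e" "var v \<notin> Q" using no gen[OF id[OF Q(1)], of e] by blast
      then show "\<exists>v\<in>e. Poly_Mapping.lookup (expo (\<lambda>v. if (var v :: ('v, 'k) mpoly) \<in> Q then 0 else 1)) v \<noteq> 0"
        by auto
    qed
    then have "mon (expo (\<lambda>v. if (var v :: ('v, 'k) mpoly) \<in> Q then 0 else 1)) \<in> Q" using Q(2) by auto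
    from prime_mon_expoD[OF Q(1) this] show False by (auto split: if_splits)
  qed
  have var_in: "(var v :: ('v, 'k) mpoly) \<in> mono_ideal (hits e) \<longleftrightarrow> v \<in> e" for v e
    unfolding var_eq_mon mon_in_mono_ideal by (auto simp: hits_def lookup_single when_def)
  have antichain: "e = e'" if "e \<in> H" "e' \<in> H"
    "(mono_ideal (hits e) :: ('v, 'k) mpoly set) \<subseteq> mono_ideal (hits e')" for e e'
  proof (rule card_subset_eq)
    show "e \<subseteq> e'" using that(3) var_in by blast
    show "card e = card e'" using H that by (simp add: simple_graph_def)
  qed simp
  show ?thesis
  proof (intro equalityI subsetI)
    fix P assume "P \<in> minimal_primes ?R ?J"
    then have P: "primeideal P ?R" "?J \<subseteq> P"
      "\<And>Q. primeideal Q ?R \<Longrightarrow> ?J \<subseteq> Q \<Longrightarrow> Q \<subseteq> P \<Longrightarrow> Q = P"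
      unfolding minimal_primes_def by blast+
    then obtain e where e: "e \<in> H" "mono_ideal (hits e) \<subseteq> P" using edge_in by blast
    then show "P \<in> (\<lambda>e. mono_ideal (hits e)) ` H"
      using P(3)[OF primeideal_vars sub[OF e(1)] e(2)] by blast
  next
    fix P :: "('v, 'k) mpoly set" assume "P \<in> (\<lambda>e. mono_ideal (hits e)) ` H"
    then obtain e where e: "e \<in> H" "P = mono_ideal (hits e)" by blast
    have "Q = P" if Q: "primeideal Q ?R" "?J \<subseteq> Q" "Q \<subseteq> P" for Q
    proof -
      obtain e' where e': "e' \<in> H" "mono_ideal (hits e') \<subseteq> Q" using edge_in Q by blast
      then have "e' = e" using antichain[of e' e] e Q(3) by blast
      then show ?thesis using e' e Q(3) by blast
    qed
    then show "P \<in> minimal_primes ?R ?J"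
      using e sub primeideal_vars[of e] unfolding minimal_primes_def by blast
  qed
qed

text \<open>
  At an edge \<open>{u, v}\<close>, a monomial \<open>x\<^sup>a\<close> with \<open>a\<^sub>u + a\<^sub>v \<ge> k\<close> is a multiple of \<open>u\<^sup>j v\<^sup>i\<close> for some
  \<open>i + j = k\<close>. Multiplication by the \<open>k\<close>-th powers of the other variables, which do not belong to the
  prime \<open>(u, v)\<close>, turns it into a multiple of an element of \<open>J\<^sup>k\<close>, since the products of all
  variables but \<open>u\<close>, and of all variables but \<open>v\<close>, belong to \<open>J\<close>.
\<close>

lemma symbolic_power_cover_ideal:
  fixes H :: "'v::finite set set"
  assumes H: "simple_graph H"
  shows "symbolic_power mpoly_ring (cover_ideal H) k = (mono_ideal (edge_powers H k) :: ('v, 'k::field) mpoly set)"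
proof -
  let ?R = "ring_of_type_algebra :: ('v, 'k) mpoly ring"
  let ?J = "mono_ideal (edge_powers H 1) :: ('v, 'k) mpoly set"
  let ?Jk = "?J [^]\<^bsub>ideals_set ?R\<^esub> k"
  have idJ: "is_ideal ?J" by (rule is_ideal_mono_ideal[OF upset_edge_powers])
  have ker: "kernel_to_localization ?R ?Jk (mono_ideal (hits e)) = mono_ideal (edge_powers {e} k)"
    if e: "e \<in> H" for e
  proof -
    have eq: "kernel_to_localization ?R ?Jk (mono_ideal (hits e)) =
        {f. \<exists>w. w \<notin> mono_ideal (hits e) \<and> w * f \<in> ?Jk}"
      by (rule kernel_to_localization_eq[OF is_ideal_ideals_pow[OF idJ] primeideal_vars])
    then have idK: "is_ideal (kernel_to_localization ?R ?Jk (mono_ideal (hits e)))"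
    proof -
      note K = is_idealD[OF is_ideal_ideals_pow[OF idJ, of k]]
      interpret primeideal "mono_ideal (hits e)" ?R by (rule primeideal_vars)
      have one: "1 \<notin> (mono_ideal (hits e) :: ('v, 'k) mpoly set)"
        using I_notcarr one_imp_carrier by auto
      have mult: "v * w \<notin> mono_ideal (hits e)" if "v \<notin> mono_ideal (hits e)" "w \<notin> mono_ideal (hits e)"
        for v w :: "('v, 'k) mpoly"
        using I_prime[of v w] that by auto
      show ?thesis unfolding eq
      proof (rule is_idealI)
        show "0 \<in> {f. \<exists>w. w \<notin> mono_ideal (hits e) \<and> w * f \<in> ?Jk}" using one K(1) by auto
      next
        fix x y assume "x \<in> {f. \<exists>w. w \<notin> mono_ideal (hits e) \<and> w * f \<in> ?Jk}"
          "y \<in> {f. \<exists>w. w \<notin> mono_ideal (hits e) \<and> w * f \<in> ?Jk}"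
        then obtain v w where vw: "v \<notin> mono_ideal (hits e)" "v * x \<in> ?Jk"
          "w \<notin> mono_ideal (hits e)" "w * y \<in> ?Jk" by blast
        have "w * (v * x) + v * (w * y) \<in> ?Jk" using K vw by blast
        then have "(v * w) * (x + y) \<in> ?Jk" by (simp add: algebra_simps)
        then show "x + y \<in> {f. \<exists>w. w \<notin> mono_ideal (hits e) \<and> w * f \<in> ?Jk}"
          using mult[OF vw(1,3)] by blast
      next
        fix r x assume "x \<in> {f. \<exists>w. w \<notin> mono_ideal (hits e) \<and> w * f \<in> ?Jk}"
        then obtain w where w: "w \<notin> mono_ideal (hits e)" "w * x \<in> ?Jk" by blast
        have "w * (r * x) \<in> ?Jk" using K(3)[OF w(2), of r] by (simp add: mult.left_commute)
        then show "r * x \<in> {f. \<exists>w. w \<notin> mono_ideal (hits e) \<and> w * f \<in> ?Jk}" using w by blast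
      qed
    qed
    show ?thesis
    proof (intro equalityI subsetI)
      fix f assume "f \<in> kernel_to_localization ?R ?Jk (mono_ideal (hits e))"
      then obtain w where w: "w \<notin> mono_ideal (hits e)" "w * f \<in> ?Jk" unfolding eq by blast
      have "w * f \<in> mono_ideal (edge_powers H k)"
        using ideals_pow_cover_subset[of ?J H k] w by blast
      then have "w * f \<in> mono_ideal {a. k \<le> (\<Sum>v\<in>e. Poly_Mapping.lookup a v)}"
        using e by (auto simp: mono_ideal_def edge_powers_def)
      then have "f \<in> mono_ideal {a. k \<le> (\<Sum>v\<in>e. Poly_Mapping.lookup a v)}"
        by (rule order_cancel[OF w(1)])
      then show "f \<in> mono_ideal (edge_powers {e} k)" by (simp add: edge_powers_def)
    next
      fix f :: "('v, 'k) mpoly" assume f: "f \<in> mono_ideal (edge_powers {e} k)"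
      have "card e = 2" using H e by (simp add: simple_graph_def)
      then obtain u v where uv: "e = {u, v}" "u \<noteq> v" by (auto simp: card_2_iff)
      show "f \<in> kernel_to_localization ?R ?Jk (mono_ideal (hits e))"
      proof (rule in_ideal_if_mon_in_ideal[OF idK])
        fix a assume "a \<in> Poly_Mapping.keys f"
        then have "a \<in> edge_powers {e} k" using f by (auto simp: mono_ideal_def)
        then have a: "k \<le> Poly_Mapping.lookup a u + Poly_Mapping.lookup a v"
          using uv by (simp add: edge_powers_def)
        define j where "j = min k (Poly_Mapping.lookup a u)"
        define i where "i = k - j"
        have ij: "i + j = k" "j \<le> Poly_Mapping.lookup a u" "i \<le> Poly_Mapping.lookup a v"
          using a by (auto simp: i_def j_def)
        define w where "w = expo (\<lambda>x. if x \<in> e then 0 else k)"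
        define r where "r = expo (\<lambda>x. if x = u then Poly_Mapping.lookup a u - j
          else if x = v then Poly_Mapping.lookup a v - i else Poly_Mapping.lookup a x)"
        \<comment> \<open>The product of the \<open>i\<close>-th power of all variables but \<open>u\<close> and the \<open>j\<close>-th power of all
           variables but \<open>v\<close>.\<close>
        define c where "c = expo (\<lambda>x. if x = u then j else if x = v then i else k)"
        have "mon (all_but u) ^ i * mon (all_but v) ^ j = (mon c :: ('v, 'k) mpoly)"
          unfolding all_but_def c_def mon_expo prod_power_distrib prod.distrib[symmetric]
          using ij(1) uv(2) by (intro prod.cong refl) (auto simp: power_add[symmetric])
        then have "mon c \<in> ?Jk"
          using power_mult_in_ideals_pow[of "mon (all_but u)" ?J "mon (all_but v)" i j]
            all_but_in_edge_powers[OF H] ij(1) by simp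
        moreover have "w + a = r + c"
          using uv ij by (intro poly_mapping_eqI) (auto simp: lookup_add w_def r_def c_def)
        then have "mon w * mon a = mon r * (mon c :: ('v, 'k) mpoly)" by (simp only: mon_add[symmetric])
        ultimately have "mon w * mon a \<in> ?Jk"
          using is_ideal_mult[OF is_ideal_ideals_pow[OF idJ]] by simp
        moreover have "(mon w :: ('v, 'k) mpoly) \<notin> mono_ideal (hits e)"
          unfolding mon_in_mono_ideal by (auto simp: hits_def w_def)
        ultimately show "mon a \<in> kernel_to_localization ?R ?Jk (mono_ideal (hits e))"
          unfolding eq by blast
      qed
    qed
  qed
  have "symbolic_power ?R ?J k = (\<Inter>e\<in>H. kernel_to_localization ?R ?Jk (mono_ideal (hits e)))"
    unfolding symbolic_power_def minimal_primes_cover_ideal[OF H] by simp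
  also have "\<dots> = (\<Inter>e\<in>H. mono_ideal (edge_powers {e} k))" using ker by simp
  also have "\<dots> = mono_ideal (edge_powers H k)" by (auto simp: mono_ideal_def edge_powers_def)
  finally show ?thesis unfolding cover_ideal_eq .
qed

section \<open>Depth of the symbolic powers\<close>

lemma esym_in_maximal_ideal: "1 \<le> j \<Longrightarrow> esym j \<in> mono_ideal (- {0})"
  using homogeneous_esym[of j] by (auto simp: mono_ideal_def homogeneous_def)

lemma regular_sequence_of_prime_filtration:
  fixes U :: "('v::finite \<Rightarrow>\<^sub>0 nat) set"
  assumes "prime_filtration U q 0 {}" "upset U"
  shows "wreg (mono_ideal U :: ('v, 'k::field) mpoly set) (map esym [1..<Suc (CARD('v) - q)])"
proof -
  have "wreg (mono_ideal (hits {} \<union> {a. 0 + a \<in> U}) :: ('v, 'k) mpoly set) (map esym [1..<Suc (CARD('v) - q)])"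
  proof (rule prime_filtration_wreg[OF assms])
    fix A :: "'v set" assume "card A \<le> q"
    then have "CARD('v) - q \<le> card (- A)" by (simp add: Compl_eq_Diff_UNIV card_Diff_subset)
    then show "wreg (mono_ideal (hits A) :: ('v, 'k) mpoly set) (map esym [1..<Suc (CARD('v) - q)])"
      by (rule wreg_esym)
  qed
  moreover have "hits {} \<union> {a. 0 + a \<in> U} = U" by (auto simp: hits_def)
  ultimately show ?thesis by simp
qed

context whiskered
begin

lemma symbolic_power_whiskered:
  "symbolic_power mpoly_ring (cover_ideal H) k = (mono_ideal (edge_powers H k) :: ('a + 'b, 'k::field) mpoly set)"
  by (rule symbolic_power_cover_ideal[OF simple_H])

text \<open>
  A filtration with quotients by at most \<open>t + 1\<close> variables and a choice of \<open>t\<close> whiskers determine the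
  depth.
\<close>

lemma depth_symbolic_power_eqI:
  assumes "1 \<le> k" and filt: "prime_filtration (edge_powers H k) (Suc t) 0 {}"
    and T: "T \<noteq> {}" "\<And>i. i \<in> T \<Longrightarrow> x i \<in> W i" "card T = t"
    and "2 \<le> k \<or> independent_set E (x ` T)"
  shows "depth_quot (symbolic_power mpoly_ring (cover_ideal H) k :: ('a + 'b, 'k::field) mpoly set) =
    enat (CARD('a) + CARD('b) - t - 1)"
  unfolding symbolic_power_whiskered
proof (rule depth_quot_eqI)
  show "is_ideal (mono_ideal (edge_powers H k) :: ('a + 'b, 'k) mpoly set)"
    by (rule is_ideal_mono_ideal[OF upset_edge_powers])
  obtain i where "i \<in> T" using T(1) by blast
  then have "{Inl (x i), Inr i} \<in> H" using T(2) by (intro whisker_edge)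
  then have "0 \<notin> edge_powers H k" using assms(1) by (force simp: edge_powers_def)
  then show "mono_ideal (edge_powers H k) \<subseteq> (mono_ideal (- {0}) :: ('a + 'b, 'k) mpoly set)"
    by (auto simp: mono_ideal_def)
  show "wreg (mono_ideal (edge_powers H k) :: ('a + 'b, 'k) mpoly set) (map esym [1..<Suc (CARD('a + 'b) - Suc t)])"
    by (rule regular_sequence_of_prime_filtration[OF filt upset_edge_powers])
  show "set (map esym [1..<Suc (CARD('a + 'b) - Suc t)]) \<subseteq> (mono_ideal (- {0}) :: ('a + 'b, 'k) mpoly set)"
    using esym_in_maximal_ideal by auto
  show "length (map esym [1..<Suc (CARD('a + 'b) - Suc t)]) = CARD('a) + CARD('b) - t - 1"
    by (simp del: upt_Suc)
  show "length fs \<le> CARD('a) + CARD('b) - t - 1"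
    if "wreg (mono_ideal (edge_powers H k)) fs" "set fs \<subseteq> mono_ideal (- {0})"
    for fs :: "('a + 'b, 'k) mpoly list"
    using no_long_regular_sequence_whiskered[OF assms(1) T(1,2) assms(6) that] T(3) by simp
qed

lemma depth_first:
  "depth_quot (symbolic_power mpoly_ring (cover_ideal H) 1 :: ('a + 'b, 'k::field) mpoly set) =
    enat (CARD('a) + CARD('b) - independence_number E - 1)"
proof -
  obtain A where A: "independent_set E A" "card A = independence_number E"
    by (rule max_independent_set)
  define T where "T = {i. A \<inter> W i \<noteq> {}}"
  define x where "x i = (SOME v. v \<in> A \<inter> W i)" for i
  have x: "x i \<in> A \<inter> W i" if "i \<in> T" for i
    using that some_in_eq[of "A \<inter> W i"] unfolding T_def x_def by blast
  have "A = x ` T"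
  proof
    show "A \<subseteq> x ` T"
    proof
      fix v assume "v \<in> A"
      obtain i where i: "v \<in> W i" using W_cover by blast
      then have "i \<in> T" using \<open>v \<in> A\<close> by (auto simp: T_def)
      then have "v = x i"
        using x[of i] i \<open>v \<in> A\<close> A(1) W_clique[of v i "x i"] unfolding independent_set_def by blast
      then show "v \<in> x ` T" using \<open>i \<in> T\<close> by blast
    qed
  qed (use x in auto)
  moreover have "inj_on x T" using x W_unique by (metis IntD2 inj_onI)
  ultimately have "card T = independence_number E" using A(2) by (simp add: card_image)
  moreover have "independent_set E {undefined}"
    using simple by (auto simp: independent_set_def simple_graph_def)
  then have "1 \<le> independence_number E" using card_independent_le by fastforce
  ultimately show ?thesis
    using prime_filtration_first x A(1) \<open>A = x ` T\<close>
    by (intro depth_symbolic_power_eqI[where T = T and x = x]) auto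
qed

lemma depth_higher:
  assumes "2 \<le> k"
  shows "depth_quot (symbolic_power mpoly_ring (cover_ideal H) k :: ('a + 'b, 'k::field) mpoly set) =
    enat (CARD('a) - 1)"
proof -
  have "\<forall>i. \<exists>y. y \<in> W i" using W_nonempty by blast
  then have "\<exists>x. \<forall>i. x i \<in> W i" by (rule choice)
  then obtain x where "\<And>i. x i \<in> W i" by blast
  then have "depth_quot (symbolic_power mpoly_ring (cover_ideal H) k :: ('a + 'b, 'k) mpoly set) =
      enat (CARD('a) + CARD('b) - CARD('b) - 1)"
    using assms prime_filtration_general by (intro depth_symbolic_power_eqI[where T = UNIV and x = x]) auto
  then show ?thesis by simp
qed

end

theorem corollary3p2:
  fixes E :: "'a::finite set set"
    and W :: "'b::finite \<Rightarrow> 'a set"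
    and J :: "('a + 'b, 'k::field) mpoly set"
    and n m :: nat
  assumes "simple_graph E"
    and "n = CARD('a)" and "m = CARD('b)"
    and "inj W" and "clique_vertex_partition E (range W)"
    and "J = cover_ideal (clique_whiskered E W)"
  shows "(\<forall>k\<ge>1. depth_quot (symbolic_power mpoly_ring J k) =
            enat (if k = 1 then n + m - independence_number E - 1 else n - 1)) \<and>
         sdstab J \<le> 2"
proof
  interpret whiskered E W using assms by unfold_locales auto
  have depth: "depth_quot (symbolic_power mpoly_ring J k) =
      enat (if k = 1 then n + m - independence_number E - 1 else n - 1)" if "k \<ge> 1" for k
    using depth_first depth_higher[of k] that unfolding assms(2,3,6) by auto
  then show "\<forall>k\<ge>1. depth_quot (symbolic_power mpoly_ring J k) =
      enat (if k = 1 then n + m - independence_number E - 1 else n - 1)" by blast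
  have "eventually (\<lambda>t. depth_quot (symbolic_power mpoly_ring J t) = enat (n - 1)) sequentially"
    using eventually_ge_at_top[of 2] by eventually_elim (use depth in auto)
  then have "(\<lambda>t. depth_quot (symbolic_power mpoly_ring J t)) \<longlonglongrightarrow> enat (n - 1)"
    by (rule tendsto_eventually)
  then have "lim (\<lambda>t. depth_quot (symbolic_power mpoly_ring J t)) = enat (n - 1)"
    by (rule limI)
  then show "sdstab J \<le> 2"
    unfolding sdstab_def using depth by (intro Least_le) auto
qed

end
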